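(* There exists a real-analytic singular Levi-flat hypersurface $H \subset \mathbb{P}^2$ with all leaves complex hyperplanes, such that $H^*$ (and hence $H$) is not contained in any proper real-algebraic subvariety of $\mathbb{P}^2$.
   Context: $\mathbb{P}^2$ is the complex projective plane; complex hyperplanes in it are complex projective lines. A real-analytic subvariety of $\mathbb{P}^2$ is a closed subset which near every point of $\mathbb{P}^2$ is the common zero set of a family of real-analytic functions. A real-analytic singular Levi-flat hypersurface is a real-analytic subvariety $H \subset \mathbb{P}^2$ of real codimension one (real dimension 3), possibly with singularities, that is Levi-flat in the following sense. Let $H^*$ be the set of points of $H$ near which $H$ is a real-analytic submanifold of dimension $3$. $H$ is Levi-flat if near every point of $H^*$ there are local holomorphic coordinates $\zeta$ in which $H^*$ is given by $\operatorname{Im}\zeta_1 = 0$; the complex hypersurfaces $\{\zeta_1 = t\}$, $t \in \mathbb{R}$, define the Levi-foliation of $H^*$. When a leaf of the Levi-foliation is closed in $H^*$, the closure of that leaf in $\mathbb{P}^2$ is regarded as the leaf itself. A real-algebraic subvariety of $\mathbb{P}^2$ is the zero set of a bihomogeneous polynomial $\rho(z,\bar z)$ in the homogeneous coordinates $z = (z_0,z_1,z_2)$, i.e. a polynomial with $\rho(\lambda z,\overline{\lambda z}) = |\lambda|^{2k}\rho(z,\bar z)$ for all $\lambda \in \mathbb{C}$, for some integer $k$. It is proper if it is not all of $\mathbb{P}^2$. *)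

theory Defs
  imports "HOL-Analysis.Analysis"
begin

section \<open>The complex projective plane\<close>

definition proportional :: "complex^3 \<Rightarrow> complex^3 \<Rightarrow> bool" where
  "proportional z w \<longleftrightarrow> z \<noteq> 0 \<and> w \<noteq> 0 \<and> (\<exists>c. c \<noteq> 0 \<and> w = c *s z)"

lemma part_equivp_proportional: "part_equivp proportional"
proof (rule part_equivpI)
  show "\<exists>z. proportional z z"
    by (rule exI[of _ "axis 1 1"]) (auto simp: proportional_def intro!: exI[of _ 1])
  show "symp proportional"
  proof (rule sympI)
    fix z w assume "proportional z w"
    then obtain c where c: "z \<noteq> 0" "w \<noteq> 0" "c \<noteq> 0" "w = c *s z"
      by (auto simp: proportional_def)
    then have "z = inverse c *s w"
      by (simp add: vector_smult_assoc)
    with c show "proportional w z"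
      unfolding proportional_def using inverse_nonzero_iff_nonzero by blast
  qed
  show "transp proportional"
    by (rule transpI) (auto simp: proportional_def vector_smult_assoc)
qed

text \<open>\<open>proj z\<close> is the point with homogeneous coordinates \<open>z\<close>; it is meaningful only for
  \<open>z \<noteq> 0\<close>.\<close>

quotient_type cp2 = "complex^3" / partial: proportional
  morphisms rep_cp2 proj
  by (rule part_equivp_proportional)

lemma proj_eq_iff:
  assumes "z \<noteq> 0" "w \<noteq> 0"
  shows "proj z = proj w \<longleftrightarrow> (\<exists>c. c \<noteq> 0 \<and> w = c *s z)"
proof -
  have refl: "proportional x x" if "x \<noteq> 0" for x
    using that by (auto simp: proportional_def intro!: exI[of _ 1])
  show ?thesis
    using Quotient_rel[OF Quotient_cp2, of z w] refl[OF assms(1)] refl[OF assms(2)] assms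
    by (auto simp: proportional_def)
qed

lemma proj_surj: "\<exists>z. z \<noteq> 0 \<and> p = proj z"
  using Quotient_abs_rep[OF Quotient_cp2, of p] Quotient_rep_reflp[OF Quotient_cp2, of p]
  unfolding proportional_def by metis

instantiation cp2 :: topological_space
begin

definition open_cp2 :: "cp2 set \<Rightarrow> bool" where
  "open_cp2 U \<longleftrightarrow> open {z. z \<noteq> 0 \<and> proj z \<in> U}"

instance
proof
  have "{z :: complex^3. z \<noteq> 0 \<and> proj z \<in> UNIV} = - {0}"
    by auto
  then show "open (UNIV :: cp2 set)"
    unfolding open_cp2_def by (metis open_Compl closed_singleton)
next
  fix S T :: "cp2 set"
  assume "open S" "open T"
  then have "open ({z. z \<noteq> 0 \<and> proj z \<in> S} \<inter> {z. z \<noteq> 0 \<and> proj z \<in> T})"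
    unfolding open_cp2_def by (rule open_Int)
  moreover have "{z. z \<noteq> 0 \<and> proj z \<in> S} \<inter> {z. z \<noteq> 0 \<and> proj z \<in> T}
      = {z. z \<noteq> 0 \<and> proj z \<in> S \<inter> T}"
    by auto
  ultimately show "open (S \<inter> T)"
    unfolding open_cp2_def by simp
next
  fix K :: "cp2 set set"
  assume "\<forall>S\<in>K. open S"
  then have "open (\<Union>S\<in>K. {z. z \<noteq> 0 \<and> proj z \<in> S})"
    unfolding open_cp2_def by blast
  moreover have "(\<Union>S\<in>K. {z. z \<noteq> 0 \<and> proj z \<in> S}) = {z. z \<noteq> 0 \<and> proj z \<in> \<Union>K}"
    by auto
  ultimately show "open (\<Union>K)"
    unfolding open_cp2_def by simp
qed

end

text \<open>
  The inverse of the standard affine chart on \<open>z\<^sub>i \<noteq> 0\<close>: the \<open>i\<close>-th homogeneous coordinate is 1.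
  Arithmetic in the index type \<open>3\<close> is modulo 3, so the affine coordinates are
  \<open>w\<^sub>1 = z\<^bsub>i+1\<^esub> / z\<^sub>i\<close> and \<open>w\<^sub>2 = z\<^bsub>i+2\<^esub> / z\<^sub>i\<close>.
\<close>

definition affine_point :: "3 \<Rightarrow> complex^2 \<Rightarrow> cp2" where
  "affine_point i w = proj (\<chi> j. if j = i then 1 else if j = i + 1 then w $ 1 else w $ 2)"

definition complex_hyperplane :: "cp2 set \<Rightarrow> bool" where
  "complex_hyperplane L \<longleftrightarrow>
     (\<exists>a :: complex^3. a \<noteq> 0 \<and> L = {proj z | z. z \<noteq> 0 \<and> (\<Sum>j\<in>UNIV. a $ j * z $ j) = 0})"


section \<open>Real-analytic subvarieties\<close>

text \<open>Local expansion as a convergent multivariate power series; a multi-index is a function on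
  the standard basis.\<close>

definition real_analytic_at :: "('a::euclidean_space \<Rightarrow> real) \<Rightarrow> 'a \<Rightarrow> bool" where
  "real_analytic_at f p \<longleftrightarrow>
     (\<exists>c r. r > 0 \<and>
        (\<forall>x\<in>ball p r.
           ((\<lambda>\<alpha>. c \<alpha> * (\<Prod>b\<in>Basis. ((x - p) \<bullet> b) ^ \<alpha> b)) has_sum f x)
             (Basis \<rightarrow>\<^sub>E (UNIV :: nat set))))"

definition real_analytic_on :: "(cp2 \<Rightarrow> real) \<Rightarrow> cp2 set \<Rightarrow> bool" where
  "real_analytic_on f U \<longleftrightarrow>
     (\<forall>i w. affine_point i w \<in> U \<longrightarrow> real_analytic_at (\<lambda>v. f (affine_point i v)) w)"

definition real_analytic_subvariety :: "cp2 set \<Rightarrow> bool" where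
  "real_analytic_subvariety H \<longleftrightarrow>
     closed H \<and>
     (\<forall>p. \<exists>U F. open U \<and> p \<in> U \<and> (\<forall>f\<in>F. real_analytic_on f U) \<and>
        H \<inter> U = {q \<in> U. \<forall>f\<in>F. f q = 0})"

text \<open>
  Near its point \<open>p\<close>, the set \<open>H\<close> is a real-analytic submanifold of real dimension \<open>d\<close>: the common
  zero set of \<open>4 - d\<close> real-analytic functions whose differentials are linearly independent along
  \<open>H\<close>. For \<open>d = 4\<close> there are no functions, and \<open>H\<close> is a neighbourhood of \<open>p\<close>.
\<close>

definition submanifold_near :: "nat \<Rightarrow> cp2 set \<Rightarrow> cp2 \<Rightarrow> bool" where
  "submanifold_near d H p \<longleftrightarrow>
     d \<le> 4 \<and> p \<in> H \<and>
     (\<exists>U f. open U \<and> p \<in> U \<and> (\<forall>k<4 - d. real_analytic_on (f k) U) \<and>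
        H \<inter> U = {q \<in> U. \<forall>k<4 - d. f k q = 0} \<and>
        (\<forall>i w. affine_point i w \<in> H \<inter> U \<longrightarrow>
           (\<forall>c :: nat \<Rightarrow> real.
              (\<forall>h. (\<Sum>k<4 - d. c k *
                      frechet_derivative (\<lambda>v. f k (affine_point i v)) (at w) h) = 0) \<longrightarrow>
              (\<forall>k<4 - d. c k = 0))))"

definition has_real_dimension :: "cp2 set \<Rightarrow> nat \<Rightarrow> bool" where
  "has_real_dimension H d \<longleftrightarrow>
     (\<exists>p. submanifold_near d H p) \<and> (\<forall>e>d. \<forall>p. \<not> submanifold_near e H p)"

text \<open>The set \<open>H\<^sup>*\<close>.\<close>

definition regular_part :: "cp2 set \<Rightarrow> cp2 set" where
  "regular_part H = {p. submanifold_near 3 H p}"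


section \<open>Levi-flat hypersurfaces and their leaves\<close>

text \<open>Holomorphic means complex-differentiable in the affine coordinates. By the inverse function
  theorem, an injective map with invertible complex Jacobian matrix is biholomorphic onto an open
  subset of \<open>\<complex>\<^sup>2\<close>.\<close>

definition holomorphic_coordinates :: "cp2 set \<Rightarrow> (cp2 \<Rightarrow> complex^2) \<Rightarrow> bool" where
  "holomorphic_coordinates U \<zeta> \<longleftrightarrow>
     open U \<and> inj_on \<zeta> U \<and>
     (\<forall>i w. affine_point i w \<in> U \<longrightarrow>
        (\<exists>A :: complex^2^2. invertible A \<and>
           ((\<lambda>v. \<zeta> (affine_point i v)) has_derivative (\<lambda>h. A *v h)) (at w)))"

definition levi_chart :: "cp2 set \<Rightarrow> cp2 set \<Rightarrow> (cp2 \<Rightarrow> complex^2) \<Rightarrow> bool" where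
  "levi_chart H U \<zeta> \<longleftrightarrow>
     holomorphic_coordinates U \<zeta> \<and> regular_part H \<inter> U = {q \<in> U. Im (\<zeta> q $ 1) = 0}"

definition levi_flat :: "cp2 set \<Rightarrow> bool" where
  "levi_flat H \<longleftrightarrow> (\<forall>p\<in>regular_part H. \<exists>U \<zeta>. p \<in> U \<and> levi_chart H U \<zeta>)"

definition levi_flat_hypersurface :: "cp2 set \<Rightarrow> bool" where
  "levi_flat_hypersurface H \<longleftrightarrow>
     real_analytic_subvariety H \<and> has_real_dimension H 3 \<and> levi_flat H"

text \<open>
  The plaques of the Levi-foliation are the connected components of the local complex hypersurfaces
  \<open>{\<zeta>\<^sub>1 = t}\<close>, and the leaf through \<open>p\<close> consists of the points that can be joined to \<open>p\<close> by a
  finite chain of plaques.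
\<close>

definition same_plaque :: "cp2 set \<Rightarrow> cp2 \<Rightarrow> cp2 \<Rightarrow> bool" where
  "same_plaque H p q \<longleftrightarrow>
     (\<exists>U \<zeta> (t::real). levi_chart H U \<zeta> \<and>
        connected_component {x \<in> U. \<zeta> x $ 1 = complex_of_real t} p q)"

definition levi_leaves :: "cp2 set \<Rightarrow> cp2 set set" where
  "levi_leaves H = (\<lambda>p. {q. (same_plaque H)\<^sup>*\<^sup>* p q}) ` regular_part H"

text \<open>A leaf that is closed in \<open>H\<^sup>*\<close> is identified with its closure in the projective plane.\<close>

definition all_leaves_hyperplanes :: "cp2 set \<Rightarrow> bool" where
  "all_leaves_hyperplanes H \<longleftrightarrow>
     (\<forall>L\<in>levi_leaves H.
        closedin (top_of_set (regular_part H)) L \<and> complex_hyperplane (closure L))"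


section \<open>Real-algebraic subvarieties\<close>

text \<open>Complex polynomials in \<open>z\<close> and its conjugate; \<open>\<alpha>\<close> and \<open>\<beta>\<close> are multi-indices.\<close>

definition polynomial_z_zbar :: "(complex^3 \<Rightarrow> complex) \<Rightarrow> bool" where
  "polynomial_z_zbar \<rho> \<longleftrightarrow>
     (\<exists>(I :: ((nat^3) \<times> (nat^3)) set) c. finite I \<and>
        (\<forall>z. \<rho> z = (\<Sum>(\<alpha>, \<beta>)\<in>I.
           c \<alpha> \<beta> * (\<Prod>j\<in>UNIV. (z $ j) ^ (\<alpha> $ j)) * (\<Prod>j\<in>UNIV. cnj (z $ j) ^ (\<beta> $ j)))))"

definition bihomogeneous :: "(complex^3 \<Rightarrow> complex) \<Rightarrow> bool" where
  "bihomogeneous \<rho> \<longleftrightarrow>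
     (\<exists>k::int. \<forall>c z. \<rho> (c *s z) = complex_of_real (cmod c powi (2 * k)) * \<rho> z)"

definition real_algebraic_subvariety :: "cp2 set \<Rightarrow> bool" where
  "real_algebraic_subvariety V \<longleftrightarrow>
     (\<exists>\<rho>. polynomial_z_zbar \<rho> \<and> bihomogeneous \<rho> \<and> V = {proj z | z. z \<noteq> 0 \<and> \<rho> z = 0})"

end

theory Submission
  imports Defs "HOL-Complex_Analysis.Complex_Analysis"
begin

text \<open>
  The example is the union \<open>H\<close> of the complex lines
  \<open>L\<^sub>t = {z. z\<^sub>1 cos t + z\<^sub>2 sin t = z\<^sub>3 sin (cos t)}\<close> for real \<open>t\<close>. The dual curve
  \<open>a t = (cos t, sin t, - sin (cos t))\<close> is entire, real on the real axis and satisfies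
  \<open>a (t + \<pi>) = - a t\<close>; write \<open>g\<^sub>z s = a s \<bullet> z\<close>, so that \<open>z \<in> H\<close> means that \<open>g\<^sub>z\<close> has a real root.

  \<^emph>\<open>Why \<open>H\<close> is analytic.\<close> The union of an analytic family of lines is in general only
  subanalytic: two real roots of \<open>g\<^sub>z\<close> can collide and leave the real axis as a conjugate pair
  \<open>s, cnj s\<close>, and then \<open>z\<close> leaves the union although every analytic equation of the union still
  vanishes at \<open>z\<close>. Here such a \<open>z\<close> is orthogonal to \<open>a s\<close> and to its conjugate, so it is a point of
  the real projective plane, and all real points belong to \<open>H\<close>: a real antiperiodic function has a
  real root. Hence, near a given point, \<open>H\<close> is the zero set of the product of all
  \<open>s\<^sub>i - cnj s\<^sub>j\<close>, where \<open>s\<^sub>i\<close> and \<open>s\<^sub>j\<close> run over the roots of \<open>g\<^sub>z\<close> in a small disc around a real root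
  (lemmas \<open>conj_resultant_eq_0_iff\<close>, \<open>conjugate_roots_imp_real_root\<close>, \<open>local_equation\<close>). By Newton's
  identities this product is a polynomial in the power sums of the roots and their conjugates,
  and by the argument principle the power sums are convergent power series in \<open>z\<close>
  (\<open>root_sum_multi_analytic\<close>).

  \<^emph>\<open>Regular points and leaves.\<close> A point of \<open>H\<close> is regular exactly when \<open>g\<^sub>z\<close> has a single real root
  modulo \<open>\<pi>\<close> and this root is simple (\<open>regular_part_iff\<close>). Indeed two distinct lines through a point
  span its tangent space, which leaves no room for a nonzero differential, and a point with a multiple root is a limit of
  such crossing points. At a point with a single simple root, the root is a holomorphic function of
  \<open>z\<close> and serves as the first coordinate of a Levi chart, with the lines \<open>L\<^sub>t\<close> as plaques. The
  real points cut \<open>L\<^sub>t\<close> into two halves. On the line at infinity \<open>z\<^sub>3 = 0\<close>, however, \<open>g\<^sub>z\<close> is a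
  shifted sine, with a single simple root; so \<open>L\<^sub>t\<close> has a real point that is regular, the two
  halves belong to one leaf, and the closure of this leaf is \<open>L\<^sub>t\<close> (\<open>closure_leaf\<close>,
  \<open>levi_leaf_eq_leaf\<close>).

  \<^emph>\<open>Why \<open>H\<close> is not algebraic.\<close> A polynomial in \<open>z\<close> and its conjugate that vanishes on \<open>H\<close> gives a
  polynomial relation between \<open>cos t\<close>, \<open>sin t\<close> and \<open>sin (cos t)\<close>, which extends to complex \<open>t\<close>. At the
  infinitely many \<open>t\<close> with \<open>cos t = w + 2 \<pi> n\<close> the third function has one and the same value, and a Laurent
  polynomial in \<open>exp (\<i> t)\<close> with infinitely many zeros is zero. So \<open>sin (cos t)\<close> may be
  replaced by any number, and the polynomial vanishes on all real lines except possibly the line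
  at infinity; as every point lies on a real line, it vanishes everywhere by continuity
  (\<open>algebraic_hull_of_regular_part\<close>).
\<close>

(* The notation for coefficients of formal power series would clash with that for vector components. *)
no_notation fps_nth (infixl "$" 75)

section \<open>Majorized power series\<close>

abbreviation multi_indices :: "('a::euclidean_space \<Rightarrow> nat) set" where
  "multi_indices \<equiv> Basis \<rightarrow>\<^sub>E UNIV"

definition multi_degree :: "('a::euclidean_space \<Rightarrow> nat) \<Rightarrow> nat" where
  "multi_degree \<alpha> = (\<Sum>b\<in>Basis. \<alpha> b)"

definition monomial :: "'a::euclidean_space \<Rightarrow> ('a \<Rightarrow> nat) \<Rightarrow> real" where
  "monomial h \<alpha> = (\<Prod>b\<in>Basis. (h \<bullet> b) ^ \<alpha> b)"

definition in_cube :: "'a::euclidean_space \<Rightarrow> real \<Rightarrow> 'a \<Rightarrow> bool" where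
  "in_cube p t x \<longleftrightarrow> (\<forall>b\<in>Basis. \<bar>(x - p) \<bullet> b\<bar> \<le> t)"

text \<open>The absolute values of the coefficients, weighted by the powers of \<open>t\<close>, sum to at most
  \<open>M\<close>, and the series represents the function on the cube of radius \<open>t\<close>. The norms so
  defined are submultiplicative, so sums, products and infinite series of analytic functions are handled without
  any estimate on derivatives.\<close>

definition majorized :: "'a::euclidean_space \<Rightarrow> real \<Rightarrow> real \<Rightarrow> ('a \<Rightarrow> complex) \<Rightarrow> bool" where
  "majorized p t M f \<longleftrightarrow>
     (\<exists>c m. ((\<lambda>\<alpha>. norm (c \<alpha>) * t ^ multi_degree \<alpha>) has_sum m) multi_indices \<and> m \<le> M \<and>
        (\<forall>x. in_cube p t x \<longrightarrow>
           ((\<lambda>\<alpha>. c \<alpha> * of_real (monomial (x - p) \<alpha>)) has_sum f x) multi_indices))"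

lemma abs_monomial_le:
  assumes "in_cube p t x"
  shows "\<bar>monomial (x - p) \<alpha>\<bar> \<le> t ^ multi_degree \<alpha>"
proof -
  have "\<bar>monomial (x - p) \<alpha>\<bar> = (\<Prod>b\<in>Basis. \<bar>(x - p) \<bullet> b\<bar> ^ \<alpha> b)"
    by (simp add: monomial_def abs_prod power_abs)
  also have "\<dots> \<le> (\<Prod>b\<in>Basis. t ^ \<alpha> b)"
    using assms by (intro prod_mono) (auto simp: in_cube_def power_mono)
  finally show ?thesis
    by (simp add: multi_degree_def power_sum)
qed

text \<open>An absolutely convergent series of monomials may list a monomial any number of times: the coefficient of a
  monomial is then an infinite sum, taken over the fibre of \<open>\<alpha>\<close>. The series for infinite sums
  and for products are brought into standard form in this way.\<close>

lemma majorized_regroup: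
  fixes \<alpha> :: "'i \<Rightarrow> 'a::euclidean_space \<Rightarrow> nat"
  assumes t: "t > 0" and \<alpha>: "\<And>i. i \<in> J \<Longrightarrow> \<alpha> i \<in> multi_indices"
    and norms: "((\<lambda>i. norm (k i) * t ^ multi_degree (\<alpha> i)) has_sum m) J" "m \<le> M"
    and sums: "\<And>x. in_cube p t x \<Longrightarrow>
      ((\<lambda>i. k i * of_real (monomial (x - p) (\<alpha> i))) has_sum f x) J"
  shows "majorized p t M f"
proof -
  define F where "F \<gamma> = {i \<in> J. \<alpha> i = \<gamma>}" for \<gamma>
  define c where "c \<gamma> = infsum k (F \<gamma>)" for \<gamma>
  define d where "d \<gamma> = infsum (\<lambda>i. norm (k i)) (F \<gamma>) * t ^ multi_degree \<gamma>" for \<gamma>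
  have bij: "bij_betw (\<lambda>i. (\<alpha> i, i)) J (Sigma multi_indices F)"
    using \<alpha> by (auto simp: bij_betw_def inj_on_def F_def)
  have fibre_abs: "(\<lambda>i. norm (k i)) summable_on F \<gamma>" for \<gamma>
  proof -
    have "(\<lambda>i. norm (k i) * t ^ multi_degree (\<alpha> i)) summable_on F \<gamma>"
      using has_sum_imp_summable[OF norms(1)]
      by (rule summable_on_subset_banach) (auto simp: F_def)
    then have "(\<lambda>i. norm (k i) * t ^ multi_degree \<gamma>) summable_on F \<gamma>"
      by (rule summable_on_cong[THEN iffD1, rotated]) (auto simp: F_def)
    then have "(\<lambda>i. norm (k i) * t ^ multi_degree \<gamma> * inverse (t ^ multi_degree \<gamma>)) summable_on F \<gamma>"
      by (rule summable_on_cmult_left)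
    moreover have "t ^ multi_degree \<gamma> \<noteq> 0"
      using t by simp
    ultimately show ?thesis
      by (simp add: mult.assoc)
  qed
  then have fibre: "(k has_sum c \<gamma>) (F \<gamma>)" for \<gamma>
    unfolding c_def by (simp add: abs_summable_summable)
  have d_sum: "(d has_sum m) multi_indices"
  proof (rule has_sum_SigmaD)
    show "((\<lambda>(\<gamma>, i). norm (k i) * t ^ multi_degree \<gamma>) has_sum m) (Sigma multi_indices F)"
      using norms(1) by (subst has_sum_reindex_bij_betw[OF bij, symmetric]) simp
    show "((\<lambda>i. case (\<gamma>, i) of (\<gamma>, i) \<Rightarrow> norm (k i) * t ^ multi_degree \<gamma>) has_sum d \<gamma>) (F \<gamma>)" for \<gamma>
      unfolding d_def using fibre_abs by (simp add: has_sum_cmult_left)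
  qed
  have c_le: "norm (c \<gamma>) * t ^ multi_degree \<gamma> \<le> d \<gamma>" for \<gamma>
    unfolding c_def d_def using fibre_abs t by (intro mult_right_mono norm_infsum_bound) auto
  have c_summable: "(\<lambda>\<gamma>. norm (c \<gamma>) * t ^ multi_degree \<gamma>) summable_on multi_indices"
    by (rule summable_on_comparison_test[OF has_sum_imp_summable[OF d_sum]]) (use c_le t in auto)
  have "(\<Sum>\<^sub>\<infinity>\<gamma>\<in>multi_indices. norm (c \<gamma>) * t ^ multi_degree \<gamma>) \<le> m"
    using has_sum_mono[OF has_sum_infsum[OF c_summable] d_sum] c_le by blast
  moreover have "((\<lambda>\<gamma>. c \<gamma> * of_real (monomial (x - p) \<gamma>)) has_sum f x) multi_indices"
    if "in_cube p t x" for x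
  proof (rule has_sum_SigmaD)
    show "((\<lambda>(\<gamma>, i). k i * of_real (monomial (x - p) \<gamma>)) has_sum f x) (Sigma multi_indices F)"
      using sums[OF that] by (subst has_sum_reindex_bij_betw[OF bij, symmetric]) simp
    show "((\<lambda>i. case (\<gamma>, i) of (\<gamma>, i) \<Rightarrow> k i * of_real (monomial (x - p) \<gamma>))
        has_sum c \<gamma> * of_real (monomial (x - p) \<gamma>)) (F \<gamma>)" for \<gamma>
      using fibre by (simp add: has_sum_cmult_left)
  qed
  ultimately show ?thesis
    unfolding majorized_def using has_sum_infsum[OF c_summable] norms(2) by (meson order_trans)
qed

lemma majorized_infsum:
  fixes f :: "'i \<Rightarrow> 'a::euclidean_space \<Rightarrow> complex"
  assumes t: "t > 0" and f: "\<And>n. n \<in> A \<Longrightarrow> majorized p t (M n) (f n)"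
    and M: "(M has_sum T) A"
    and sums: "\<And>x. in_cube p t x \<Longrightarrow> ((\<lambda>n. f n x) has_sum g x) A"
  shows "majorized p t T g"
proof -
  have "\<forall>n\<in>A. \<exists>c m. ((\<lambda>\<alpha>. norm (c \<alpha>) * t ^ multi_degree \<alpha>) has_sum m) multi_indices \<and> m \<le> M n \<and>
        (\<forall>x. in_cube p t x \<longrightarrow>
           ((\<lambda>\<alpha>. c \<alpha> * of_real (monomial (x - p) \<alpha>)) has_sum f n x) multi_indices)"
    using f unfolding majorized_def by blast
  from this[THEN bchoice] obtain c where "\<forall>n\<in>A. \<exists>m. ((\<lambda>\<alpha>. norm (c n \<alpha>) * t ^ multi_degree \<alpha>) has_sum m) multi_indices
      \<and> m \<le> M n \<and> (\<forall>x. in_cube p t x \<longrightarrow>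
           ((\<lambda>\<alpha>. c n \<alpha> * of_real (monomial (x - p) \<alpha>)) has_sum f n x) multi_indices)"
    by blast
  from this[THEN bchoice] obtain m
    where c: "\<And>n. n \<in> A \<Longrightarrow> ((\<lambda>\<alpha>. norm (c n \<alpha>) * t ^ multi_degree \<alpha>) has_sum m n) multi_indices"
      and m: "\<And>n. n \<in> A \<Longrightarrow> m n \<le> M n"
      and f_sum: "\<And>n x. n \<in> A \<Longrightarrow> in_cube p t x \<Longrightarrow>
        ((\<lambda>\<alpha>. c n \<alpha> * of_real (monomial (x - p) \<alpha>)) has_sum f n x) multi_indices"
    by blast
  define J where "J = Sigma A (\<lambda>_. multi_indices :: ('a \<Rightarrow> nat) set)"
  have m0: "0 \<le> m n" if "n \<in> A" for n
    using has_sum_nonneg[OF c[OF that]] t by auto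
  have m_summable: "m summable_on A"
    by (rule summable_on_comparison_test[OF has_sum_imp_summable[OF M]]) (use m m0 in auto)
  have norm_summable: "(\<lambda>(n, \<alpha>). norm (c n \<alpha>) * t ^ multi_degree \<alpha>) summable_on J"
    unfolding J_def
  proof (rule summable_on_SigmaI[OF _ m_summable])
    show "((\<lambda>\<alpha>. case (n, \<alpha>) of (n, \<alpha>) \<Rightarrow> norm (c n \<alpha>) * t ^ multi_degree \<alpha>) has_sum m n) multi_indices"
      if "n \<in> A" for n
      using c[OF that] by simp
  qed (use t in auto)
  have norm_sum: "((\<lambda>(n, \<alpha>). norm (c n \<alpha>) * t ^ multi_degree \<alpha>) has_sum infsum m A) J"
    unfolding J_def
  proof (rule has_sum_SigmaI[OF _ has_sum_infsum[OF m_summable] norm_summable[unfolded J_def]])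
    show "((\<lambda>\<alpha>. case (n, \<alpha>) of (n, \<alpha>) \<Rightarrow> norm (c n \<alpha>) * t ^ multi_degree \<alpha>) has_sum m n) multi_indices"
      if "n \<in> A" for n
      using c[OF that] by simp
  qed
  have le: "infsum m A \<le> T"
    using has_sum_mono[OF has_sum_infsum[OF m_summable] M] m by blast
  show ?thesis
  proof (rule majorized_regroup[where J = J and \<alpha> = snd and k = "\<lambda>(n, \<alpha>). c n \<alpha>"])
    show "((\<lambda>i. norm (case i of (n, \<alpha>) \<Rightarrow> c n \<alpha>) * t ^ multi_degree (snd i)) has_sum infsum m A) J"
      using norm_sum by (simp add: case_prod_unfold)
    show "((\<lambda>i. (case i of (n, \<alpha>) \<Rightarrow> c n \<alpha>) * of_real (monomial (x - p) (snd i))) has_sum g x) J"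
      if x: "in_cube p t x" for x
      unfolding J_def
    proof (rule has_sum_SigmaI)
      show "(\<lambda>i. (case i of (n, \<alpha>) \<Rightarrow> c n \<alpha>) * of_real (monomial (x - p) (snd i)))
          summable_on Sigma A (\<lambda>_. multi_indices)"
      proof (rule abs_summable_summable, rule summable_on_comparison_test[OF norm_summable[unfolded J_def]])
        show "norm ((case i of (n, \<alpha>) \<Rightarrow> c n \<alpha>) * of_real (monomial (x - p) (snd i)))
            \<le> (case i of (n, \<alpha>) \<Rightarrow> norm (c n \<alpha>) * t ^ multi_degree \<alpha>)" for i
          using abs_monomial_le[OF x] by (auto simp: case_prod_unfold norm_mult intro!: mult_left_mono)
      qed auto
      show "((\<lambda>n. f n x) has_sum g x) A"
        by (rule sums[OF x])
      show "((\<lambda>\<alpha>. (case (n, \<alpha>) of (n, \<alpha>) \<Rightarrow> c n \<alpha>) * of_real (monomial (x - p) (snd (n, \<alpha>))))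
          has_sum f n x) multi_indices" if "n \<in> A" for n
        using f_sum[OF that x] by simp
    qed
    show "snd i \<in> multi_indices" if "i \<in> J" for i
      using that by (auto simp: J_def)
  qed (fact t, fact le)
qed

lemma majorized_mono: "majorized p t M f \<Longrightarrow> M \<le> N \<Longrightarrow> majorized p t N f"
  unfolding majorized_def by (meson order_trans)

lemma majorized_nonneg:
  fixes p :: "'a::euclidean_space"
  assumes "majorized p t M f" "t > 0"
  shows "0 \<le> M"
proof -
  obtain c :: "('a \<Rightarrow> nat) \<Rightarrow> complex" and m where "((\<lambda>\<alpha>. norm (c \<alpha>) * t ^ multi_degree \<alpha>) has_sum m) (multi_indices :: ('a \<Rightarrow> nat) set)" "m \<le> M"
    using assms unfolding majorized_def by blast
  moreover from this(1) have "0 \<le> m"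
    by (rule has_sum_nonneg) (use assms in auto)
  ultimately show ?thesis by linarith
qed

lemma majorized_add:
  assumes t: "t > 0" and "majorized p t M f" "majorized p t N g"
  shows "majorized p t (M + N) (\<lambda>x. f x + g x)"
  by (rule majorized_infsum[OF t, where A = UNIV and f = "\<lambda>b. if b then f else g"
        and M = "\<lambda>b. if b then M else N"])
    (use assms in \<open>auto intro!: has_sum_finiteI simp: UNIV_bool\<close>)

text \<open>The product series is indexed by pairs of multi-indices; regrouping by their sum is the Cauchy product.\<close>

lemma majorized_mult:
  fixes f g :: "'a::euclidean_space \<Rightarrow> complex"
  assumes t: "t > 0" and f: "majorized p t M f" and g: "majorized p t N g"
  shows "majorized p t (M * N) (\<lambda>x. f x * g x)"
proof -
  obtain c m where c: "((\<lambda>\<alpha>. norm (c \<alpha>) * t ^ multi_degree \<alpha>) has_sum m) multi_indices" "m \<le> M"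
    and f_sum: "\<And>x. in_cube p t x \<Longrightarrow>
      ((\<lambda>\<alpha>. c \<alpha> * of_real (monomial (x - p) \<alpha>)) has_sum f x) multi_indices"
    using f unfolding majorized_def by blast
  obtain d n where d: "((\<lambda>\<alpha>. norm (d \<alpha>) * t ^ multi_degree \<alpha>) has_sum n) multi_indices" "n \<le> N"
    and g_sum: "\<And>x. in_cube p t x \<Longrightarrow>
      ((\<lambda>\<alpha>. d \<alpha> * of_real (monomial (x - p) \<alpha>)) has_sum g x) multi_indices"
    using g unfolding majorized_def by blast
  have m0: "0 \<le> m" "0 \<le> n"
    using has_sum_nonneg[OF c(1)] has_sum_nonneg[OF d(1)] t by auto
  define J where "J = Sigma (multi_indices :: ('a \<Rightarrow> nat) set) (\<lambda>_. multi_indices :: ('a \<Rightarrow> nat) set)"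
  define add where "add = (\<lambda>(\<alpha> :: 'a \<Rightarrow> nat, \<beta>). \<lambda>b\<in>Basis. \<alpha> b + \<beta> b)"
  have deg: "multi_degree (add (\<alpha>, \<beta>)) = multi_degree \<alpha> + multi_degree \<beta>" for \<alpha> \<beta>
    by (simp add: add_def multi_degree_def sum.distrib)
  have mon: "monomial x (add (\<alpha>, \<beta>)) = monomial x \<alpha> * monomial x \<beta>" for x \<alpha> \<beta>
    by (simp add: add_def monomial_def prod.distrib power_add)
  have inner: "((\<lambda>\<beta>. (norm (c \<alpha>) * t ^ multi_degree \<alpha>) * (norm (d \<beta>) * t ^ multi_degree \<beta>))
      has_sum (norm (c \<alpha>) * t ^ multi_degree \<alpha>) * n) multi_indices" for \<alpha>
    by (rule has_sum_cmult_right[OF d(1)])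
  have outer: "((\<lambda>\<alpha>. (norm (c \<alpha>) * t ^ multi_degree \<alpha>) * n) has_sum m * n) multi_indices"
    by (rule has_sum_cmult_left[OF c(1)])
  have norm_summable: "(\<lambda>(\<alpha>, \<beta>). (norm (c \<alpha>) * t ^ multi_degree \<alpha>) * (norm (d \<beta>) * t ^ multi_degree \<beta>)) summable_on J"
    unfolding J_def by (rule summable_on_SigmaI)
      (use inner has_sum_imp_summable[OF outer] t in auto)
  have norm_sum: "((\<lambda>(\<alpha>, \<beta>). (norm (c \<alpha>) * t ^ multi_degree \<alpha>) * (norm (d \<beta>) * t ^ multi_degree \<beta>)) has_sum m * n) J"
    using norm_summable inner outer unfolding J_def by (intro has_sum_SigmaI) auto
  show ?thesis
  proof (rule majorized_regroup[where J = J and \<alpha> = add and k = "\<lambda>(\<alpha>, \<beta>). c \<alpha> * d \<beta>"])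
    show "((\<lambda>i. norm (case i of (\<alpha>, \<beta>) \<Rightarrow> c \<alpha> * d \<beta>) * t ^ multi_degree (add i)) has_sum m * n) J"
      using norm_sum
      by (rule has_sum_cong[THEN iffD1, rotated]) (auto simp: deg power_add norm_mult)
    show "m * n \<le> M * N"
      using m0 c d by (intro mult_mono) auto
    show "add i \<in> multi_indices" for i
      by (auto simp: add_def case_prod_unfold)
    show "((\<lambda>i. (case i of (\<alpha>, \<beta>) \<Rightarrow> c \<alpha> * d \<beta>) * of_real (monomial (x - p) (add i)))
        has_sum f x * g x) J" if x: "in_cube p t x" for x
      unfolding J_def
    proof (rule has_sum_SigmaI)
      show "(\<lambda>i. (case i of (\<alpha>, \<beta>) \<Rightarrow> c \<alpha> * d \<beta>) * of_real (monomial (x - p) (add i)))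
          summable_on Sigma multi_indices (\<lambda>_. multi_indices)"
      proof (rule abs_summable_summable, rule summable_on_comparison_test[OF norm_summable[unfolded J_def]])
        show "norm ((case i of (\<alpha>, \<beta>) \<Rightarrow> c \<alpha> * d \<beta>) * of_real (monomial (x - p) (add i)))
            \<le> (case i of (\<alpha>, \<beta>) \<Rightarrow> (norm (c \<alpha>) * t ^ multi_degree \<alpha>) * (norm (d \<beta>) * t ^ multi_degree \<beta>))" for i
        proof -
          obtain \<alpha> \<beta> where i: "i = (\<alpha>, \<beta>)" by force
          have "norm (c \<alpha>) * \<bar>monomial (x - p) \<alpha>\<bar> * (norm (d \<beta>) * \<bar>monomial (x - p) \<beta>\<bar>)
              \<le> (norm (c \<alpha>) * t ^ multi_degree \<alpha>) * (norm (d \<beta>) * t ^ multi_degree \<beta>)"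
            using t by (intro mult_mono mult_left_mono abs_monomial_le[OF x]) auto
          then show ?thesis
            by (simp add: i mon norm_mult abs_mult mult_ac)
        qed
      qed auto
      show "((\<lambda>\<alpha>. c \<alpha> * of_real (monomial (x - p) \<alpha>) * g x) has_sum f x * g x) multi_indices"
        by (rule has_sum_cmult_left[OF f_sum[OF x]])
      show "((\<lambda>\<beta>. (case (\<alpha>, \<beta>) of (\<alpha>, \<beta>) \<Rightarrow> c \<alpha> * d \<beta>) * of_real (monomial (x - p) (add (\<alpha>, \<beta>))))
         has_sum c \<alpha> * of_real (monomial (x - p) \<alpha>) * g x) multi_indices" for \<alpha>
        using has_sum_cmult_right[OF g_sum[OF x], of "c \<alpha> * of_real (monomial (x - p) \<alpha>)"]
        by (simp add: mon mult_ac)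
    qed
  qed (use t in auto)
qed

lemma majorized_const:
  fixes p :: "'a::euclidean_space"
  assumes t: "t > 0"
  shows "majorized p t (norm k) (\<lambda>_. k)"
proof (rule majorized_regroup[OF t, where J = "{()}" and \<alpha> = "\<lambda>_. \<lambda>b\<in>Basis. 0" and k = "\<lambda>_. k"])
qed (auto intro!: has_sum_finiteI simp: multi_degree_def monomial_def)

lemma majorized_coordinate:
  fixes p :: "'a::euclidean_space"
  assumes t: "t > 0" and b: "b \<in> Basis"
  shows "majorized p t t (\<lambda>x. of_real ((x - p) \<bullet> b))"
proof (rule majorized_regroup[OF t, where J = "{()}" and k = "\<lambda>_. 1" and
      \<alpha> = "\<lambda>_. \<lambda>b'\<in>Basis. if b' = b then 1 else 0"])
  have "monomial h (\<lambda>b'\<in>Basis. if b' = b then 1 else 0) = h \<bullet> b" for h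
  proof -
    have "monomial h (\<lambda>b'\<in>Basis. if b' = b then 1 else 0) = (\<Prod>b'\<in>Basis. if b' = b then h \<bullet> b' else 1)"
      unfolding monomial_def by (rule prod.cong) auto
    then show ?thesis using b by simp
  qed
  then show "((\<lambda>i. 1 * complex_of_real (monomial (x - p) (\<lambda>b'\<in>Basis. if b' = b then 1 else 0))) has_sum
         complex_of_real ((x - p) \<bullet> b)) {()}" for x
    by (auto intro!: has_sum_finiteI)
  have "multi_degree (\<lambda>b'\<in>Basis. if b' = b then 1 else 0) = (\<Sum>b'\<in>Basis. if b' = b then 1 else 0)"
    unfolding multi_degree_def by (rule sum.cong) auto
  then have "multi_degree (\<lambda>b'\<in>Basis. if b' = b then 1 else 0) = 1"
    using b by simp
  then show "((\<lambda>i. norm (1::complex) * t ^ multi_degree (\<lambda>b'\<in>Basis. if b' = b then 1 else 0)) has_sum t) {()}"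
    by (auto intro!: has_sum_finiteI)
qed auto

lemma majorized_cnj:
  assumes "majorized p t M f"
  shows "majorized p t M (\<lambda>x. cnj (f x))"
proof -
  obtain c m where c: "((\<lambda>\<alpha>. norm (c \<alpha>) * t ^ multi_degree \<alpha>) has_sum m) multi_indices" "m \<le> M"
    and f_sum: "\<And>x. in_cube p t x \<Longrightarrow>
      ((\<lambda>\<alpha>. c \<alpha> * of_real (monomial (x - p) \<alpha>)) has_sum f x) multi_indices"
    using assms unfolding majorized_def by blast
  have "((\<lambda>\<alpha>. cnj (c \<alpha>) * of_real (monomial (x - p) \<alpha>)) has_sum cnj (f x)) multi_indices"
    if "in_cube p t x" for x
    using has_sum_cnj_iff[THEN iffD2, OF f_sum[OF that]] by simp
  with c show ?thesis
    unfolding majorized_def by (intro exI[of _ "\<lambda>\<alpha>. cnj (c \<alpha>)"] exI[of _ m]) auto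
qed

lemma majorized_norm_le:
  assumes f: "majorized p t M f" and x: "in_cube p t x"
  shows "norm (f x) \<le> M"
proof -
  obtain c m where c: "((\<lambda>\<alpha>. norm (c \<alpha>) * t ^ multi_degree \<alpha>) has_sum m) multi_indices" "m \<le> M"
    and f_sum: "((\<lambda>\<alpha>. c \<alpha> * of_real (monomial (x - p) \<alpha>)) has_sum f x) multi_indices"
    using f x unfolding majorized_def by blast
  have le: "norm (c \<alpha> * of_real (monomial (x - p) \<alpha>)) \<le> norm (c \<alpha>) * t ^ multi_degree \<alpha>" for \<alpha>
    using abs_monomial_le[OF x] by (auto simp: norm_mult intro!: mult_left_mono)
  have abs: "(\<lambda>\<alpha>. norm (c \<alpha> * of_real (monomial (x - p) \<alpha>))) summable_on multi_indices"
    by (rule summable_on_comparison_test[OF has_sum_imp_summable[OF c(1)]]) (use le in auto)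
  have "norm (f x) \<le> (\<Sum>\<^sub>\<infinity>\<alpha>\<in>multi_indices. norm (c \<alpha>) * t ^ multi_degree \<alpha>)"
    by (rule order_trans[OF norm_has_sum_bound[OF has_sum_infsum[OF abs] f_sum]
          infsum_mono[OF abs has_sum_imp_summable[OF c(1)] le]])
  also have "\<dots> = m"
    by (rule infsumI[OF c(1)])
  finally show ?thesis using c(2) by linarith
qed

lemma majorized_sum:
  assumes t: "t > 0" and fin: "finite I" and f: "\<And>i. i \<in> I \<Longrightarrow> majorized p t (M i) (f i)"
  shows "majorized p t (sum M I) (\<lambda>x. \<Sum>i\<in>I. f i x)"
  by (rule majorized_infsum[OF t, where A = I and f = f and M = M]) (use f fin in \<open>auto intro!: has_sum_finiteI\<close>)

lemma multi_degree_eq_0: "\<alpha> \<in> multi_indices \<Longrightarrow> multi_degree \<alpha> = 0 \<longleftrightarrow> \<alpha> = (\<lambda>b\<in>Basis. 0)"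
  by (auto simp: multi_degree_def PiE_def extensional_def)

lemma in_cube_self [simp]: "t \<ge> 0 \<Longrightarrow> in_cube p t p"
  by (simp add: in_cube_def)

text \<open>On a small cube the bound is close to the value at the centre, because every nonconstant monomial gains a factor
  \<open>t / T\<close>. Smallness at a point thus becomes smallness in norm, which is what makes geometric series
  of analytic functions converge.\<close>

lemma majorized_shrink:
  fixes p :: "'a::euclidean_space"
  assumes f: "majorized p T M f" and t: "0 < t" "t \<le> T"
  shows "majorized p t (norm (f p) + t / T * M) f"
proof -
  obtain c m where c: "((\<lambda>\<alpha>. norm (c \<alpha>) * T ^ multi_degree \<alpha>) has_sum m) multi_indices" "m \<le> M"
    and f_sum: "\<And>x. in_cube p T x \<Longrightarrow>
      ((\<lambda>\<alpha>. c \<alpha> * of_real (monomial (x - p) \<alpha>)) has_sum f x) multi_indices"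
    using f unfolding majorized_def by blast
  define o' where "o' = (\<lambda>b\<in>(Basis::'a set). 0::nat)"
  have o': "o' \<in> multi_indices" "multi_degree o' = 0" "monomial 0 o' = 1"
    by (auto simp: o'_def multi_degree_def monomial_def)
  have "((\<lambda>\<alpha>. c \<alpha> * of_real (monomial (p - p) \<alpha>)) has_sum c o') multi_indices"
  proof (rule has_sum_finite_neutralI[where B = "{o'}"])
    show "c \<alpha> * complex_of_real (monomial (p - p) \<alpha>) = 0" if "\<alpha> \<in> multi_indices - {o'}" for \<alpha>
    proof -
      have "multi_degree \<alpha> \<noteq> 0"
        using that multi_degree_eq_0[of \<alpha>] by (auto simp: o'_def)
      then show ?thesis
        by (auto simp: multi_degree_def monomial_def)
    qed
  qed (use o' in auto)
  then have fp: "f p = c o'"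
    using f_sum[of p] t has_sum_unique by fastforce
  have upper: "((\<lambda>\<alpha>. (if \<alpha> = o' then norm (f p) else 0) + t / T * (norm (c \<alpha>) * T ^ multi_degree \<alpha>))
      has_sum norm (f p) + t / T * m) multi_indices"
  proof (intro has_sum_add has_sum_cmult_right c)
    show "((\<lambda>\<alpha>. if \<alpha> = o' then norm (f p) else 0) has_sum norm (f p)) multi_indices"
      by (rule has_sum_finite_neutralI[where B = "{o'}"]) (use o' in auto)
  qed
  have le: "norm (c \<alpha>) * t ^ multi_degree \<alpha> \<le> (if \<alpha> = o' then norm (f p) else 0) + t / T * (norm (c \<alpha>) * T ^ multi_degree \<alpha>)"
    if \<alpha>: "\<alpha> \<in> multi_indices" for \<alpha>
  proof (cases "\<alpha> = o'")
    case True
    then show ?thesis using fp o' t by auto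
  next
    case False
    then obtain n where n: "multi_degree \<alpha> = Suc n"
      using multi_degree_eq_0[OF \<alpha>] not0_implies_Suc by (auto simp: o'_def)
    have "t ^ n \<le> T ^ n"
      using t by (intro power_mono) auto
    then have "norm (c \<alpha>) * (t * t ^ n) \<le> norm (c \<alpha>) * (t * T ^ n)"
      using t by (intro mult_left_mono) auto
    moreover have "t / T * (norm (c \<alpha>) * T ^ Suc n) = norm (c \<alpha>) * (t * T ^ n)"
      using t by simp
    ultimately show ?thesis
      using False n by simp
  qed
  have summable: "(\<lambda>\<alpha>. norm (c \<alpha>) * t ^ multi_degree \<alpha>) summable_on multi_indices"
    by (rule summable_on_comparison_test[OF has_sum_imp_summable[OF upper]]) (use le t in auto)
  have "(\<Sum>\<^sub>\<infinity>\<alpha>\<in>multi_indices. norm (c \<alpha>) * t ^ multi_degree \<alpha>) \<le> norm (f p) + t / T * m"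
    using has_sum_mono[OF has_sum_infsum[OF summable] upper] le by blast
  also have "\<dots> \<le> norm (f p) + t / T * M"
    using c t by (auto intro!: divide_right_mono mult_left_mono)
  finally have "(\<Sum>\<^sub>\<infinity>\<alpha>\<in>multi_indices. norm (c \<alpha>) * t ^ multi_degree \<alpha>) \<le> norm (f p) + t / T * M" .
  moreover have "in_cube p T x" if "in_cube p t x" for x
    using that t by (force simp: in_cube_def)
  ultimately show ?thesis
    unfolding majorized_def using has_sum_infsum[OF summable] f_sum by blast
qed

definition multi_analytic :: "('a::euclidean_space \<Rightarrow> complex) \<Rightarrow> 'a \<Rightarrow> bool" where
  "multi_analytic f p \<longleftrightarrow> (\<exists>t M. t > 0 \<and> majorized p t M f)"

lemma multi_analytic_majorized_near_value:
  fixes p :: "'a::euclidean_space"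
  assumes f: "multi_analytic f p" and e: "norm (f p) < e"
  shows "\<exists>T>0. \<forall>t. 0 < t \<and> t \<le> T \<longrightarrow> majorized p t e f"
proof -
  obtain T M where T: "T > 0" "majorized p T M f"
    using f unfolding multi_analytic_def by blast
  have M: "0 \<le> M"
    by (rule majorized_nonneg[OF T(2,1)])
  define r where "r = min T ((e - norm (f p)) * T / (M + 1))"
  have "r > 0"
    using e T M by (simp add: r_def)
  moreover have "majorized p t e f" if t: "0 < t" "t \<le> r" for t
  proof (rule majorized_mono[OF majorized_shrink[OF T(2)]])
    have "t * (M + 1) \<le> (e - norm (f p)) * T"
      using t M by (simp add: r_def field_simps)
    then have "t * M \<le> (e - norm (f p)) * T"
      using t by (simp add: algebra_simps)
    then show "norm (f p) + t / T * M \<le> e"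
      using T by (simp add: field_simps)
  qed (use t in \<open>auto simp: r_def\<close>)
  ultimately show ?thesis by blast
qed

lemma multi_analytic_common:
  fixes p :: "'a::euclidean_space"
  assumes "multi_analytic f p" "multi_analytic g p"
  obtains t M N where "t > 0" "majorized p t M f" "majorized p t N g"
proof -
  obtain T U where "T > 0" "\<forall>t. 0 < t \<and> t \<le> T \<longrightarrow> majorized p t (norm (f p) + 1) f"
    and "U > 0" "\<forall>t. 0 < t \<and> t \<le> U \<longrightarrow> majorized p t (norm (g p) + 1) g"
    using multi_analytic_majorized_near_value[OF assms(1), of "norm (f p) + 1"]
      multi_analytic_majorized_near_value[OF assms(2), of "norm (g p) + 1"] by auto
  then show ?thesis
    using that[of "min T U" "norm (f p) + 1" "norm (g p) + 1"] by simp
qed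

lemma multi_analytic_const [intro, simp]: "multi_analytic (\<lambda>_. k) p"
  unfolding multi_analytic_def using majorized_const zero_less_one by blast

lemma multi_analytic_add [intro]:
  assumes "multi_analytic f p" "multi_analytic g p"
  shows "multi_analytic (\<lambda>x. f x + g x) p"
proof -
  obtain t M N where t: "t > 0" "majorized p t M f" "majorized p t N g"
    by (rule multi_analytic_common[OF assms])
  from majorized_add[OF this] t(1) show ?thesis
    unfolding multi_analytic_def by blast
qed

lemma multi_analytic_mult [intro]:
  assumes "multi_analytic f p" "multi_analytic g p"
  shows "multi_analytic (\<lambda>x. f x * g x) p"
proof -
  obtain t M N where t: "t > 0" "majorized p t M f" "majorized p t N g"
    by (rule multi_analytic_common[OF assms])
  from majorized_mult[OF this] t(1) show ?thesis
    unfolding multi_analytic_def by blast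
qed

lemma multi_analytic_cnj [intro]: "multi_analytic f p \<Longrightarrow> multi_analytic (\<lambda>x. cnj (f x)) p"
  unfolding multi_analytic_def using majorized_cnj by blast

lemma multi_analytic_sum [intro]:
  "(\<And>i. i \<in> I \<Longrightarrow> multi_analytic (f i) p) \<Longrightarrow> multi_analytic (\<lambda>x. \<Sum>i\<in>I. f i x) p"
  by (induction I rule: infinite_finite_induct) auto

lemma multi_analytic_prod [intro]:
  "(\<And>i. i \<in> I \<Longrightarrow> multi_analytic (f i) p) \<Longrightarrow> multi_analytic (\<lambda>x. \<Prod>i\<in>I. f i x) p"
  by (induction I rule: infinite_finite_induct) auto

lemma multi_analytic_component [intro]: "multi_analytic (\<lambda>v::complex^'n. v $ k) p"
proof -
  have coordinate: "multi_analytic (\<lambda>v. complex_of_real (v \<bullet> b)) p" if "b \<in> Basis" for b :: "complex^'n"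
  proof -
    have "multi_analytic (\<lambda>v. complex_of_real ((v - p) \<bullet> b)) p"
      unfolding multi_analytic_def using majorized_coordinate[OF zero_less_one that] zero_less_one by blast
    from multi_analytic_add[OF this multi_analytic_const[of "complex_of_real (p \<bullet> b)"]]
    show ?thesis by (simp add: inner_diff_left)
  qed
  have *: "(\<lambda>v::complex^'n. v $ k) = (\<lambda>v. complex_of_real (v \<bullet> axis k 1) + \<i> * complex_of_real (v \<bullet> axis k \<i>))"
    by (auto simp: inner_axis complex_eq_iff)
  show ?thesis
    unfolding * by (intro multi_analytic_add multi_analytic_mult multi_analytic_const coordinate)
      (auto simp: Basis_vec_def Basis_complex_def)
qed

lemma multi_analytic_transform:
  fixes p :: "'a::euclidean_space"
  assumes f: "multi_analytic f p" and U: "open U" "p \<in> U" and eq: "\<And>x. x \<in> U \<Longrightarrow> g x = f x"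
  shows "multi_analytic g p"
proof -
  obtain T where T: "T > 0" "\<forall>t. 0 < t \<and> t \<le> T \<longrightarrow> majorized p t (norm (f p) + 1) f"
    using multi_analytic_majorized_near_value[OF f, of "norm (f p) + 1"] by auto
  obtain r where r: "r > 0" "ball p r \<subseteq> U"
    using U open_contains_ball by blast
  define t where "t = min T (r / (2 * DIM('a)))"
  have t: "0 < t" "t \<le> T" and tr: "t * DIM('a) < r"
    using T r by (auto simp: t_def min_def field_simps)
  have "x \<in> U" if "in_cube p t x" for x
  proof -
    have "norm (x - p) \<le> (\<Sum>b\<in>Basis. \<bar>(x - p) \<bullet> b\<bar>)"
      by (rule norm_le_l1)
    also have "\<dots> \<le> (\<Sum>b\<in>(Basis::'a set). t)"
      using that by (intro sum_mono) (auto simp: in_cube_def)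
    also have "\<dots> < r"
      using tr by (simp add: mult.commute)
    finally show ?thesis
      using r by (auto simp: dist_norm norm_minus_commute)
  qed
  then have eq': "f x = g x" if "in_cube p t x" for x
    using that eq by simp
  have "majorized p t (norm (f p) + 1) f"
    using T(2) t by blast
  then have "majorized p t (norm (f p) + 1) g"
    unfolding majorized_def using eq' by auto
  then show ?thesis
    unfolding multi_analytic_def using t by blast
qed

lemma real_analytic_at_Re:
  assumes "multi_analytic f p"
  shows "real_analytic_at (\<lambda>x. Re (f x)) p"
proof -
  obtain t M where t: "t > 0" and "majorized p t M f"
    using assms unfolding multi_analytic_def by blast
  then obtain c where c: "\<And>x. in_cube p t x \<Longrightarrow>
      ((\<lambda>\<alpha>. c \<alpha> * of_real (monomial (x - p) \<alpha>)) has_sum f x) multi_indices"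
    unfolding majorized_def by blast
  have "((\<lambda>\<alpha>. Re (c \<alpha>) * (\<Prod>b\<in>Basis. ((x - p) \<bullet> b) ^ \<alpha> b)) has_sum Re (f x)) multi_indices"
    if "x \<in> ball p t" for x
  proof -
    have "\<bar>(x - p) \<bullet> b\<bar> \<le> t" if "b \<in> Basis" for b
      using Basis_le_norm[OF that, of "x - p"] \<open>x \<in> ball p t\<close> by (simp add: dist_norm norm_minus_commute)
    then have "((\<lambda>\<alpha>. c \<alpha> * of_real (monomial (x - p) \<alpha>)) has_sum f x) multi_indices"
      by (intro c) (simp add: in_cube_def)
    from has_sum_Re[OF this] show ?thesis
      by (simp add: monomial_def flip: of_real_prod)
  qed
  then show ?thesis
    unfolding real_analytic_at_def by (intro exI[of _ "\<lambda>\<alpha>. Re (c \<alpha>)"] exI[of _ t] conjI ballI t)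
qed

lemma real_analytic_at_Im:
  assumes "multi_analytic f p"
  shows "real_analytic_at (\<lambda>x. Im (f x)) p"
proof -
  have "real_analytic_at (\<lambda>x. Re (- \<i> * f x)) p"
    by (intro real_analytic_at_Re multi_analytic_mult multi_analytic_const assms)
  then show ?thesis by simp
qed

text \<open>Convergence of the series at the corner \<open>p + t (1, \<dots>, 1)\<close> of a cube is already absolute,
  since real summability is; this is the majorant.\<close>

lemma multi_analytic_of_real:
  fixes p :: "'a::euclidean_space"
  assumes "real_analytic_at f p"
  shows "multi_analytic (\<lambda>x. of_real (f x)) p"
proof -
  obtain c r where r: "r > 0" and c: "\<And>x. x \<in> ball p r \<Longrightarrow>
      ((\<lambda>\<alpha>. c \<alpha> * (\<Prod>b\<in>Basis. ((x - p) \<bullet> b) ^ \<alpha> b)) has_sum f x) multi_indices"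
    using assms unfolding real_analytic_at_def by blast
  define t where "t = r / (2 * DIM('a))"
  have t: "0 < t" and tr: "t * DIM('a) < r"
    using r by (auto simp: t_def field_simps)
  have ball: "x \<in> ball p r" if "in_cube p t x" for x
  proof -
    have "norm (x - p) \<le> (\<Sum>b\<in>Basis. \<bar>(x - p) \<bullet> b\<bar>)"
      by (rule norm_le_l1)
    also have "\<dots> \<le> (\<Sum>b\<in>(Basis::'a set). t)"
      using that by (intro sum_mono) (auto simp: in_cube_def)
    also have "\<dots> < r"
      using tr by (simp add: mult.commute)
    finally show ?thesis
      by (auto simp: dist_norm norm_minus_commute)
  qed
  define q where "q = p + (\<Sum>b\<in>Basis. t *\<^sub>R b)"
  have q: "(q - p) \<bullet> b = t" if "b \<in> Basis" for b
    using that by (simp add: q_def)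
  have "in_cube p t q"
    using t by (auto simp: in_cube_def q)
  moreover have "monomial (q - p) \<alpha> = t ^ multi_degree \<alpha>" for \<alpha>
    by (simp add: monomial_def multi_degree_def power_sum q)
  ultimately have "((\<lambda>\<alpha>. c \<alpha> * t ^ multi_degree \<alpha>) has_sum f q) multi_indices"
    using c[OF ball[of q]] by (simp flip: monomial_def)
  then have "(\<lambda>\<alpha>. c \<alpha> * t ^ multi_degree \<alpha>) summable_on multi_indices"
    by (rule has_sum_imp_summable)
  then have "(\<lambda>\<alpha>. norm (c \<alpha> * t ^ multi_degree \<alpha>)) summable_on multi_indices"
    by (rule summable_on_iff_abs_summable_on_real[THEN iffD1])
  then have "(\<lambda>\<alpha>. norm (complex_of_real (c \<alpha>)) * t ^ multi_degree \<alpha>) summable_on multi_indices"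
    using t by (simp add: abs_mult)
  moreover have "((\<lambda>\<alpha>. complex_of_real (c \<alpha>) * of_real (monomial (x - p) \<alpha>)) has_sum of_real (f x)) multi_indices"
    if "in_cube p t x" for x
    using has_sum_of_real[OF c[OF ball[OF that]], where 'a = complex] by (simp add: monomial_def)
  ultimately have "majorized p t (\<Sum>\<^sub>\<infinity>\<alpha>\<in>multi_indices. norm (complex_of_real (c \<alpha>)) * t ^ multi_degree \<alpha>)
      (\<lambda>x. of_real (f x))"
    unfolding majorized_def
    by (intro exI[of _ "\<lambda>\<alpha>. complex_of_real (c \<alpha>)"] exI conjI order_refl allI impI) (auto intro: has_sum_infsum)
  with t show ?thesis
    unfolding multi_analytic_def by blast
qed

text \<open>The terms of degree at least two are dominated by \<open>(norm h / T)\<^sup>2\<close> times the majorant.\<close>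

lemma multi_analytic_remainder:
  fixes p :: "'a::euclidean_space"
  assumes "multi_analytic f p"
  shows "\<exists>L C r. bounded_linear L \<and> r > 0 \<and>
    (\<forall>h. norm h < r \<longrightarrow> norm (f (p + h) - f p - L h) \<le> C * (norm h)\<^sup>2)"
proof -
  obtain T M where T: "T > 0" and "majorized p T M f"
    using assms unfolding multi_analytic_def by blast
  then obtain c m where c: "((\<lambda>\<alpha>. norm (c \<alpha>) * T ^ multi_degree \<alpha>) has_sum m) multi_indices"
    and f_sum: "\<And>x. in_cube p T x \<Longrightarrow>
      ((\<lambda>\<alpha>. c \<alpha> * of_real (monomial (x - p) \<alpha>)) has_sum f x) multi_indices"
    unfolding majorized_def by blast
  define E :: "nat \<Rightarrow> ('a \<Rightarrow> nat) set" where "E k = {\<alpha> \<in> multi_indices. multi_degree \<alpha> = k}" for k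
  define unit where "unit b = (\<lambda>b'\<in>(Basis :: 'a set). if b' = b then 1 else 0 :: nat)" for b
  have E0: "E 0 = {\<lambda>b\<in>Basis. 0}"
    using multi_degree_eq_0 by (auto simp: E_def multi_degree_def)
  have E1: "E 1 = unit ` Basis"
  proof (intro equalityI subsetI)
    fix \<alpha> assume \<alpha>: "\<alpha> \<in> E 1"
    then obtain b where b: "b \<in> Basis" "\<alpha> b = 1" "\<And>b'. b' \<in> Basis \<Longrightarrow> b' \<noteq> b \<Longrightarrow> \<alpha> b' = 0"
      using sum_eq_1_iff[of Basis \<alpha>] unfolding E_def multi_degree_def by auto
    then have "\<alpha> = unit b"
      using \<alpha> by (auto simp: E_def unit_def PiE_def extensional_def fun_eq_iff)
    with b show "\<alpha> \<in> unit ` Basis" by blast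
  next
    fix \<alpha> assume "\<alpha> \<in> unit ` (Basis :: 'a set)"
    then obtain b :: 'a where b: "b \<in> Basis" "\<alpha> = unit b" by blast
    have "multi_degree (unit b) = (\<Sum>b'\<in>(Basis :: 'a set). if b' = b then 1 else 0)"
      unfolding multi_degree_def unit_def by (rule sum.cong) auto
    with b show "\<alpha> \<in> E 1"
      by (auto simp: E_def unit_def)
  qed
  have inj: "inj_on unit Basis"
  proof (rule inj_onI)
    fix b b' :: 'a assume b: "b \<in> Basis" "b' \<in> Basis" "unit b = unit b'"
    have "unit b b = 1"
      using b(1) by (simp add: unit_def)
    then have "unit b' b = 1"
      using b(3) by simp
    then show "b = b'"
      using b(1) by (simp add: unit_def split: if_splits)
  qed
  have mon: "monomial h (unit b) = h \<bullet> b" if "b \<in> Basis" for h b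
  proof -
    have "monomial h (unit b) = (\<Prod>b'\<in>Basis. if b' = b then h \<bullet> b' else 1)"
      unfolding monomial_def unit_def by (rule prod.cong) auto
    then show ?thesis using that by simp
  qed
  define L where "L h = (\<Sum>b\<in>Basis. (h \<bullet> b) *\<^sub>R c (unit b))" for h
  have L: "bounded_linear L"
    unfolding L_def by (intro bounded_linear_sum bounded_linear_scaleR_const bounded_linear_inner_left)
  have mon_bound: "\<bar>monomial h \<alpha>\<bar> \<le> norm h ^ multi_degree \<alpha>" for h :: 'a and \<alpha>
  proof -
    have "\<bar>monomial ((0 + h) - 0) \<alpha>\<bar> \<le> norm h ^ multi_degree \<alpha>"
      by (rule abs_monomial_le) (auto simp: in_cube_def Basis_le_norm)
    then show ?thesis by simp
  qed
  have "norm (f (p + h) - f p - L h) \<le> (m / T\<^sup>2) * (norm h)\<^sup>2" if h: "norm h < T" for h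
  proof -
    let ?g = "\<lambda>\<alpha>. c \<alpha> * of_real (monomial h \<alpha>)"
    have cube: "in_cube p T (p + h)"
      using h Basis_le_norm[of _ h] by (force simp: in_cube_def)
    have all: "(?g has_sum f (p + h)) multi_indices"
      using f_sum[OF cube] by simp
    have fp: "f p = c (\<lambda>b\<in>Basis. 0)"
    proof -
      have "((\<lambda>\<alpha>. c \<alpha> * of_real (monomial (p - p) \<alpha>)) has_sum c (\<lambda>b\<in>Basis. 0)) multi_indices"
      proof (rule has_sum_finite_neutralI[where B = "E 0"])
        show "c \<alpha> * complex_of_real (monomial (p - p) \<alpha>) = 0" if "\<alpha> \<in> multi_indices - E 0" for \<alpha>
          using that by (auto simp: E_def multi_degree_def monomial_def)
      qed (auto simp: E0 monomial_def)
      then show ?thesis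
        using f_sum[of p] T has_sum_unique in_cube_self[of T p] by fastforce
    qed
    have low: "(?g has_sum (f p + L h)) (E 0 \<union> E 1)"
    proof (rule has_sum_Un_disjoint)
      show "(?g has_sum f p) (E 0)"
        by (rule has_sum_finiteI) (auto simp: E0 fp monomial_def)
      show "(?g has_sum L h) (E 1)"
      proof (rule has_sum_finiteI)
        have "sum ?g (E 1) = (\<Sum>b\<in>Basis. ?g (unit b))"
          unfolding E1 by (rule sum.reindex[OF inj, unfolded o_def])
        then show "L h = sum ?g (E 1)"
          unfolding L_def by (simp add: mon scaleR_conv_of_real mult.commute cong: sum.cong)
      qed (unfold E1, simp)
    qed (auto simp: E_def)
    have high: "(?g has_sum (f (p + h) - (f p + L h))) (multi_indices - (E 0 \<union> E 1))"
      by (rule has_sum_Diff[OF all low]) (auto simp: E_def)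
    let ?k = "\<lambda>\<alpha>. (norm (c \<alpha>) * T ^ multi_degree \<alpha>) * ((norm h)\<^sup>2 / T\<^sup>2)"
    have k: "(?k has_sum m * ((norm h)\<^sup>2 / T\<^sup>2)) multi_indices"
      by (rule has_sum_cmult_left[OF c])
    have le: "norm (?g \<alpha>) \<le> ?k \<alpha>" if \<alpha>: "\<alpha> \<in> multi_indices - (E 0 \<union> E 1)" for \<alpha>
    proof -
      have "multi_degree \<alpha> \<noteq> 0" "multi_degree \<alpha> \<noteq> 1"
        using \<alpha> by (auto simp: E_def)
      then obtain n where n: "multi_degree \<alpha> = n + 2"
        by (metis One_nat_def add_2_eq_Suc' not0_implies_Suc)
      have "norm h ^ n * (norm h)\<^sup>2 \<le> T ^ n * (norm h)\<^sup>2"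
        using h by (intro mult_right_mono power_mono) auto
      then have "norm h ^ multi_degree \<alpha> \<le> T ^ multi_degree \<alpha> * ((norm h)\<^sup>2 / T\<^sup>2)"
        using T by (simp add: n power_add field_simps power2_eq_square)
      with mon_bound[of h \<alpha>] have "\<bar>monomial h \<alpha>\<bar> \<le> T ^ multi_degree \<alpha> * ((norm h)\<^sup>2 / T\<^sup>2)"
        by linarith
      from mult_left_mono[OF this, of "norm (c \<alpha>)"] show ?thesis
        by (simp add: norm_mult mult.assoc)
    qed
    have k_high: "?k summable_on (multi_indices - (E 0 \<union> E 1))"
      by (rule summable_on_subset_banach[OF has_sum_imp_summable[OF k]]) auto
    have "norm (f (p + h) - (f p + L h)) \<le> infsum ?k (multi_indices - (E 0 \<union> E 1))"
    proof (rule order_trans[OF norm_has_sum_bound[OF has_sum_infsum high]])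
      show abs: "(\<lambda>\<alpha>. norm (?g \<alpha>)) summable_on (multi_indices - (E 0 \<union> E 1))"
        by (rule summable_on_comparison_test[OF k_high]) (use le in auto)
      show "(\<Sum>\<^sub>\<infinity>\<alpha>\<in>multi_indices - (E 0 \<union> E 1). norm (?g \<alpha>)) \<le> infsum ?k (multi_indices - (E 0 \<union> E 1))"
        by (rule infsum_mono[OF abs k_high]) (use le in auto)
    qed
    also have "\<dots> \<le> infsum ?k multi_indices"
      by (rule infsum_mono_neutral[OF k_high has_sum_imp_summable[OF k]]) (use T in auto)
    also have "\<dots> = m * ((norm h)\<^sup>2 / T\<^sup>2)"
      by (rule infsumI[OF k])
    finally show ?thesis
      by (simp add: algebra_simps)
  qed
  with L T show ?thesis
    by (intro exI conjI allI impI)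
qed

lemma multi_analytic_imp_differentiable:
  fixes p :: "'a::euclidean_space"
  assumes "multi_analytic f p"
  shows "f differentiable at p"
proof -
  obtain L r C where L: "bounded_linear L" and r: "r > 0"
    and bound: "\<And>h. norm h < r \<Longrightarrow> norm (f (p + h) - f p - L h) \<le> C * (norm h)\<^sup>2"
    using multi_analytic_remainder[OF assms] by auto
  have "((\<lambda>h. norm (f (p + h) - f p - L h) / norm h) \<longlongrightarrow> 0) (at 0)"
  proof (rule Lim_null_comparison)
    have "\<forall>\<^sub>F h in at (0::'a). norm h < r"
      using r by (auto simp: eventually_at dist_norm)
    then show "\<forall>\<^sub>F h in at (0::'a). norm (norm (f (p + h) - f p - L h) / norm h) \<le> C * norm h"
    proof (rule eventually_mono)
      fix h :: 'a assume "norm h < r"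
      from bound[OF this] show "norm (norm (f (p + h) - f p - L h) / norm h) \<le> C * norm h"
        by (cases "h = 0") (auto simp: field_simps power2_eq_square)
    qed
    show "((\<lambda>h. C * norm h) \<longlongrightarrow> 0) (at (0::'a))"
      by (auto intro!: tendsto_eq_intros)
  qed
  then have "(f has_derivative L) (at p)"
    using L by (simp add: has_derivative_at)
  then show ?thesis
    unfolding differentiable_def by blast
qed

lemma real_analytic_at_imp_differentiable:
  fixes p :: "'a::euclidean_space"
  assumes "real_analytic_at f p"
  shows "f differentiable at p"
proof -
  have "(\<lambda>x. Re (complex_of_real (f x))) differentiable at p"
    using multi_analytic_imp_differentiable[OF multi_analytic_of_real[OF assms]]
    unfolding differentiable_def by (elim exE) (rule exI, erule has_derivative_Re)
  then show ?thesis by simp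
qed

lemma multi_analytic_suminf:
  fixes f :: "nat \<Rightarrow> 'a::euclidean_space \<Rightarrow> complex"
  assumes t: "t > 0" and f: "\<And>n. majorized p t (M n) (f n)" and M: "summable M"
    and sums: "\<And>x. in_cube p t x \<Longrightarrow> (\<lambda>n. f n x) sums g x"
  shows "multi_analytic g p"
proof -
  have M0: "0 \<le> M n" for n
    using majorized_nonneg[OF f t] .
  have M_sum: "(M has_sum suminf M) UNIV"
    using M M0 by (intro sums_nonneg_imp_has_sum summable_sums) auto
  have "majorized p t (suminf M) g"
  proof (rule majorized_infsum[OF t _ M_sum])
    show "((\<lambda>n. f n x) has_sum g x) UNIV" if x: "in_cube p t x" for x
    proof (rule norm_summable_imp_has_sum)
      have "norm (f n x) \<le> M n" for n
        by (rule majorized_norm_le[OF f x])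
      then show "summable (\<lambda>n. norm (f n x))"
        by (intro summable_comparison_test[OF _ M]) auto
    qed (rule sums[OF x])
  qed (rule f)
  with t show ?thesis
    unfolding multi_analytic_def by blast
qed

section \<open>Power sums of roots depending on parameters\<close>

lemma contour_integral_circlepath_norm_le:
  assumes "continuous_on (sphere z r) f" "0 < r" "\<And>s. s \<in> sphere z r \<Longrightarrow> norm (f s) \<le> B"
  shows "norm (contour_integral (circlepath z r) f) \<le> 2 * pi * r * B"
proof -
  have "f contour_integrable_on circlepath z r"
    using assms by (intro contour_integrable_continuous_circlepath) simp
  then have "(f has_contour_integral contour_integral (circlepath z r) f) (circlepath z r)"
    by (rule has_contour_integral_integral)
  moreover have "z + of_real r \<in> sphere z r"
    using assms by (simp add: dist_norm)
  then have "0 \<le> B"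
    using assms(3) norm_ge_zero order_trans by blast
  ultimately have "norm (contour_integral (circlepath z r) f) \<le> B * (2 * pi * r)"
    by (rule has_contour_integral_bound_circlepath) (use assms in \<open>auto simp: dist_norm norm_minus_commute\<close>)
  then show ?thesis
    by (simp add: mult_ac)
qed

text \<open>The multinomial expansion of the power is avoided by pulling out one linear factor at a time and absorbing
  \<open>A j\<close> into the weight \<open>k\<close>.\<close>

lemma majorized_contour_integral_power:
  fixes \<delta> :: "'n::finite \<Rightarrow> 'a::euclidean_space \<Rightarrow> complex" and p :: 'a
  assumes t: "t > 0" and \<rho>: "0 < \<rho>" and \<delta>: "\<And>j. majorized p t e (\<delta> j)"
    and A: "\<And>j. continuous_on (sphere \<theta> \<rho>) (A j)" "\<And>j s. s \<in> sphere \<theta> \<rho> \<Longrightarrow> norm (A j s) \<le> B"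
  shows "continuous_on (sphere \<theta> \<rho>) k \<Longrightarrow> (\<And>s. s \<in> sphere \<theta> \<rho> \<Longrightarrow> norm (k s) \<le> K) \<Longrightarrow>
    majorized p t (2 * pi * \<rho> * K * (real CARD('n) * e * B) ^ n)
      (\<lambda>x. contour_integral (circlepath \<theta> \<rho>) (\<lambda>s. k s * (\<Sum>j\<in>UNIV. \<delta> j x * A j s) ^ n))"
proof (induction n arbitrary: k K)
  case 0
  have "norm (contour_integral (circlepath \<theta> \<rho>) k) \<le> 2 * pi * \<rho> * K"
    using 0 \<rho> by (intro contour_integral_circlepath_norm_le)
  then show ?case
    using majorized_mono[OF majorized_const[OF t]] by simp
next
  case (Suc n)
  define I where "I j x = contour_integral (circlepath \<theta> \<rho>) (\<lambda>s. (k s * A j s) * (\<Sum>j\<in>UNIV. \<delta> j x * A j s) ^ n)" for j x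
  have int: "(\<lambda>s. (k s * A j s) * (\<Sum>j\<in>UNIV. \<delta> j x * A j s) ^ n) contour_integrable_on circlepath \<theta> \<rho>" for j x
    using Suc.prems A \<rho> by (intro contour_integrable_continuous_circlepath continuous_intros) auto
  have "contour_integral (circlepath \<theta> \<rho>) (\<lambda>s. k s * (\<Sum>j\<in>UNIV. \<delta> j x * A j s) ^ Suc n) = (\<Sum>j\<in>UNIV. \<delta> j x * I j x)" for x
  proof -
    have "contour_integral (circlepath \<theta> \<rho>) (\<lambda>s. k s * (\<Sum>j\<in>UNIV. \<delta> j x * A j s) ^ Suc n)
       = contour_integral (circlepath \<theta> \<rho>) (\<lambda>s. \<Sum>j\<in>UNIV. \<delta> j x * ((k s * A j s) * (\<Sum>j\<in>UNIV. \<delta> j x * A j s) ^ n))"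
      by (simp add: sum_distrib_left sum_distrib_right mult_ac)
    also have "\<dots> = (\<Sum>j\<in>UNIV. contour_integral (circlepath \<theta> \<rho>) (\<lambda>s. \<delta> j x * ((k s * A j s) * (\<Sum>j\<in>UNIV. \<delta> j x * A j s) ^ n)))"
      by (intro contour_integral_sum contour_integrable_lmul int) auto
    also have "\<dots> = (\<Sum>j\<in>UNIV. \<delta> j x * I j x)"
      unfolding I_def by (intro sum.cong refl contour_integral_lmul int)
    finally show ?thesis .
  qed
  moreover have "majorized p t (\<Sum>j\<in>(UNIV::'n set). e * (2 * pi * \<rho> * (K * B) * (real CARD('n) * e * B) ^ n)) (\<lambda>x. \<Sum>j\<in>UNIV. \<delta> j x * I j x)"
  proof (intro majorized_sum majorized_mult t \<delta> finite)
    have K0: "0 \<le> K"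
      using Suc.prems(2)[of "\<theta> + of_real \<rho>"] \<rho> by (simp add: dist_norm) (use norm_ge_zero order_trans in blast)
    fix j
    show "majorized p t (2 * pi * \<rho> * (K * B) * (real CARD('n) * e * B) ^ n) (I j)"
      unfolding I_def
    proof (rule Suc.IH)
      show "continuous_on (sphere \<theta> \<rho>) (\<lambda>s. k s * A j s)"
        using Suc.prems A by (intro continuous_intros)
      show "norm (k s * A j s) \<le> K * B" if "s \<in> sphere \<theta> \<rho>" for s
        using Suc.prems(2)[OF that] A(2)[OF that] K0 by (simp add: norm_mult mult_mono)
    qed
  qed
  ultimately show ?case
    by (simp add: mult_ac)
qed

text \<open>The hyperplane with coordinates \<open>A j s\<close> contains \<open>z\<close> when this vanishes; it is linear
  in \<open>z\<close>.\<close>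

definition pencil :: "('n::finite \<Rightarrow> complex \<Rightarrow> complex) \<Rightarrow> complex^'n \<Rightarrow> complex \<Rightarrow> complex" where
  "pencil A z s = (\<Sum>j\<in>UNIV. z $ j * A j s)"

text \<open>The roots are counted with multiplicity, which for a root of an entire function is its order.\<close>

definition root_sum :: "('n::finite \<Rightarrow> complex \<Rightarrow> complex) \<Rightarrow> complex \<Rightarrow> real \<Rightarrow> nat \<Rightarrow> complex^'n \<Rightarrow> complex" where
  "root_sum A \<theta> \<rho> l z =
     (\<Sum>s | s \<in> ball \<theta> \<rho> \<and> pencil A z s = 0. of_int (zorder (pencil A z) s) * s ^ l)"

lemma pencil_holomorphic:
  assumes "\<And>j. A j holomorphic_on UNIV"
  shows "pencil A z holomorphic_on S"
proof -
  have "A j holomorphic_on S" for j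
    using assms holomorphic_on_subset by blast
  then show ?thesis
    unfolding pencil_def[abs_def] by (intro holomorphic_intros)
qed

lemma deriv_pencil:
  assumes "\<And>j. A j holomorphic_on UNIV"
  shows "deriv (pencil A z) s = pencil (\<lambda>j. deriv (A j)) z s"
proof (rule DERIV_imp_deriv)
  have "(A j has_field_derivative deriv (A j) s) (at s)" for j
    using assms[of j] by (auto simp: holomorphic_derivI)
  then show "(pencil A z has_field_derivative pencil (\<lambda>j. deriv (A j)) z s) (at s)"
    unfolding pencil_def[abs_def] by (auto intro!: derivative_eq_intros simp: mult.commute)
qed

lemma finite_pencil_roots:
  assumes A: "\<And>j. A j holomorphic_on UNIV" and nz: "pencil A z s\<^sub>0 \<noteq> 0"
  shows "finite {s \<in> cball \<theta> \<rho>. pencil A z s = 0}"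
proof (cases "pencil A z constant_on UNIV")
  case True
  then have "pencil A z s \<noteq> 0" for s
    using nz by (auto simp: constant_on_def)
  then show ?thesis by simp
next
  case False
  then show ?thesis
    by (intro holomorphic_compact_finite_zeros[where S = UNIV] pencil_holomorphic A) auto
qed

lemma contour_integral_root_sum:
  assumes A: "\<And>j. A j holomorphic_on UNIV" and \<rho>: "0 < \<rho>"
    and nz: "\<And>s. s \<in> sphere \<theta> \<rho> \<Longrightarrow> pencil A z s \<noteq> 0"
  shows "contour_integral (circlepath \<theta> \<rho>) (\<lambda>s. deriv (pencil A z) s * s ^ l / pencil A z s)
    = 2 * pi * \<i> * root_sum A \<theta> \<rho> l z"
proof -
  let ?g = "pencil A z" and ?S = "ball \<theta> (\<rho> + 1)"
  define pz where "pz = {w \<in> ?S. ?g w = 0 \<or> w \<in> {}}"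
  have "\<theta> + of_real \<rho> \<in> sphere \<theta> \<rho>"
    using \<rho> by (simp add: dist_norm)
  then have "finite {s \<in> cball \<theta> (\<rho> + 1). ?g s = 0}"
    using nz by (intro finite_pencil_roots[OF A]) auto
  then have fin: "finite pz"
    by (rule rev_finite_subset) (auto simp: pz_def)
  have "contour_integral (circlepath \<theta> \<rho>) (\<lambda>s. deriv ?g s * s ^ l / ?g s)
    = 2 * pi * \<i> * (\<Sum>p\<in>pz. winding_number (circlepath \<theta> \<rho>) p * p ^ l * zorder ?g p)"
    unfolding pz_def
  proof (rule argument_principle)
    show "path_image (circlepath \<theta> \<rho>) \<subseteq> ?S - {w \<in> ?S. ?g w = 0 \<or> w \<in> {}}"
      using nz \<rho> by (auto simp: dist_norm)
    show "\<forall>w. w \<notin> ?S \<longrightarrow> winding_number (circlepath \<theta> \<rho>) w = 0"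
    proof (intro allI impI)
      fix w assume "w \<notin> ?S"
      then show "winding_number (circlepath \<theta> \<rho>) w = 0"
        using \<rho> by (intro winding_number_zero_outside[where s = "cball \<theta> \<rho>"]) auto
    qed
  qed (use fin in \<open>auto intro!: pencil_holomorphic A holomorphic_intros simp: pz_def\<close>)
  also have "(\<Sum>p\<in>pz. winding_number (circlepath \<theta> \<rho>) p * p ^ l * zorder ?g p) = root_sum A \<theta> \<rho> l z"
    unfolding root_sum_def
  proof (rule sum.mono_neutral_cong_right[OF fin])
    show "{s. s \<in> ball \<theta> \<rho> \<and> ?g s = 0} \<subseteq> pz"
      by (auto simp: pz_def)
    show "winding_number (circlepath \<theta> \<rho>) s * s ^ l * of_int (zorder ?g s) = of_int (zorder ?g s) * s ^ l"
      if "s \<in> {s. s \<in> ball \<theta> \<rho> \<and> ?g s = 0}" for s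
      using that winding_number_circlepath[of s \<theta> \<rho>] by (simp add: dist_norm norm_minus_commute)
    show "\<forall>s\<in>pz - {s. s \<in> ball \<theta> \<rho> \<and> ?g s = 0}. winding_number (circlepath \<theta> \<rho>) s * s ^ l * of_int (zorder ?g s) = 0"
    proof
      fix s assume s: "s \<in> pz - {s. s \<in> ball \<theta> \<rho> \<and> ?g s = 0}"
      then have "s \<notin> cball \<theta> \<rho>"
        using nz[of s] by (auto simp: pz_def)
      then have "winding_number (circlepath \<theta> \<rho>) s = 0"
        using \<rho> by (intro winding_number_zero_outside[where s = "cball \<theta> \<rho>"]) auto
      then show "winding_number (circlepath \<theta> \<rho>) s * s ^ l * of_int (zorder ?g s) = 0"
        by simp
    qed
  qed
  finally show ?thesis .
qed

text \<open>A radius of stability: while \<open>z\<close> moves by at most \<open>\<epsilon>\<close>, the pencil changes on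
  the circle by at most half of its minimum there, so no root crosses the circle.\<close>

definition root_stable :: "('n::finite \<Rightarrow> complex \<Rightarrow> complex) \<Rightarrow> complex \<Rightarrow> real \<Rightarrow> complex^'n \<Rightarrow> real \<Rightarrow> bool" where
  "root_stable A \<theta> \<rho> z \<epsilon> \<longleftrightarrow> 0 < \<rho> \<and> 0 < \<epsilon> \<and>
     (\<exists>m B. 0 < m \<and> 0 \<le> B \<and> real CARD('n) * \<epsilon> * B \<le> m / 2 \<and>
        (\<forall>s\<in>sphere \<theta> \<rho>. m \<le> norm (pencil A z s) \<and> (\<forall>j. norm (A j s) \<le> B)))"

lemma bounded_on_sphere:
  fixes A :: "'n::finite \<Rightarrow> complex \<Rightarrow> complex"
  assumes "\<And>j. continuous_on (sphere \<theta> \<rho>) (A j)"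
  obtains B where "B \<ge> 0" "\<And>j s. s \<in> sphere \<theta> \<rho> \<Longrightarrow> norm (A j s) \<le> B"
proof -
  have "\<exists>B. \<forall>s\<in>sphere \<theta> \<rho>. norm (A j s) \<le> B" for j
    using compact_imp_bounded[OF compact_continuous_image[OF assms[of j] compact_sphere]]
    unfolding bounded_iff by auto
  then obtain B where B: "\<And>j s. s \<in> sphere \<theta> \<rho> \<Longrightarrow> norm (A j s) \<le> B j"
    by metis
  have "norm (A j s) \<le> (\<Sum>j\<in>UNIV. \<bar>B j\<bar>)" if "s \<in> sphere \<theta> \<rho>" for j s
    using B[OF that, of j] member_le_sum[of j UNIV "\<lambda>j. \<bar>B j\<bar>"] by simp
  then show ?thesis
    using that[of "\<Sum>j\<in>UNIV. \<bar>B j\<bar>"] by (simp add: sum_nonneg)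
qed

lemma root_stable_exists:
  fixes A :: "'n::finite \<Rightarrow> complex \<Rightarrow> complex"
  assumes A: "\<And>j. A j holomorphic_on UNIV" and \<rho>: "0 < \<rho>"
    and nz: "\<And>s. s \<in> sphere \<theta> \<rho> \<Longrightarrow> pencil A z s \<noteq> 0"
  shows "\<exists>\<epsilon>. root_stable A \<theta> \<rho> z \<epsilon>"
proof -
  have A_cont: "continuous_on (sphere \<theta> \<rho>) (A j)" for j
    using A[of j] holomorphic_on_imp_continuous_on continuous_on_subset by blast
  obtain B where B: "B \<ge> 0" "\<And>j s. s \<in> sphere \<theta> \<rho> \<Longrightarrow> norm (A j s) \<le> B"
    using bounded_on_sphere[of \<theta> \<rho> A, OF A_cont] by blast
  have "\<exists>s\<^sub>0\<in>sphere \<theta> \<rho>. \<forall>s\<in>sphere \<theta> \<rho>. norm (pencil A z s\<^sub>0) \<le> norm (pencil A z s)"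
  proof (rule continuous_attains_inf)
    show "continuous_on (sphere \<theta> \<rho>) (\<lambda>s. norm (pencil A z s))"
      by (intro continuous_on_norm holomorphic_on_imp_continuous_on pencil_holomorphic A)
    have "\<theta> + of_real \<rho> \<in> sphere \<theta> \<rho>"
      using \<rho> by (simp add: dist_norm)
    then show "sphere \<theta> \<rho> \<noteq> {}" by blast
  qed auto
  then obtain m where m: "m > 0" "\<And>s. s \<in> sphere \<theta> \<rho> \<Longrightarrow> m \<le> norm (pencil A z s)"
    using nz by (metis zero_less_norm_iff)
  define \<epsilon> where "\<epsilon> = m / (2 * CARD('n) * (B + 1))"
  have "\<epsilon> > 0"
    using m B by (simp add: \<epsilon>_def)
  moreover have "real CARD('n) * \<epsilon> * B \<le> real CARD('n) * \<epsilon> * (B + 1)"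
    using \<open>\<epsilon> > 0\<close> by (intro mult_left_mono) auto
  moreover have "real CARD('n) * \<epsilon> * (B + 1) = m / 2"
  proof -
    have "2 * real CARD('n) * (B + 1) \<noteq> 0"
      using B by simp
    then have "\<epsilon> * (2 * real CARD('n) * (B + 1)) = m"
      unfolding \<epsilon>_def by simp
    then show ?thesis
      by (simp add: algebra_simps)
  qed
  ultimately have "root_stable A \<theta> \<rho> z \<epsilon>"
    unfolding root_stable_def using \<rho> m B by (intro conjI exI[of _ m] exI[of _ B]) auto
  then show ?thesis by blast
qed

lemma pencil_diff: "pencil A z s = pencil A y s + pencil A (z - y) s"
  by (simp add: pencil_def sum.distrib[symmetric] algebra_simps)

lemma root_stable_lower_bound:
  fixes z y :: "complex^'n"
  assumes "root_stable A \<theta> \<rho> z \<epsilon>" "s \<in> sphere \<theta> \<rho>" "\<And>j. norm (y $ j - z $ j) \<le> \<epsilon>"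
  shows "norm (pencil A (y - z) s) \<le> norm (pencil A z s) / 2" "pencil A y s \<noteq> 0"
proof -
  obtain m B where m: "0 < m" "0 \<le> B" "real CARD('n) * \<epsilon> * B \<le> m / 2" "m \<le> norm (pencil A z s)" "\<And>j. norm (A j s) \<le> B"
    and \<epsilon>: "0 < \<epsilon>"
    using assms(1,2) unfolding root_stable_def by blast
  have "norm (pencil A (y - z) s) \<le> (\<Sum>j\<in>(UNIV::'n set). \<epsilon> * B)"
    unfolding pencil_def using m assms(3) \<epsilon> by (intro sum_norm_le) (auto simp: norm_mult intro!: mult_mono)
  also have "\<dots> \<le> m / 2"
    using m by (simp add: mult_ac)
  finally show *: "norm (pencil A (y - z) s) \<le> norm (pencil A z s) / 2"
    using m by linarith
  show "pencil A y s \<noteq> 0"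
  proof
    assume "pencil A y s = 0"
    then have "pencil A z s = - pencil A (y - z) s"
      using pencil_diff[of A y s z] by (simp add: eq_neg_iff_add_eq_0)
    then show False
      using * m by simp
  qed
qed

text \<open>The power sum is \<open>1 / (2 \<pi> \<i>)\<close> times the integral of \<open>s ^ l\<close> times the
  logarithmic derivative of the pencil. Writing the pencil at \<open>Z v\<close> as the pencil at \<open>z\<close>
  plus the pencil at \<open>Z v - z\<close> and expanding the reciprocal into a geometric series gives a series of
  functions that are polynomial in the components of \<open>Z v\<close>, with geometrically decreasing majorants.
  The parameter map \<open>Z\<close> is arbitrary, so that the statement applies in every affine chart.\<close>

lemma root_sum_multi_analytic:
  fixes A :: "'n::finite \<Rightarrow> complex \<Rightarrow> complex" and Z :: "'a::euclidean_space \<Rightarrow> complex^'n"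
  assumes A: "\<And>j. A j holomorphic_on UNIV" and st: "root_stable A \<theta> \<rho> z \<epsilon>"
    and Z: "\<And>j. multi_analytic (\<lambda>v. Z v $ j) w" and near: "Z w \<in> ball z \<epsilon>"
  shows "multi_analytic (\<lambda>v. root_sum A \<theta> \<rho> l (Z v)) w"
proof -
  obtain m B where \<rho>: "0 < \<rho>" and \<epsilon>: "0 < \<epsilon>" and m: "0 < m" and B: "0 \<le> B" and small: "real CARD('n) * \<epsilon> * B \<le> m / 2"
    and g0: "\<And>s. s \<in> sphere \<theta> \<rho> \<Longrightarrow> m \<le> norm (pencil A z s)"
    and A_le: "\<And>j s. s \<in> sphere \<theta> \<rho> \<Longrightarrow> norm (A j s) \<le> B"
    using st unfolding root_stable_def by blast
  have A_cont: "continuous_on (sphere \<theta> \<rho>) (A j)" for j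
    using A[of j] holomorphic_on_imp_continuous_on continuous_on_subset by blast
  define A' where "A' j s = deriv (A j) s * s ^ l" for j s
  have A'_cont: "continuous_on (sphere \<theta> \<rho>) (A' j)" for j
  proof -
    have "deriv (A j) holomorphic_on UNIV"
      using A by (intro holomorphic_deriv) auto
    then have "continuous_on (sphere \<theta> \<rho>) (deriv (A j))"
      using holomorphic_on_imp_continuous_on continuous_on_subset by blast
    then show ?thesis
      unfolding A'_def by (intro continuous_intros)
  qed
  obtain D where D: "0 \<le> D" "\<And>j s. s \<in> sphere \<theta> \<rho> \<Longrightarrow> norm (A' j s) \<le> D"
    using bounded_on_sphere[of \<theta> \<rho> A', OF A'_cont] by blast
  have g0_cont: "continuous_on (sphere \<theta> \<rho>) (pencil A z)"
    by (intro holomorphic_on_imp_continuous_on pencil_holomorphic A)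
  define \<delta> where "\<delta> j v = Z v $ j - z $ j" for j v
  have "\<exists>T>0. \<forall>t. 0 < t \<and> t \<le> T \<longrightarrow> majorized w t \<epsilon> (\<delta> j)" for j
  proof (rule multi_analytic_majorized_near_value)
    show "multi_analytic (\<delta> j) w"
      using multi_analytic_add[OF Z multi_analytic_const[of "- (z $ j)"]] by (simp add: \<delta>_def[abs_def])
    show "norm (\<delta> j w) < \<epsilon>"
      using near Finite_Cartesian_Product.norm_nth_le[of "Z w - z" j]
      by (simp add: \<delta>_def dist_norm norm_minus_commute)
  qed
  then obtain T where T: "\<And>j. T j > 0" "\<And>j t. 0 < t \<Longrightarrow> t \<le> T j \<Longrightarrow> majorized w t \<epsilon> (\<delta> j)"
    by metis
  define t where "t = Min (range T)"
  have t: "t > 0" and \<delta>: "\<And>j. majorized w t \<epsilon> (\<delta> j)"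
    using T by (auto simp: t_def)
  have Z_maj: "majorized w t (\<epsilon> + norm z) (\<lambda>v. Z v $ j)" for j
    using majorized_mono[OF majorized_add[OF t \<delta>[of j] majorized_const[OF t, of _ "z $ j"]], of "\<epsilon> + norm z"]
      Finite_Cartesian_Product.norm_nth_le[of z j] by (simp add: \<delta>_def)
  \<comment> \<open>The weight of the \<open>n\<close>-th term of the geometric series; \<open>q\<close> below bounds its ratio.\<close>
  define k where "k n j s = A' j s * (-1) ^ n / pencil A z s ^ Suc n" for n j s
  have k_cont: "continuous_on (sphere \<theta> \<rho>) (k n j)" for n j
  proof -
    have "pencil A z s \<noteq> 0" if "s \<in> sphere \<theta> \<rho>" for s
      using g0[OF that] m by auto
    then show ?thesis
      unfolding k_def by (intro continuous_intros A'_cont g0_cont) simp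
  qed
  have k_le: "norm (k n j s) \<le> D / m ^ Suc n" if "s \<in> sphere \<theta> \<rho>" for n j s
    unfolding k_def norm_divide norm_mult norm_power
    using D(2)[OF that] g0[OF that] m D(1)
    by (simp del: power_Suc) (intro frac_le power_mono; simp)
  define I where "I n j x = contour_integral (circlepath \<theta> \<rho>) (\<lambda>s. k n j s * (\<Sum>j\<in>UNIV. \<delta> j x * A j s) ^ n)" for n j x
  define F where "F n x = (\<Sum>j\<in>UNIV. Z x $ j * I n j x)" for n x
  define q where "q = real CARD('n) * \<epsilon> * B / m"
  have q: "0 \<le> q" "q \<le> 1 / 2"
    using small m \<epsilon> B by (auto simp: q_def field_simps)
  define M where "M n = (\<Sum>j\<in>(UNIV::'n set). (\<epsilon> + norm z) * (2 * pi * \<rho> * (D / m ^ Suc n) * (real CARD('n) * \<epsilon> * B) ^ n))" for n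
  have M_eq: "M n = real CARD('n) * (\<epsilon> + norm z) * (2 * pi * \<rho> * D / m) * q ^ n" for n
    by (simp add: M_def q_def power_divide field_simps)
  have F_maj: "majorized w t (M n) (F n)" for n
    unfolding M_def F_def I_def
    by (intro majorized_sum majorized_mult t finite Z_maj
        majorized_contour_integral_power[OF t \<rho> \<delta> A_cont A_le] k_cont k_le)
  have M_summable: "summable M"
    unfolding M_eq using q by (intro summable_mult summable_geometric) auto
  have F_sums: "(\<lambda>n. F n x) sums (2 * pi * \<i> * root_sum A \<theta> \<rho> l (Z x))" if x: "in_cube w t x" for x
  proof -
    have near_x: "norm (Z x $ j - z $ j) \<le> \<epsilon>" for j
      using majorized_norm_le[OF \<delta> x, of j] by (simp add: \<delta>_def)
    note d_le = root_stable_lower_bound(1)[OF st _ near_x] and nz = root_stable_lower_bound(2)[OF st _ near_x]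
    define d where "d s = pencil A (Z x - z) s" for s
    have d_eq: "d s = (\<Sum>j\<in>UNIV. \<delta> j x * A j s)" for s
      by (simp add: d_def pencil_def \<delta>_def)
    have d_cont: "continuous_on (sphere \<theta> \<rho>) d"
      unfolding d_def[abs_def] by (intro holomorphic_on_imp_continuous_on pencil_holomorphic A)
    define h where "h s = (\<Sum>j\<in>UNIV. Z x $ j * A' j s)" for s
    have h_eq: "h s = deriv (pencil A (Z x)) s * s ^ l" for s
      unfolding deriv_pencil[OF A] by (simp add: h_def A'_def pencil_def sum_distrib_right mult.assoc)
    define f where "f n s = h s * (-1) ^ n / pencil A z s ^ Suc n * d s ^ n" for n s
    have F_eq: "F n x = contour_integral (circlepath \<theta> \<rho>) (f n)" for n
    proof -
      have int: "(\<lambda>s. k n j s * d s ^ n) contour_integrable_on circlepath \<theta> \<rho>" for j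
        using \<rho> by (intro contour_integrable_continuous_circlepath continuous_intros) (auto intro!: k_cont d_cont)
      have "f n = (\<lambda>s. \<Sum>j\<in>UNIV. Z x $ j * (k n j s * d s ^ n))"
        by (simp add: f_def h_def k_def fun_eq_iff sum_distrib_right sum_distrib_left sum_divide_distrib mult_ac)
      then have "contour_integral (circlepath \<theta> \<rho>) (f n)
          = (\<Sum>j\<in>UNIV. contour_integral (circlepath \<theta> \<rho>) (\<lambda>s. Z x $ j * (k n j s * d s ^ n)))"
        by (simp add: contour_integral_sum contour_integrable_lmul int)
      also have "\<dots> = F n x"
        unfolding F_def I_def d_eq[symmetric] by (intro sum.cong refl contour_integral_lmul int)
      finally show ?thesis by simp
    qed
    have h_cont: "continuous_on (sphere \<theta> \<rho>) h"
      unfolding h_def by (intro continuous_intros A'_cont)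
    define H where "H = (\<Sum>j\<in>UNIV. norm (Z x $ j) * D)"
    have H: "0 \<le> H" "\<And>s. s \<in> sphere \<theta> \<rho> \<Longrightarrow> norm (h s) \<le> H"
      unfolding H_def h_def using D by (auto intro!: sum_nonneg sum_norm_le simp: norm_mult mult_left_mono)
    have f_le: "norm (f n s) \<le> H / m * (1 / 2) ^ n" if s: "s \<in> sphere \<theta> \<rho>" for n s
    proof -
      have pos: "0 < norm (pencil A z s)"
        using g0[OF s] m by linarith
      have "norm (f n s) = norm (h s) / norm (pencil A z s) * (norm (d s) / norm (pencil A z s)) ^ n"
        by (simp add: f_def norm_mult norm_divide norm_power power_divide)
      also have "\<dots> \<le> H / m * (1 / 2) ^ n"
      proof -
        have "norm (d s) / norm (pencil A z s) \<le> 1 / 2"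
          using d_le[OF s] pos by (simp add: d_def divide_simps)
        moreover have "norm (h s) / norm (pencil A z s) \<le> H / m"
          using H(2)[OF s] H(1) g0[OF s] m by (intro frac_le) auto
        ultimately show ?thesis
          using H(1) m by (intro mult_mono power_mono) auto
      qed
      finally show ?thesis .
    qed
    have "uniform_limit (sphere \<theta> \<rho>) (\<lambda>n s. \<Sum>i<n. f i s) (\<lambda>s. \<Sum>i. f i s) sequentially"
      by (rule Weierstrass_m_test[OF f_le]) (auto intro!: summable_mult summable_geometric)
    also have "?this \<longleftrightarrow> uniform_limit (sphere \<theta> \<rho>) (\<lambda>n s. \<Sum>i<n. f i s) (\<lambda>s. h s / pencil A (Z x) s) sequentially"
    proof (intro uniform_limit_cong' refl)
      fix s assume s: "s \<in> sphere \<theta> \<rho>"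
      have pos: "0 < norm (pencil A z s)"
        using g0[OF s] m by linarith
      have "norm (- d s / pencil A z s) \<le> 1 / 2"
        using d_le[OF s] pos by (simp add: norm_divide d_def divide_simps)
      then have "norm (- d s / pencil A z s) < 1"
        by linarith
      then have "(\<lambda>n. h s / pencil A z s * (- d s / pencil A z s) ^ n) sums (h s / pencil A z s * (1 / (1 - - d s / pencil A z s)))"
        by (intro sums_mult geometric_sums)
      moreover have "h s / pencil A z s * (- d s / pencil A z s) ^ n = f n s" for n
        by (simp add: f_def power_divide power_minus[of "d s / pencil A z s"])
      moreover have "h s / pencil A z s * (1 / (1 - - d s / pencil A z s)) = h s / pencil A (Z x) s"
        using pos nz[OF s] pencil_diff[of A "Z x" s z] by (simp add: d_def field_simps)
      ultimately have "(\<lambda>n. f n s) sums (h s / pencil A (Z x) s)"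
        by (simp only:)
      then show "(\<Sum>i. f i s) = h s / pencil A (Z x) s"
        by (rule sums_unique[symmetric])
    qed
    finally have ul: "uniform_limit (sphere \<theta> \<rho>) (\<lambda>n s. \<Sum>i<n. f i s) (\<lambda>s. h s / pencil A (Z x) s) sequentially" .
    have f_int: "f n contour_integrable_on circlepath \<theta> \<rho>" for n
    proof -
      have "pencil A z s \<noteq> 0" if "s \<in> sphere \<theta> \<rho>" for s
        using g0[OF that] m by auto
      then have "continuous_on (sphere \<theta> \<rho>) (f n)"
        unfolding f_def by (intro continuous_intros h_cont g0_cont d_cont) simp
      then show ?thesis
        using \<rho> by (intro contour_integrable_continuous_circlepath) simp
    qed
    have "(\<lambda>n. contour_integral (circlepath \<theta> \<rho>) (\<lambda>s. \<Sum>i<n. f i s))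
        \<longlonglongrightarrow> contour_integral (circlepath \<theta> \<rho>) (\<lambda>s. h s / pencil A (Z x) s)"
      by (rule contour_integral_uniform_limit_circlepath(2)[OF _ ul])
        (use \<rho> in \<open>auto intro!: always_eventually contour_integrable_sum f_int\<close>)
    moreover have "contour_integral (circlepath \<theta> \<rho>) (\<lambda>s. \<Sum>i<n. f i s) = (\<Sum>i<n. F i x)" for n
      unfolding F_eq by (intro contour_integral_sum f_int) auto
    moreover have "contour_integral (circlepath \<theta> \<rho>) (\<lambda>s. h s / pencil A (Z x) s) = 2 * pi * \<i> * root_sum A \<theta> \<rho> l (Z x)"
      unfolding h_eq by (rule contour_integral_root_sum[OF A \<rho> nz])
    ultimately show ?thesis
      unfolding sums_def by simp
  qed
  have "multi_analytic (\<lambda>x. 2 * pi * \<i> * root_sum A \<theta> \<rho> l (Z x)) w"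
    by (rule multi_analytic_suminf[OF t F_maj M_summable F_sums])
  from multi_analytic_mult[OF multi_analytic_const[of "1 / (2 * pi * \<i>)"] this]
  show ?thesis by simp
qed

text \<open>The number of roots is continuous and integer-valued.\<close>

lemma root_count_constant:
  assumes A: "\<And>j. A j holomorphic_on UNIV" and st: "root_stable A \<theta> \<rho> z \<epsilon>" and y: "y \<in> ball z \<epsilon>"
  shows "root_sum A \<theta> \<rho> 0 y = root_sum A \<theta> \<rho> 0 z"
proof -
  have "continuous_on (ball z \<epsilon>) (root_sum A \<theta> \<rho> 0)"
  proof (rule differentiable_imp_continuous_on, unfold differentiable_on_def, intro ballI)
    fix y assume "y \<in> ball z \<epsilon>"
    then have "multi_analytic (root_sum A \<theta> \<rho> 0) y"
      using root_sum_multi_analytic[OF A st, of "\<lambda>v. v" y 0] by auto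
    then show "root_sum A \<theta> \<rho> 0 differentiable at y within ball z \<epsilon>"
      by (rule differentiable_at_withinI[OF multi_analytic_imp_differentiable])
  qed
  moreover have int: "root_sum A \<theta> \<rho> 0 y \<in> \<int>" for y
    by (auto simp: root_sum_def)
  ultimately have "root_sum A \<theta> \<rho> 0 constant_on ball z \<epsilon>"
  proof (intro continuous_discrete_range_constant convex_connected convex_ball)
    fix x
    show "\<exists>e>0. \<forall>y. y \<in> ball z \<epsilon> \<and> root_sum A \<theta> \<rho> 0 y \<noteq> root_sum A \<theta> \<rho> 0 x
        \<longrightarrow> e \<le> norm (root_sum A \<theta> \<rho> 0 y - root_sum A \<theta> \<rho> 0 x)"
    proof (intro exI[of _ 1] conjI allI impI)
      fix y assume "y \<in> ball z \<epsilon> \<and> root_sum A \<theta> \<rho> 0 y \<noteq> root_sum A \<theta> \<rho> 0 x"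
      moreover obtain a b where "root_sum A \<theta> \<rho> 0 y = of_int a" "root_sum A \<theta> \<rho> 0 x = of_int b"
        using int by (meson Ints_cases)
      moreover from calculation have "norm (complex_of_int (a - b)) \<ge> 1"
        by (subst norm_of_int) auto
      ultimately show "1 \<le> norm (root_sum A \<theta> \<rho> 0 y - root_sum A \<theta> \<rho> 0 x)"
        by simp
    qed auto
  qed auto
  moreover have "z \<in> ball z \<epsilon>"
    using st by (simp add: root_stable_def)
  ultimately show ?thesis
    using y unfolding constant_on_def by auto
qed

section \<open>Newton identities\<close>

text \<open>Its coefficients are the elementary symmetric functions of the \<open>u p\<close>, taken with multiplicities
  \<open>m p\<close>.\<close>

definition root_fps :: "'b set \<Rightarrow> ('b \<Rightarrow> nat) \<Rightarrow> ('b \<Rightarrow> complex) \<Rightarrow> complex fps" where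
  "root_fps Z m u = (\<Prod>p\<in>Z. (1 + fps_const (u p) * fps_X) ^ m p)"

text \<open>Logarithmic differentiation; the second factor on the right is \<open>m u / (1 + u X)\<close>.\<close>

lemma fps_deriv_linear_power:
  "fps_deriv ((1 + fps_const u * fps_X) ^ m) =
     (1 + fps_const u * fps_X) ^ m * (fps_const (of_nat m) * Abs_fps (\<lambda>i. (-1) ^ i * u ^ Suc i))"
  for u :: complex
proof -
  define F where "F = Abs_fps (\<lambda>i. (-1) ^ i * u ^ Suc i)"
  define P where "P = 1 + fps_const u * fps_X"
  have "P * F = fps_const u"
  proof (rule fps_ext)
    fix n
    show "fps_nth (P * F) n = fps_nth (fps_const u) n"
      by (cases n) (simp_all add: P_def F_def distrib_right mult.assoc)
  qed
  moreover have "fps_deriv P = fps_const u"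
    by (simp add: P_def)
  ultimately have dP: "fps_deriv P = P * F"
    by simp
  have "fps_deriv (P ^ m) = P ^ m * (fps_const (of_nat m) * F)"
  proof (induction m)
    case (Suc m)
    have "fps_deriv (P ^ Suc m) = P * fps_deriv (P ^ m) + fps_deriv P * P ^ m"
      by simp
    also have "\<dots> = P ^ Suc m * ((fps_const (of_nat m) + 1) * F)"
      unfolding Suc dP by (simp add: algebra_simps)
    also have "fps_const (complex_of_nat m) + 1 = fps_const (of_nat (Suc m))"
      by (simp flip: fps_const_1_eq_1)
    finally show ?case .
  qed simp
  then show ?thesis
    by (simp add: P_def F_def)
qed

lemma fps_deriv_root_fps:
  assumes "finite Z"
  shows "fps_deriv (root_fps Z m u) =
    root_fps Z m u * (\<Sum>p\<in>Z. fps_const (of_nat (m p)) * Abs_fps (\<lambda>i. (-1) ^ i * u p ^ Suc i))"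
  using assms
proof (induction Z rule: finite_induct)
  case (insert q Z)
  let ?P = "(1 + fps_const (u q) * fps_X) ^ m q"
  have P: "root_fps (insert q Z) m u = ?P * root_fps Z m u"
    unfolding root_fps_def by (rule prod.insert[OF insert.hyps])
  show ?case
    unfolding P fps_deriv_mult insert.IH fps_deriv_linear_power sum.insert[OF insert.hyps]
    by (simp only: algebra_simps)
qed (simp add: root_fps_def)

lemma root_fps_nth_0:
  assumes "finite Z"
  shows "fps_nth (root_fps Z m u) 0 = 1"
  using assms
proof (induction Z rule: finite_induct)
  case (insert q Z)
  have "root_fps (insert q Z) m u = (1 + fps_const (u q) * fps_X) ^ m q * root_fps Z m u"
    using insert by (simp add: root_fps_def)
  then show ?case
    using insert by (simp only: fps_mult_nth_0 fps_nth_power_0) simp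
qed (simp add: root_fps_def)

lemma newton_identity:
  assumes "finite Z"
  shows "of_nat (Suc k) * fps_nth (root_fps Z m u) (Suc k) =
    (\<Sum>i\<le>k. fps_nth (root_fps Z m u) (k - i) * ((-1) ^ i * (\<Sum>p\<in>Z. of_nat (m p) * u p ^ Suc i)))"
proof -
  have "of_nat (Suc k) * fps_nth (root_fps Z m u) (Suc k) = fps_nth (fps_deriv (root_fps Z m u)) k"
    by simp
  also have "\<dots> = (\<Sum>i\<le>k. fps_nth (\<Sum>p\<in>Z. fps_const (of_nat (m p)) * Abs_fps (\<lambda>i. (-1) ^ i * u p ^ Suc i)) i * fps_nth (root_fps Z m u) (k - i))"
    unfolding fps_deriv_root_fps[OF assms] by (subst mult.commute) (simp add: fps_mult_nth atLeast0AtMost)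
  also have "\<dots> = (\<Sum>i\<le>k. fps_nth (root_fps Z m u) (k - i) * ((-1) ^ i * (\<Sum>p\<in>Z. of_nat (m p) * u p ^ Suc i)))"
    by (simp add: fps_sum_nth sum_distrib_left sum_distrib_right mult_ac)
  finally show ?thesis .
qed

lemma fps_nth_linear_power_mult:
  fixes f :: "complex fps"
  assumes "\<And>k. N < k \<Longrightarrow> fps_nth f k = 0"
  shows "fps_nth ((1 + fps_const u * fps_X) ^ m * f) (m + N) = u ^ m * fps_nth f N
    \<and> (\<forall>k>m + N. fps_nth ((1 + fps_const u * fps_X) ^ m * f) k = 0)"
proof (induction m)
  case (Suc m)
  let ?g = "(1 + fps_const u * fps_X) ^ m * f"
  have step: "fps_nth ((1 + fps_const u * fps_X) ^ Suc m * f) (Suc k) = fps_nth ?g (Suc k) + u * fps_nth ?g k" for k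
  proof -
    have "(1 + fps_const u * fps_X) ^ Suc m * f = ?g + fps_const u * (fps_X * ?g)"
      by (simp add: algebra_simps)
    then show ?thesis by simp
  qed
  have "fps_nth ((1 + fps_const u * fps_X) ^ Suc m * f) (Suc m + N) = u ^ Suc m * fps_nth f N"
    using Suc step[of "m + N"] by simp
  moreover have "fps_nth ((1 + fps_const u * fps_X) ^ Suc m * f) k = 0" if "k > Suc m + N" for k
  proof -
    have "k = Suc (k - 1)" "k - 1 > m + N"
      using that by auto
    then show ?thesis
      using Suc step[of "k - 1"] by auto
  qed
  ultimately show ?case by blast
qed (use assms in auto)

lemma root_fps_top_coeff:
  assumes "finite Z"
  shows "fps_nth (root_fps Z m u) (sum m Z) = (\<Prod>p\<in>Z. u p ^ m p) \<and>
    (\<forall>k>sum m Z. fps_nth (root_fps Z m u) k = 0)"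
  using assms
proof (induction Z rule: finite_induct)
  case (insert q Z)
  then show ?case
    using fps_nth_linear_power_mult[of "sum m Z" "root_fps Z m u" "u q" "m q"]
    by (simp add: root_fps_def)
qed (simp add: root_fps_def)

text \<open>The product is the top elementary symmetric function. Newton's identities express it polynomially in the power
  sums, which are analytic although the individual \<open>u v p\<close> need not be. The number of factors has to
  be constant so that the same coefficient is read off everywhere.\<close>

lemma multi_analytic_root_product:
  fixes w :: "'a::euclidean_space"
  assumes fin: "\<And>v. finite (Z v)"
    and power_sums: "\<And>k. multi_analytic (\<lambda>v. \<Sum>p\<in>Z v. of_nat (m v p) * u v p ^ k) w"
    and U: "open U" "w \<in> U" and count: "\<And>v. v \<in> U \<Longrightarrow> sum (m v) (Z v) = N"
  shows "multi_analytic (\<lambda>v. \<Prod>p\<in>Z v. u v p ^ m v p) w"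
proof -
  have coeff: "multi_analytic (\<lambda>v. fps_nth (root_fps (Z v) (m v) (u v)) k) w" for k
  proof (induction k rule: less_induct)
    case (less k)
    show ?case
    proof (cases k)
      case 0
      then show ?thesis
        by (simp add: root_fps_nth_0 fin)
    next
      case (Suc k')
      have "fps_nth (root_fps (Z v) (m v) (u v)) k = 1 / of_nat (Suc k') *
         (\<Sum>i\<le>k'. fps_nth (root_fps (Z v) (m v) (u v)) (k' - i) * ((-1) ^ i * (\<Sum>p\<in>Z v. of_nat (m v p) * u v p ^ Suc i)))" for v
        unfolding newton_identity[OF fin[of v], symmetric] Suc by (simp del: of_nat_Suc)
      moreover have "multi_analytic (\<lambda>v. 1 / of_nat (Suc k') *
         (\<Sum>i\<le>k'. fps_nth (root_fps (Z v) (m v) (u v)) (k' - i) * ((-1) ^ i * (\<Sum>p\<in>Z v. of_nat (m v p) * u v p ^ Suc i)))) w"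
        by (intro multi_analytic_mult multi_analytic_const multi_analytic_sum power_sums less.IH) (simp add: Suc less_Suc_eq_le)
      ultimately show ?thesis
        by presburger
    qed
  qed
  show ?thesis
  proof (rule multi_analytic_transform[OF coeff[of N] U])
    fix v assume "v \<in> U"
    then show "(\<Prod>p\<in>Z v. u v p ^ m v p) = fps_nth (root_fps (Z v) (m v) (u v)) N"
      using root_fps_top_coeff[OF fin[of v], of "m v" "u v"] count by simp
  qed
qed

section \<open>The product of root differences\<close>

definition pencil_roots :: "('n::finite \<Rightarrow> complex \<Rightarrow> complex) \<Rightarrow> complex \<Rightarrow> real \<Rightarrow> complex^'n \<Rightarrow> complex set" where
  "pencil_roots A \<theta> \<rho> z = {s. s \<in> ball \<theta> \<rho> \<and> pencil A z s = 0}"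

text \<open>The resultant of the monic polynomial that has the given roots and of its complex conjugate.\<close>

definition conj_resultant :: "('n::finite \<Rightarrow> complex \<Rightarrow> complex) \<Rightarrow> complex \<Rightarrow> real \<Rightarrow> complex^'n \<Rightarrow> complex" where
  "conj_resultant A \<theta> \<rho> z = (\<Prod>(s, s')\<in>pencil_roots A \<theta> \<rho> z \<times> pencil_roots A \<theta> \<rho> z.
     (s - cnj s') ^ (nat (zorder (pencil A z) s) * nat (zorder (pencil A z) s')))"

lemma pencil_scale: "pencil A (c *s z) s = c * pencil A z s"
  by (simp add: pencil_def sum_distrib_left mult.assoc)

lemma pencil_roots_scale: "c \<noteq> 0 \<Longrightarrow> pencil_roots A \<theta> \<rho> (c *s z) = pencil_roots A \<theta> \<rho> z"
  by (simp add: pencil_roots_def pencil_scale)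

lemma zorder_pencil_scale: "c \<noteq> 0 \<Longrightarrow> zorder (pencil A (c *s z)) s = zorder (pencil A z) s"
  using zorder_cmult[of c "pencil A z" s] by (simp add: pencil_scale[abs_def])

lemma root_sum_scale: "c \<noteq> 0 \<Longrightarrow> root_sum A \<theta> \<rho> l (c *s z) = root_sum A \<theta> \<rho> l z"
  by (simp add: root_sum_def zorder_pencil_scale pencil_scale)

lemma conj_resultant_scale: "c \<noteq> 0 \<Longrightarrow> conj_resultant A \<theta> \<rho> (c *s z) = conj_resultant A \<theta> \<rho> z"
  by (simp add: conj_resultant_def zorder_pencil_scale pencil_roots_scale)

lemma zorder_pencil_pos:
  assumes A: "\<And>j. A j holomorphic_on UNIV" and "pencil A z s\<^sub>0 \<noteq> 0" "pencil A z s = 0"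
  shows "0 < zorder (pencil A z) s"
proof -
  have "pencil A z holomorphic_on UNIV"
    by (rule pencil_holomorphic[OF A])
  moreover have "\<exists>w\<in>UNIV. pencil A z w \<noteq> 0"
    using assms by blast
  ultimately show ?thesis
    using zorder_exist_zero[of "pencil A z" UNIV s] assms(3) convex_connected[OF convex_UNIV, where 'a = complex] by simp
qed

lemma multi_analytic_eventually_near:
  fixes Z :: "'a::euclidean_space \<Rightarrow> complex^'n"
  assumes Z: "\<And>j. multi_analytic (\<lambda>v. Z v $ j) w" and near: "Z w \<in> ball z \<epsilon>"
  shows "\<exists>U. open U \<and> w \<in> U \<and> (\<forall>v\<in>U. Z v \<in> ball z \<epsilon>)"
proof -
  have "isCont Z w"
    unfolding isCont_def
  proof (rule vec_tendstoI)
    fix j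
    have "isCont (\<lambda>v. Z v $ j) w"
      by (rule differentiable_imp_continuous_within[OF multi_analytic_imp_differentiable[OF Z]])
    then show "((\<lambda>v. Z v $ j) \<longlongrightarrow> Z w $ j) (at w)"
      by (simp add: isCont_def)
  qed
  then show ?thesis
    using near unfolding continuous_at_open by (meson open_ball)
qed

text \<open>The power sums of the differences \<open>s - cnj s'\<close> are, by the binomial theorem, bilinear in the power
  sums of the roots and their conjugates.\<close>

lemma conj_resultant_multi_analytic:
  fixes A :: "'n::finite \<Rightarrow> complex \<Rightarrow> complex" and Z :: "'a::euclidean_space \<Rightarrow> complex^'n"
  assumes A: "\<And>j. A j holomorphic_on UNIV" and st: "root_stable A \<theta> \<rho> z \<epsilon>"
    and Z: "\<And>j. multi_analytic (\<lambda>v. Z v $ j) w" and near: "Z w \<in> ball z \<epsilon>"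
  shows "multi_analytic (\<lambda>v. conj_resultant A \<theta> \<rho> (Z v)) w"
proof -
  obtain U where U: "open U" "w \<in> U" and Z_near: "\<And>v. v \<in> U \<Longrightarrow> Z v \<in> ball z \<epsilon>"
    using multi_analytic_eventually_near[of Z w z \<epsilon>, OF Z near] by blast
  define m where "m v s = (if v \<in> U then nat (zorder (pencil A (Z v)) s) else 0)" for v s
  define R where "R v = (if v \<in> U then pencil_roots A \<theta> \<rho> (Z v) else {})" for v
  define X where "X v = R v \<times> R v" for v
  have nz: "\<exists>s. pencil A (Z v) s \<noteq> 0" if "v \<in> U" for v
  proof -
    have "\<theta> + of_real \<rho> \<in> sphere \<theta> \<rho>"
      using st by (simp add: dist_norm root_stable_def)
    moreover have "norm (Z v $ j - z $ j) \<le> \<epsilon>" for j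
      using Z_near[OF that] Finite_Cartesian_Product.norm_nth_le[of "Z v - z" j]
      by (simp add: dist_norm norm_minus_commute)
    ultimately show ?thesis
      using root_stable_lower_bound(2)[OF st] by blast
  qed
  have fin: "finite (R v)" for v
  proof (cases "v \<in> U")
    case True
    then obtain s\<^sub>0 where "pencil A (Z v) s\<^sub>0 \<noteq> 0"
      using nz by blast
    then have "finite {s \<in> cball \<theta> \<rho>. pencil A (Z v) s = 0}"
      by (rule finite_pencil_roots[OF A])
    then show ?thesis
      using True by (auto simp: R_def pencil_roots_def elim: rev_finite_subset)
  qed (simp add: R_def)
  have S: "(\<Sum>s\<in>R v. of_nat (m v s) * s ^ l) = root_sum A \<theta> \<rho> l (Z v)" if v: "v \<in> U" for v l
  proof -
    obtain s\<^sub>0 where s\<^sub>0: "pencil A (Z v) s\<^sub>0 \<noteq> 0"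
      using nz[OF v] by blast
    have "of_nat (m v s) = (of_int (zorder (pencil A (Z v)) s) :: complex)" if "s \<in> R v" for s
      using zorder_pencil_pos[OF A s\<^sub>0, of s] that v by (simp add: m_def R_def pencil_roots_def)
    then show ?thesis
      using v unfolding root_sum_def by (simp add: R_def pencil_roots_def)
  qed
  have "multi_analytic (\<lambda>v. \<Prod>x\<in>X v. (fst x - cnj (snd x)) ^ (m v (fst x) * m v (snd x))) w"
  proof (rule multi_analytic_root_product[OF _ _ U])
    show "finite (X v)" for v
      using fin by (simp add: X_def)
    show "multi_analytic (\<lambda>v. \<Sum>x\<in>X v. of_nat (m v (fst x) * m v (snd x)) * (fst x - cnj (snd x)) ^ k) w" for k
    proof (rule multi_analytic_transform[OF _ U])
      show "multi_analytic (\<lambda>v. \<Sum>l\<le>k. of_nat (k choose l) * (-1) ^ (k - l) *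
          (root_sum A \<theta> \<rho> l (Z v) * cnj (root_sum A \<theta> \<rho> (k - l) (Z v)))) w"
        by (intro multi_analytic_sum multi_analytic_mult multi_analytic_const multi_analytic_cnj
            root_sum_multi_analytic[OF A st Z near])
      fix v assume v: "v \<in> U"
      have "(\<Sum>x\<in>X v. of_nat (m v (fst x) * m v (snd x)) * (fst x - cnj (snd x)) ^ k)
        = (\<Sum>s\<in>R v. \<Sum>s'\<in>R v. of_nat (m v s * m v s') * (s + - cnj s') ^ k)"
        unfolding X_def by (subst sum.cartesian_product) (simp add: case_prod_unfold)
      also have "\<dots> = (\<Sum>s\<in>R v. \<Sum>s'\<in>R v. \<Sum>l\<le>k. of_nat (k choose l) * (-1) ^ (k - l) *
            ((of_nat (m v s) * s ^ l) * cnj (of_nat (m v s') * s' ^ (k - l))))"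
        unfolding binomial_ring by (simp add: sum_distrib_left power_minus[of "cnj _"] mult_ac)
      also have "\<dots> = (\<Sum>l\<le>k. \<Sum>s\<in>R v. \<Sum>s'\<in>R v. of_nat (k choose l) * (-1) ^ (k - l) *
            ((of_nat (m v s) * s ^ l) * cnj (of_nat (m v s') * s' ^ (k - l))))"
        by (subst sum.swap[where A = "R v" and B = "{..k}"], subst sum.swap) simp
      also have "\<dots> = (\<Sum>l\<le>k. of_nat (k choose l) * (-1) ^ (k - l) *
          ((\<Sum>s\<in>R v. of_nat (m v s) * s ^ l) * cnj (\<Sum>s\<in>R v. of_nat (m v s) * s ^ (k - l))))"
        unfolding cnj_sum sum_product by (simp add: sum_distrib_left)
      finally show "(\<Sum>x\<in>X v. of_nat (m v (fst x) * m v (snd x)) * (fst x - cnj (snd x)) ^ k)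
        = (\<Sum>l\<le>k. of_nat (k choose l) * (-1) ^ (k - l) *
          (root_sum A \<theta> \<rho> l (Z v) * cnj (root_sum A \<theta> \<rho> (k - l) (Z v))))"
        unfolding S[OF v] .
    qed
    fix v assume v: "v \<in> U"
    have "of_nat (\<Sum>s\<in>R v. m v s) = root_sum A \<theta> \<rho> 0 z"
      using S[OF v, of 0] root_count_constant[OF A st Z_near[OF v]] by simp
    moreover have "of_nat (\<Sum>s\<in>R w. m w s) = root_sum A \<theta> \<rho> 0 z"
      using S[OF U(2), of 0] root_count_constant[OF A st Z_near[OF U(2)]] by simp
    ultimately have count: "(\<Sum>s\<in>R v. m v s) = (\<Sum>s\<in>R w. m w s)"
      by (metis of_nat_eq_iff)
    have "(\<Sum>x\<in>X v. m v (fst x) * m v (snd x)) = (\<Sum>s\<in>R v. m v s) * (\<Sum>s\<in>R v. m v s)"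
      unfolding X_def sum_product by (subst sum.cartesian_product) (simp add: case_prod_unfold)
    then show "(\<Sum>x\<in>X v. m v (fst x) * m v (snd x)) = (\<Sum>s\<in>R w. m w s) * (\<Sum>s\<in>R w. m w s)"
      by (simp add: count)
  qed
  then show ?thesis
  proof (rule multi_analytic_transform[OF _ U])
    fix v assume "v \<in> U"
    then show "conj_resultant A \<theta> \<rho> (Z v) = (\<Prod>x\<in>X v. (fst x - cnj (snd x)) ^ (m v (fst x) * m v (snd x)))"
      by (simp add: conj_resultant_def X_def R_def m_def case_prod_unfold)
  qed
qed

lemma conj_resultant_eq_0_iff:
  assumes A: "\<And>j. A j holomorphic_on UNIV" and nz: "pencil A z s\<^sub>0 \<noteq> 0"
  shows "conj_resultant A \<theta> \<rho> z = 0 \<longleftrightarrow>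
    (\<exists>s\<in>pencil_roots A \<theta> \<rho> z. cnj s \<in> pencil_roots A \<theta> \<rho> z)"
proof -
  let ?R = "pencil_roots A \<theta> \<rho> z"
  have "finite {s \<in> cball \<theta> \<rho>. pencil A z s = 0}"
    by (rule finite_pencil_roots[OF A nz])
  then have fin: "finite ?R"
    by (rule rev_finite_subset) (auto simp: pencil_roots_def)
  have pos: "nat (zorder (pencil A z) s) > 0" if "s \<in> ?R" for s
    using zorder_pencil_pos[OF A nz, of s] that by (simp add: pencil_roots_def)
  have "conj_resultant A \<theta> \<rho> z = 0 \<longleftrightarrow> (\<exists>x\<in>?R \<times> ?R. fst x - cnj (snd x) = 0)"
    unfolding conj_resultant_def using fin pos by (auto simp: case_prod_unfold)
  also have "\<dots> \<longleftrightarrow> (\<exists>s\<in>?R. cnj s \<in> ?R)"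
    by force
  finally show ?thesis .
qed

text \<open>With one root, the first power sum is the root itself.\<close>

lemma single_root:
  assumes A: "\<And>j. A j holomorphic_on UNIV" and \<rho>: "0 < \<rho>" and nz: "pencil A z s\<^sub>0 \<noteq> 0"
    and count: "root_sum A \<theta> \<rho> 0 z = 1"
  shows "pencil_roots A \<theta> \<rho> z = {root_sum A \<theta> \<rho> 1 z}"
proof -
  let ?R = "pencil_roots A \<theta> \<rho> z" and ?m = "\<lambda>s. nat (zorder (pencil A z) s)"
  have "finite {s \<in> cball \<theta> \<rho>. pencil A z s = 0}"
    by (rule finite_pencil_roots[OF A nz])
  then have fin: "finite ?R"
    by (rule rev_finite_subset) (auto simp: pencil_roots_def)
  have pos: "zorder (pencil A z) s > 0" if "s \<in> ?R" for s
    using zorder_pencil_pos[OF A nz, of s] that by (simp add: pencil_roots_def)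
  have S: "root_sum A \<theta> \<rho> l z = (\<Sum>s\<in>?R. of_nat (?m s) * s ^ l)" for l
    unfolding root_sum_def pencil_roots_def[symmetric]
    by (intro sum.cong refl) (use pos in \<open>simp add: less_imp_le\<close>)
  have "of_nat (\<Sum>s\<in>?R. ?m s) = (of_nat 1 :: complex)"
    using count unfolding S[of 0] by simp
  then have "(\<Sum>s\<in>?R. ?m s) = 1"
    by (simp only: of_nat_eq_iff)
  then obtain s where s: "s \<in> ?R" "?m s = 1" "\<And>s'. s' \<in> ?R \<Longrightarrow> s \<noteq> s' \<Longrightarrow> ?m s' = 0"
    using sum_eq_1_iff[OF fin, of ?m] by auto
  then have R: "?R = {s}"
    using pos by force
  then have "root_sum A \<theta> \<rho> 1 z = s"
    unfolding S R using s(2) by simp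
  with R show ?thesis by simp
qed

section \<open>The projective plane and the union of lines\<close>

lemma continuous_on_scale: "continuous_on S (\<lambda>z::complex^'n. c *s z)"
  unfolding vector_scalar_mult_def by (intro continuous_intros)

lemma scale_eq_0_iff: "c *s z = 0 \<longleftrightarrow> c = 0 \<or> z = 0" for z :: "complex^'n"
  by (auto simp: vec_eq_iff)

lemma proj_scale: "c \<noteq> 0 \<Longrightarrow> z \<noteq> 0 \<Longrightarrow> proj (c *s z) = proj z"
  by (metis proj_eq_iff scale_eq_0_iff)

lemma proj_eqE:
  assumes "proj z = proj w" "z \<noteq> 0" "w \<noteq> 0"
  obtains c where "c \<noteq> 0" "w = c *s z"
  using assms proj_eq_iff by blast

text \<open>A function on the projective plane can be defined on the chosen representative once it does not change under
  scaling.\<close>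

lemma rep_proj:
  assumes "z \<noteq> 0"
  obtains c where "c \<noteq> 0" "rep_cp2 (proj z) = c *s z"
proof -
  have "proportional z z"
    using assms by (auto simp: proportional_def intro!: exI[of _ 1])
  then have "proportional z (rep_cp2 (proj z))"
    using Quotient_rep_abs[OF Quotient_cp2] equivp_implies_part_equivp part_equivp_symp[OF part_equivp_proportional]
    by blast
  then show ?thesis
    using that unfolding proportional_def by blast
qed

lemma continuous_on_proj: "continuous_on (- {0}) proj"
proof -
  have "open (proj -` B \<inter> - {0})" if "open B" for B
  proof -
    have "proj -` B \<inter> - {0} = {z. z \<noteq> 0 \<and> proj z \<in> B}"
      by auto
    then show ?thesis
      using that by (simp add: open_cp2_def)
  qed
  then show ?thesis
    by (simp add: continuous_on_open_vimage open_Compl)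
qed

lemma open_proj_image:
  assumes W: "open W" "0 \<notin> W"
  shows "open (proj ` W)"
proof -
  have "{z. z \<noteq> 0 \<and> proj z \<in> proj ` W} = (\<Union>c\<in>-{0}. (\<lambda>z. c *s z) -` W)"
  proof (intro equalityI subsetI)
    fix z assume "z \<in> {z. z \<noteq> 0 \<and> proj z \<in> proj ` W}"
    then obtain w where "z \<noteq> 0" "w \<in> W" "proj z = proj w" by blast
    moreover from this have "w \<noteq> 0" using W by auto
    ultimately obtain c where "c \<noteq> 0" "w = c *s z"
      using proj_eqE by metis
    then show "z \<in> (\<Union>c\<in>-{0}. (\<lambda>z. c *s z) -` W)"
      using \<open>w \<in> W\<close> by auto
  next
    fix z assume "z \<in> (\<Union>c\<in>-{0}. (\<lambda>z. c *s z) -` W)"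
    then obtain c where c: "c \<noteq> 0" "c *s z \<in> W" by auto
    then have "z \<noteq> 0" using W by (metis vector_smult_rzero)
    moreover have "proj z = proj (c *s z)"
      using c \<open>z \<noteq> 0\<close> by (simp add: proj_scale)
    ultimately show "z \<in> {z. z \<noteq> 0 \<and> proj z \<in> proj ` W}"
      using c by auto
  qed
  moreover have "open ((\<lambda>z. c *s z) -` W)" for c
    by (rule open_vimage[OF W(1) continuous_on_scale])
  ultimately show ?thesis
    unfolding open_cp2_def by auto
qed

definition lift :: "3 \<Rightarrow> complex^2 \<Rightarrow> complex^3" where
  "lift i w = (\<chi> j. if j = i then 1 else if j = i + 1 then w $ 1 else w $ 2)"

lemma affine_point_eq: "affine_point i w = proj (lift i w)"
  by (simp add: affine_point_def lift_def)

lemma lift_same [simp]: "lift i w $ i = 1"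
  by (simp add: lift_def)

lemma lift_nonzero [simp]: "lift i w \<noteq> 0"
  by (metis lift_same zero_index zero_neq_one)

text \<open>Indices are cyclic, so every affine chart is treated alike: its own index, and the two that follow.\<close>

lemma index_cases: "j = i \<or> j = i + 1 \<or> j = i + 2" for i j :: 3
  using exhaust_3[of i] exhaust_3[of j] by auto

lemma index_distinct [simp]: "i + 1 \<noteq> i" "i + 2 \<noteq> i" "i + 2 \<noteq> i + 1" "i \<noteq> i + 1" "i \<noteq> i + 2" "i + 1 \<noteq> i + 2" for i :: 3
  using exhaust_3[of i] by auto

lemma lift_components [simp]: "lift i w $ (i + 1) = w $ 1" "lift i w $ (i + 2) = w $ 2"
  by (simp_all add: lift_def)

lemma lift_surj:
  fixes z :: "complex^3"
  assumes "z $ i \<noteq> 0"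
  shows "z = z $ i *s lift i (vector [z $ (i + 1) / z $ i, z $ (i + 2) / z $ i])"
  unfolding vec_eq_iff
proof
  fix j
  show "z $ j = (z $ i *s lift i (vector [z $ (i + 1) / z $ i, z $ (i + 2) / z $ i])) $ j"
    using index_cases[of j i] assms by auto
qed

lemma affine_point_surj:
  obtains i w where "p = affine_point i w"
proof -
  obtain z where z: "z \<noteq> 0" "p = proj z"
    using proj_surj by blast
  then obtain i where i: "z $ i \<noteq> 0"
    by (auto simp: vec_eq_iff)
  have "p = affine_point i (vector [z $ (i + 1) / z $ i, z $ (i + 2) / z $ i])"
    unfolding affine_point_eq z(2) by (subst lift_surj[OF i]) (simp add: proj_scale i)
  then show ?thesis by (rule that)
qed

lemma affine_point_inj: "affine_point i v = affine_point i w \<Longrightarrow> v = w"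
proof -
  assume "affine_point i v = affine_point i w"
  then obtain c where c: "lift i w = c *s lift i v"
    unfolding affine_point_eq using proj_eqE[of "lift i v" "lift i w"] by auto
  from arg_cong[OF c, of "\<lambda>z. z $ i"] have "c = 1"
    by simp
  with c have eq: "lift i w = lift i v" by simp
  have "w $ 1 = v $ 1" "w $ 2 = v $ 2"
    using arg_cong[OF eq, of "\<lambda>z. z $ (i + 1)"] arg_cong[OF eq, of "\<lambda>z. z $ (i + 2)"] by simp_all
  then show "v = w"
    by (simp add: vec_eq_iff forall_2)
qed

lemma multi_analytic_lift: "multi_analytic (\<lambda>v. lift i v $ j) w"
  by (cases "j = i"; cases "j = i + 1") (simp_all add: lift_def multi_analytic_component)

lemma continuous_on_lift: "continuous_on S (lift i)"
proof -
  have "continuous_on S (\<lambda>w. \<chi> j. if j = i then 1 else if j = i + 1 then w $ 1 else w $ 2)"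
  proof (rule continuous_on_vec_lambda)
    show "continuous_on S (\<lambda>w. if j = i then 1 else if j = i + 1 then w $ 1 else w $ 2 :: complex)" for j
      by (cases "j = i"; cases "j = i + 1") (simp_all add: continuous_on_component)
  qed
  then show ?thesis
    by (simp add: lift_def[abs_def])
qed

lemma continuous_on_affine_point: "continuous_on S (affine_point i)"
  unfolding affine_point_eq[abs_def]
  by (rule continuous_on_compose2[OF continuous_on_proj continuous_on_lift]) auto

lemma open_affine_vimage: "open U \<Longrightarrow> open {v. affine_point i v \<in> U}"
  using continuous_on_affine_point[of UNIV i] by (auto simp: continuous_on_open_vimage vimage_def)

text \<open>Analyticity in every affine chart at once: the lift of a chart is an affine map, and after scaling it takes
  values in \<open>W\<close>.\<close>

lemma real_analytic_on_homogeneous: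
  assumes homog: "\<And>c z. c \<noteq> 0 \<Longrightarrow> z \<noteq> 0 \<Longrightarrow> F (c *s z) = F z" and W: "0 \<notin> W"
    and an: "\<And>(Z :: complex^2 \<Rightarrow> complex^3) w. (\<And>j. multi_analytic (\<lambda>v. Z v $ j) w) \<Longrightarrow> Z w \<in> W \<Longrightarrow>
      multi_analytic (\<lambda>v. F (Z v)) w"
  shows "real_analytic_on (\<lambda>p. Re (F (rep_cp2 p))) (proj ` W)"
    and "real_analytic_on (\<lambda>p. Im (F (rep_cp2 p))) (proj ` W)"
proof -
  have F_rep: "F (rep_cp2 (proj z)) = F z" if "z \<noteq> 0" for z
    using rep_proj[OF that] homog that by metis
  have an': "multi_analytic (\<lambda>v. F (rep_cp2 (affine_point i v))) w" if p: "affine_point i w \<in> proj ` W" for i w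
  proof -
    obtain z where z: "z \<in> W" "proj (lift i w) = proj z"
      using p unfolding affine_point_eq by blast
    then obtain c where c: "c \<noteq> 0" "z = c *s lift i w"
      using proj_eqE[of "lift i w" z] W by (metis lift_nonzero)
    have "multi_analytic (\<lambda>v. F (c *s lift i v)) w"
    proof (rule an)
      show "multi_analytic (\<lambda>v. (c *s lift i v) $ j) w" for j
        by (simp add: multi_analytic_mult multi_analytic_lift)
      show "c *s lift i w \<in> W"
        using z c by simp
    qed
    moreover have "F (rep_cp2 (affine_point i v)) = F (c *s lift i v)" for v
      using F_rep[of "lift i v"] homog[OF c(1), of "lift i v"] by (simp add: affine_point_eq)
    ultimately show ?thesis by simp
  qed
  show "real_analytic_on (\<lambda>p. Re (F (rep_cp2 p))) (proj ` W)"
    unfolding real_analytic_on_def by (intro allI impI real_analytic_at_Re an')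
  show "real_analytic_on (\<lambda>p. Im (F (rep_cp2 p))) (proj ` W)"
    unfolding real_analytic_on_def by (intro allI impI real_analytic_at_Im an')
qed

definition dual_curve :: "3 \<Rightarrow> complex \<Rightarrow> complex" where
  "dual_curve j s = (if j = 1 then cos s else if j = 2 then sin s else - sin (cos s))"

definition incidence :: "complex^3 \<Rightarrow> complex \<Rightarrow> complex" where
  "incidence = pencil dual_curve"

lemma incidence_eq: "incidence z s = z $ 1 * cos s + z $ 2 * sin s - z $ 3 * sin (cos s)"
  by (simp add: incidence_def pencil_def sum_3 dual_curve_def)

lemma dual_curve_holomorphic: "dual_curve j holomorphic_on UNIV"
proof -
  consider "j = 1" | "j = 2" | "j = 3"
    using exhaust_3[of j] by blast
  then show ?thesis
    by cases (auto simp: dual_curve_def[abs_def] intro!: holomorphic_intros)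
qed

lemma incidence_scale: "incidence (c *s z) s = c * incidence z s"
  by (simp add: incidence_def pencil_scale)

lemma incidence_holomorphic: "incidence z holomorphic_on S"
  unfolding incidence_def by (rule pencil_holomorphic[OF dual_curve_holomorphic])

lemma incidence_nonconstant:
  assumes "z \<noteq> 0"
  shows "\<exists>s. incidence z s \<noteq> 0"
proof (rule ccontr)
  assume "\<nexists>s. incidence z s \<noteq> 0"
  then have zero: "incidence z s = 0" for s
    by blast
  have z2: "z $ 2 = 0"
    using zero[of "complex_of_real (pi / 2)"] unfolding incidence_eq
    by (simp only: cos_of_real sin_of_real) simp
  have "cos (Arccos (of_real pi)) = (of_real pi :: complex)"
    by (rule cos_Arccos)
  moreover have "sin (complex_of_real pi) = 0"
    by (simp only: sin_of_real) simp
  ultimately have z1: "z $ 1 = 0"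
    using zero[of "Arccos (of_real pi)"] z2 unfolding incidence_eq by simp
  have "sin (1::complex) \<noteq> 0"
  proof -
    have "sin (1::real) > 0"
      using pi_gt3 by (intro sin_gt_zero) auto
    then have "sin (complex_of_real 1) \<noteq> 0"
      by (simp only: sin_of_real) simp
    then show ?thesis by simp
  qed
  then have "z $ 3 = 0"
    using zero[of 0] z1 z2 unfolding incidence_eq by simp
  with z1 z2 have "z = 0"
    by (simp add: vec_eq_iff forall_3)
  with assms show False ..
qed

lemma incidence_plus_pi: "incidence z (s + of_real pi) = - incidence z s"
  by (simp add: incidence_eq cos_add sin_add cos_of_real sin_of_real)

text \<open>The curve is antiperiodic, so \<open>t\<close> and \<open>t + \<pi>\<close> define the same line.\<close>

lemma incidence_plus_int_pi: "incidence z (s + of_real (of_int k * pi)) = 0 \<longleftrightarrow> incidence z s = 0"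
proof -
  have plus: "incidence z (s + of_real (of_nat n * pi)) = 0 \<longleftrightarrow> incidence z s = 0" for n s
  proof (induction n)
    case (Suc n)
    have "s + of_real (of_nat (Suc n) * pi) = (s + of_real (of_nat n * pi)) + complex_of_real pi"
      by (simp add: algebra_simps)
    then show ?case
      using incidence_plus_pi[of z "s + of_real (of_nat n * pi)"] Suc by (simp add: add.assoc)
  qed simp
  show ?thesis
  proof (cases "k \<ge> 0")
    case True
    then show ?thesis
      using plus[of s "nat k"] by simp
  next
    case False
    have "(s + of_real (of_int k * pi)) + of_real (of_nat (nat (- k)) * pi) = s"
      using False by simp
    then show ?thesis
      using plus[of "s + of_real (of_int k * pi)" "nat (- k)"] by (simp only:)
  qed
qed

lemma real_root_in_period:
  assumes "incidence z (of_real t) = 0"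
  obtains k :: int where "t + of_int k * pi \<in> {a..a + pi}" "incidence z (of_real (t + of_int k * pi)) = 0"
proof -
  define k where "k = \<lceil>(a - t) / pi\<rceil>"
  have "(a - t) / pi \<le> k" "k < (a - t) / pi + 1"
    unfolding k_def by linarith+
  then have "t + of_int k * pi \<in> {a..a + pi}"
    using pi_gt_zero by (simp add: field_simps)
  moreover have "incidence z (of_real (t + of_int k * pi)) = 0"
    using incidence_plus_int_pi[of z "of_real t" k] assms by simp
  ultimately show ?thesis by (rule that)
qed

lemma sin_cos_real: "sin (cos (complex_of_real t)) = of_real (sin (cos t))"
  by (simp add: cos_of_real sin_of_real)

text \<open>The real projective plane is contained in the union of the lines: an antiperiodic real function cannot keep one
  strict sign.\<close>

lemma real_point_root:
  "\<exists>t. incidence (vector [of_real r1, of_real r2, of_real r3]) (of_real t) = 0"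
proof -
  let ?f = "\<lambda>t. r1 * cos t + r2 * sin t - r3 * sin (cos t)"
  have eq: "incidence (vector [of_real r1, of_real r2, of_real r3]) (of_real t) = of_real (?f t)" for t
    by (simp add: incidence_eq sin_cos_real cos_of_real sin_of_real)
  have cont: "continuous_on {0..pi} ?f"
    by (intro continuous_intros)
  have "?f pi = - ?f 0"
    by simp
  then consider "?f 0 \<le> 0" "0 \<le> ?f pi" | "?f pi \<le> 0" "0 \<le> ?f 0"
    by linarith
  then obtain t where "?f t = 0"
  proof cases
    case 1
    then show ?thesis using IVT'[OF 1 _ cont] that by auto
  next
    case 2
    then show ?thesis using IVT2'[OF 2 _ cont] that by auto
  qed
  then show ?thesis
    using eq[of t] by (intro exI[of _ t]) simp
qed

lemma sin_nonreal_nonzero: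
  assumes "Im s \<noteq> 0"
  shows "sin (cnj s - s) \<noteq> 0"
proof
  assume "sin (cnj s - s) = 0"
  then obtain n :: int where "cnj s - s = of_real (n * pi)"
    by (auto simp: sin_eq_0)
  from arg_cong[OF this, of Im] assms show False
    by simp
qed

text \<open>A point orthogonal to \<open>a s\<close> and \<open>a (cnj s)\<close> for nonreal \<open>s\<close> is determined
  up to scaling by two conjugate equations, by Cramer's rule with determinant \<open>sin (cnj s - s)\<close>; so
  it is a real point and has a real root. This is why no spurious points enter the local equation.\<close>

lemma conjugate_roots_imp_real_root:
  assumes z: "incidence z s = 0" "incidence z (cnj s) = 0"
  shows "\<exists>t. incidence z (of_real t) = 0"
proof (cases "Im s = 0")
  case True
  then have "s = of_real (Re s)"
    by (simp add: complex_eq_iff)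
  with z show ?thesis by metis
next
  case False
  define D where "D = sin (cnj s - s)"
  define h where "h = sin (cos s)"
  have D: "D \<noteq> 0" "D = cos s * sin (cnj s) - cos (cnj s) * sin s" "cnj D = - D"
    using sin_nonreal_nonzero[OF False] by (simp_all add: D_def sin_diff cnj_sin cnj_cos algebra_simps)
  have h': "sin (cos (cnj s)) = cnj h"
    by (simp add: h_def cnj_sin cnj_cos)
  have e1: "z $ 1 * cos s + z $ 2 * sin s = z $ 3 * h"
    and e2: "z $ 1 * cos (cnj s) + z $ 2 * sin (cnj s) = z $ 3 * cnj h"
    using z h' by (simp_all add: incidence_eq h_def)
  define r1 where "r1 = (h * sin (cnj s) - cnj h * sin s) / D"
  define r2 where "r2 = (cos s * cnj h - cos (cnj s) * h) / D"
  have "z $ 1 * D = z $ 3 * (h * sin (cnj s) - cnj h * sin s)"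
  proof -
    have "z $ 1 * D = (z $ 1 * cos s + z $ 2 * sin s) * sin (cnj s) - (z $ 1 * cos (cnj s) + z $ 2 * sin (cnj s)) * sin s"
      by (simp add: D(2) algebra_simps)
    then show ?thesis
      unfolding e1 e2 by (simp add: algebra_simps)
  qed
  then have z1: "z $ 1 = z $ 3 * r1"
    using D(1) by (simp add: r1_def field_simps)
  have "z $ 2 * D = z $ 3 * (cos s * cnj h - cos (cnj s) * h)"
  proof -
    have "z $ 2 * D = cos s * (z $ 1 * cos (cnj s) + z $ 2 * sin (cnj s)) - cos (cnj s) * (z $ 1 * cos s + z $ 2 * sin s)"
      by (simp add: D(2) algebra_simps)
    then show ?thesis
      unfolding e1 e2 by (simp add: algebra_simps)
  qed
  then have z2: "z $ 2 = z $ 3 * r2"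
    using D(1) by (simp add: r2_def field_simps)
  have "cnj r1 = r1" "cnj r2 = r2"
    using D(1) unfolding r1_def r2_def complex_cnj_divide complex_cnj_diff complex_cnj_mult D(3)
    by (simp_all add: cnj_sin cnj_cos field_simps)
  then have r: "r1 = of_real (Re r1)" "r2 = of_real (Re r2)"
    by (simp_all add: complex_eq_iff)
  define x where "x = (vector [of_real (Re r1), of_real (Re r2), of_real 1] :: complex^3)"
  obtain t where t: "incidence x (of_real t) = 0"
    unfolding x_def using real_point_root by blast
  have "z = z $ 3 *s x"
    unfolding vec_eq_iff forall_3 x_def r[symmetric] using z1 z2 by simp
  then have "incidence z (of_real t) = z $ 3 * incidence x (of_real t)"
    using incidence_scale[of "z $ 3" x] by metis
  then show ?thesis
    using t by auto
qed

definition levi_example :: "cp2 set" where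
  "levi_example = {proj z | z. z \<noteq> 0 \<and> (\<exists>t. incidence z (complex_of_real t) = 0)}"

lemma incidence_proj_cong:
  assumes "proj z = proj w" "z \<noteq> 0" "w \<noteq> 0"
  shows "incidence z s = 0 \<longleftrightarrow> incidence w s = 0"
  using proj_eqE[OF assms] by (metis incidence_scale mult_eq_0_iff)

lemma proj_in_levi_example:
  assumes "z \<noteq> 0"
  shows "proj z \<in> levi_example \<longleftrightarrow> (\<exists>t. incidence z (complex_of_real t) = 0)"
  unfolding levi_example_def using assms incidence_proj_cong by blast

lemma norm_dual_curve_real: "norm (dual_curve j (of_real t)) \<le> 1"
  by (auto simp: dual_curve_def sin_cos_real cos_of_real sin_of_real)

lemma incidence_nonzero_nearby:
  assumes K: "compact K" and nz: "\<And>t. t \<in> K \<Longrightarrow> incidence z (complex_of_real t) \<noteq> 0"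
  shows "\<exists>\<epsilon>>0. \<forall>y\<in>ball z \<epsilon>. \<forall>t\<in>K. incidence y (complex_of_real t) \<noteq> 0"
proof (cases "K = {}")
  case False
  have "continuous_on K (\<lambda>t. norm (incidence z (complex_of_real t)))"
    unfolding incidence_eq by (intro continuous_intros)
  then obtain t0 where t0: "t0 \<in> K" "\<And>t. t \<in> K \<Longrightarrow> norm (incidence z (of_real t0)) \<le> norm (incidence z (of_real t))"
    using continuous_attains_inf[OF K False, of "\<lambda>t. norm (incidence z (complex_of_real t))"] by blast
  define m where "m = norm (incidence z (of_real t0))"
  have m: "m > 0"
    using nz[OF t0(1)] by (simp add: m_def)
  have "incidence y (of_real t) \<noteq> 0" if y: "y \<in> ball z (m / 3)" and t: "t \<in> K" for y t
  proof
    assume zero: "incidence y (of_real t) = 0"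
    have "norm ((y - z) $ j * dual_curve j (of_real t)) \<le> norm (y - z)" for j
      using mult_mono[OF Finite_Cartesian_Product.norm_nth_le[of "y - z" j] norm_dual_curve_real[of j t]]
      by (simp add: norm_mult)
    then have "norm (incidence (y - z) (of_real t)) \<le> (\<Sum>j\<in>(UNIV::3 set). norm (y - z))"
      unfolding incidence_def pencil_def by (intro sum_norm_le) auto
    also have "\<dots> < m"
      using y by (simp add: dist_norm norm_minus_commute)
    finally have "norm (incidence (y - z) (of_real t)) < m" .
    moreover have "incidence z (of_real t) = - incidence (y - z) (of_real t)"
      using pencil_diff[of dual_curve y "of_real t" z] zero
      by (simp add: incidence_def eq_neg_iff_add_eq_0)
    ultimately show False
      using t0(2)[OF t] by (simp add: m_def)
  qed
  then show ?thesis
    using m by (intro exI[of _ "m / 3"]) auto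
qed (auto intro: exI[of _ 1])

lemma closed_levi_example: "closed levi_example"
proof -
  have "open {z. z \<noteq> 0 \<and> proj z \<in> - levi_example}"
    unfolding open_dist
  proof (intro ballI)
    fix z assume "z \<in> {z. z \<noteq> 0 \<and> proj z \<in> - levi_example}"
    then have z: "z \<noteq> 0" "\<And>t. incidence z (complex_of_real t) \<noteq> 0"
      using proj_in_levi_example by auto
    then obtain \<epsilon> where \<epsilon>: "\<epsilon> > 0" "\<And>y t. y \<in> ball z \<epsilon> \<Longrightarrow> t \<in> {0..0 + pi} \<Longrightarrow> incidence y (complex_of_real t) \<noteq> 0"
      using incidence_nonzero_nearby[of "{0..0 + pi}" z] by auto
    have "y \<in> {z. z \<noteq> 0 \<and> proj z \<in> - levi_example}" if "dist y z < \<epsilon>" for y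
    proof -
      have y: "y \<in> ball z \<epsilon>"
        using that by (simp add: dist_commute)
      have "y \<noteq> 0"
        using \<epsilon>(2)[OF y, of 0] by (auto simp: incidence_eq)
      moreover have "incidence y (of_real t) \<noteq> 0" for t
        using real_root_in_period[of y t 0] \<epsilon>(2)[OF y] by metis
      ultimately show ?thesis
        using proj_in_levi_example by auto
    qed
    with \<epsilon>(1) show "\<exists>e>0. \<forall>y. dist y z < e \<longrightarrow> y \<in> {z. z \<noteq> 0 \<and> proj z \<in> - levi_example}"
      by blast
  qed
  then show ?thesis
    unfolding closed_def open_cp2_def by simp
qed

lemma isolated_root_disc:
  assumes z: "z \<noteq> 0" and r: "r > 0"
  obtains \<rho> \<epsilon> where "0 < \<rho>" "\<rho> < r" "\<And>s. s \<in> cball \<theta> \<rho> \<Longrightarrow> incidence z s = 0 \<Longrightarrow> s = \<theta>"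
    "root_stable dual_curve \<theta> \<rho> z \<epsilon>"
proof -
  obtain s\<^sub>0 where "incidence z s\<^sub>0 \<noteq> 0"
    using incidence_nonconstant[OF z] by blast
  then have "finite {s \<in> cball \<theta> r. incidence z s = 0}"
    unfolding incidence_def by (rule finite_pencil_roots[OF dual_curve_holomorphic])
  then obtain d where d: "d > 0" "\<And>s. s \<in> {s \<in> cball \<theta> r. incidence z s = 0} \<Longrightarrow> s \<noteq> \<theta> \<Longrightarrow> d \<le> dist \<theta> s"
    using finite_set_avoid[of "{s \<in> cball \<theta> r. incidence z s = 0}" \<theta>] by auto
  define \<rho> where "\<rho> = min d r / 2"
  have \<rho>: "0 < \<rho>" "\<rho> < r" "\<rho> < d"
    using d r by (auto simp: \<rho>_def min_def)
  have only: "s = \<theta>" if "s \<in> cball \<theta> \<rho>" "incidence z s = 0" for s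
    using d(2)[of s] that \<rho> by fastforce
  have "pencil dual_curve z s \<noteq> 0" if "s \<in> sphere \<theta> \<rho>" for s
    using only[of s] that \<rho> by (auto simp: incidence_def)
  then have "\<exists>\<epsilon>. root_stable dual_curve \<theta> \<rho> z \<epsilon>"
    by (rule root_stable_exists[OF dual_curve_holomorphic \<rho>(1)])
  then obtain \<epsilon> where "root_stable dual_curve \<theta> \<rho> z \<epsilon>" ..
  from that[OF \<rho>(1,2) only this] show ?thesis .
qed

lemma root_stable_ball_nonzero:
  assumes "root_stable dual_curve \<theta> \<rho> z \<epsilon>" "y \<in> ball z \<epsilon>"
  shows "y \<noteq> 0" "\<And>s. s \<in> sphere \<theta> \<rho> \<Longrightarrow> incidence y s \<noteq> 0"
proof -
  have near: "norm (y $ j - z $ j) \<le> \<epsilon>" for j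
    using assms(2) Finite_Cartesian_Product.norm_nth_le[of "y - z" j]
    by (simp add: dist_norm norm_minus_commute)
  then show nz: "incidence y s \<noteq> 0" if "s \<in> sphere \<theta> \<rho>" for s
    unfolding incidence_def by (rule root_stable_lower_bound(2)[OF assms(1) that])
  have "\<theta> + of_real \<rho> \<in> sphere \<theta> \<rho>"
    using assms(1) by (simp add: dist_norm root_stable_def)
  from nz[OF this] show "y \<noteq> 0"
    by (auto simp: incidence_eq)
qed

section \<open>Local equations and simple roots\<close>

text \<open>The real roots in one period are finitely many, and the local equation is the product of the resultants over
  small discs around them. Away from these discs the period is compact, so no real root appears there when
  \<open>z\<close> moves a little.\<close>

lemma local_equation:
  assumes z: "z \<noteq> 0"
  obtains W F where "open W" "z \<in> W" "0 \<notin> W"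
    "\<And>c y. c \<noteq> 0 \<Longrightarrow> y \<noteq> 0 \<Longrightarrow> F (c *s y) = F y"
    "\<And>(Z :: complex^2 \<Rightarrow> complex^3) w. (\<And>j. multi_analytic (\<lambda>v. Z v $ j) w) \<Longrightarrow> Z w \<in> W \<Longrightarrow>
      multi_analytic (\<lambda>v. F (Z v)) w"
    "\<And>y. y \<in> W \<Longrightarrow> proj y \<in> levi_example \<longleftrightarrow> F y = (0::complex)"
proof -
  define R where "R = {t \<in> {0..pi}. incidence z (complex_of_real t) = 0}"
  obtain s\<^sub>0 where s\<^sub>0: "incidence z s\<^sub>0 \<noteq> 0"
    using incidence_nonconstant[OF z] by blast
  have "finite {s \<in> cball 0 pi. incidence z s = 0}"
    using s\<^sub>0 unfolding incidence_def by (rule finite_pencil_roots[OF dual_curve_holomorphic])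
  then have "finite (complex_of_real -` {s \<in> cball 0 pi. incidence z s = 0})"
    by (rule finite_vimageI) (simp add: inj_of_real)
  then have fin: "finite R"
    by (rule rev_finite_subset) (auto simp: R_def)
  have "\<exists>\<rho> \<epsilon>. 0 < \<rho> \<and> root_stable dual_curve (complex_of_real t) \<rho> z \<epsilon>" for t
    by (rule isolated_root_disc[OF z zero_less_one, of "complex_of_real t"]) blast
  then obtain \<rho> \<epsilon> where \<rho>: "\<And>t. 0 < \<rho> t" and st: "\<And>t. root_stable dual_curve (complex_of_real t) (\<rho> t) z (\<epsilon> t)"
    by metis
  define K where "K = {0..pi} - (\<Union>t\<in>R. ball t (\<rho> t))"
  have "compact K"
    unfolding K_def by (intro compact_diff open_UN ballI open_ball compact_Icc)
  moreover have "incidence z (complex_of_real t) \<noteq> 0" if "t \<in> K" for t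
    using that \<rho> unfolding K_def R_def by force
  ultimately obtain \<epsilon>K where \<epsilon>K: "\<epsilon>K > 0"
    "\<And>y t. y \<in> ball z \<epsilon>K \<Longrightarrow> t \<in> K \<Longrightarrow> incidence y (complex_of_real t) \<noteq> 0"
    using incidence_nonzero_nearby[of K z] by blast
  define e where "e = Min (insert \<epsilon>K (\<epsilon> ` R))"
  have e: "e > 0"
    unfolding e_def using fin \<epsilon>K st by (auto simp: root_stable_def)
  have "e \<le> \<epsilon>K"
    unfolding e_def using fin by (intro Min_le) auto
  then have e_K: "ball z e \<subseteq> ball z \<epsilon>K"
    by (rule subset_ball)
  have "e \<le> \<epsilon> t" if "t \<in> R" for t
    unfolding e_def using fin that by (intro Min_le) auto
  then have e_R: "ball z e \<subseteq> ball z (\<epsilon> t)" if "t \<in> R" for t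
    using that by (intro subset_ball)
  define F where "F y = (\<Prod>t\<in>R. conj_resultant dual_curve (complex_of_real t) (\<rho> t) y)" for y
  have nz: "y \<noteq> 0" if y: "y \<in> ball z e" for y
  proof (cases "R = {}")
    case True
    then have "0 \<in> K" by (simp add: K_def)
    then have "incidence y 0 \<noteq> 0"
      using \<epsilon>K(2)[of y 0] y e_K by auto
    then show ?thesis by (auto simp: incidence_eq)
  next
    case False
    then obtain t where "t \<in> R" by blast
    then show ?thesis
      using root_stable_ball_nonzero(1)[OF st, of y t] e_R[of t] y by blast
  qed
  show ?thesis
  proof (rule that)
    show "open (ball z e)" "z \<in> ball z e"
      using e by auto
    show "0 \<notin> ball z e"
      using nz[of 0] by blast
    show "F (c *s y) = F y" if "c \<noteq> 0" for c y
      using that by (simp add: F_def conj_resultant_scale)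
    show "multi_analytic (\<lambda>v. F (Z v)) w"
      if Z: "\<And>j. multi_analytic (\<lambda>v. Z v $ j) w" and near: "Z w \<in> ball z e" for Z :: "complex^2 \<Rightarrow> complex^3" and w
      unfolding F_def
    proof (rule multi_analytic_prod)
      fix t assume "t \<in> R"
      then have "Z w \<in> ball z (\<epsilon> t)"
        using near e_R by blast
      then show "multi_analytic (\<lambda>v. conj_resultant dual_curve (complex_of_real t) (\<rho> t) (Z v)) w"
        by (rule conj_resultant_multi_analytic[OF dual_curve_holomorphic st Z])
    qed
    fix y assume y: "y \<in> ball z e"
    obtain s\<^sub>1 where s\<^sub>1: "pencil dual_curve y s\<^sub>1 \<noteq> 0"
      using incidence_nonconstant[OF nz[OF y]] by (auto simp: incidence_def)
    have F0: "F y = 0 \<longleftrightarrow> (\<exists>t\<in>R. \<exists>s\<in>pencil_roots dual_curve (complex_of_real t) (\<rho> t) y.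
        cnj s \<in> pencil_roots dual_curve (complex_of_real t) (\<rho> t) y)"
      unfolding F_def prod_zero_iff[OF fin] conj_resultant_eq_0_iff[OF dual_curve_holomorphic s\<^sub>1] ..
    show "proj y \<in> levi_example \<longleftrightarrow> F y = 0"
    proof
      assume "proj y \<in> levi_example"
      then obtain t where "incidence y (complex_of_real t) = 0"
        using proj_in_levi_example[OF nz[OF y]] by blast
      then obtain t' where t': "t' \<in> {0..0 + pi}" "incidence y (complex_of_real t') = 0"
        using real_root_in_period[of y t 0] by metis
      then have "t' \<notin> K"
        using \<epsilon>K(2)[of y t'] y e_K by blast
      then obtain t where t: "t \<in> R" "t' \<in> ball t (\<rho> t)"
        using t' by (auto simp: K_def)
      have "complex_of_real t' \<in> pencil_roots dual_curve (complex_of_real t) (\<rho> t) y"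
        using t t' by (simp add: pencil_roots_def incidence_def dist_of_real)
      then show "F y = 0"
        unfolding F0 using t(1) by (intro bexI[of _ t] bexI[of _ "complex_of_real t'"]) auto
    next
      assume "F y = 0"
      then obtain s where "incidence y s = 0" "incidence y (cnj s) = 0"
        unfolding F0 pencil_roots_def incidence_def by blast
      then show "proj y \<in> levi_example"
        using conjugate_roots_imp_real_root proj_in_levi_example[OF nz[OF y]] by blast
    qed
  qed
qed

lemma proj_image_iff:
  assumes hom: "\<And>c y. c \<noteq> 0 \<Longrightarrow> y \<noteq> 0 \<Longrightarrow> F (c *s y) = F y" and W: "0 \<notin> W"
    and P: "\<And>y. y \<in> W \<Longrightarrow> proj y \<in> H \<longleftrightarrow> Q (F y)" and q: "q \<in> proj ` W"
  shows "q \<in> H \<longleftrightarrow> Q (F (rep_cp2 q))"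
proof -
  obtain y where y: "y \<in> W" "q = proj y"
    using q by blast
  then have "y \<noteq> 0" using W by auto
  then obtain c where "c \<noteq> 0" "rep_cp2 q = c *s y"
    using rep_proj y by metis
  then show ?thesis
    using hom[of c y] P[OF y(1)] y \<open>y \<noteq> 0\<close> by simp
qed

lemma real_analytic_subvariety_levi_example: "real_analytic_subvariety levi_example"
  unfolding real_analytic_subvariety_def
proof (intro conjI allI closed_levi_example)
  fix p
  obtain z where z: "z \<noteq> 0" "p = proj z"
    using proj_surj by blast
  obtain W F where W: "open W" "z \<in> W" "0 \<notin> W"
    and hom: "\<And>c y. c \<noteq> 0 \<Longrightarrow> y \<noteq> 0 \<Longrightarrow> F (c *s y) = F y"
    and an: "\<And>(Z :: complex^2 \<Rightarrow> complex^3) w. (\<And>j. multi_analytic (\<lambda>v. Z v $ j) w) \<Longrightarrow> Z w \<in> W \<Longrightarrow>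
      multi_analytic (\<lambda>v. F (Z v)) w"
    and zero: "\<And>y. y \<in> W \<Longrightarrow> proj y \<in> levi_example \<longleftrightarrow> F y = (0::complex)"
    using local_equation[OF z(1)] by blast
  have iff: "q \<in> levi_example \<longleftrightarrow> F (rep_cp2 q) = 0" if "q \<in> proj ` W" for q
    by (rule proj_image_iff[of F W levi_example "\<lambda>x. x = 0" q, OF hom W(3) zero that])
  show "\<exists>U G. open U \<and> p \<in> U \<and> (\<forall>f\<in>G. real_analytic_on f U) \<and> levi_example \<inter> U = {q \<in> U. \<forall>f\<in>G. f q = 0}"
  proof (intro exI conjI)
    show "open (proj ` W)"
      by (rule open_proj_image[OF W(1,3)])
    show "p \<in> proj ` W"
      using W z by blast
    show "\<forall>f\<in>{\<lambda>p. Re (F (rep_cp2 p)), \<lambda>p. Im (F (rep_cp2 p))}. real_analytic_on f (proj ` W)"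
      using real_analytic_on_homogeneous[OF hom W(3) an] by blast
    show "levi_example \<inter> proj ` W = {q \<in> proj ` W. \<forall>f\<in>{\<lambda>p. Re (F (rep_cp2 p)), \<lambda>p. Im (F (rep_cp2 p))}. f q = 0}"
      using iff by (auto simp: complex_eq_iff)
  qed
qed

text \<open>The line through the point is unique and the root is simple; these turn out to be the regular points.\<close>

definition simple_point :: "complex^3 \<Rightarrow> real \<Rightarrow> bool" where
  "simple_point z t \<longleftrightarrow> z \<noteq> 0 \<and> incidence z (of_real t) = 0 \<and> deriv (incidence z) (of_real t) \<noteq> 0 \<and>
     (\<forall>t'. incidence z (of_real t') = 0 \<longrightarrow> (\<exists>k::int. t' = t + k * pi))"

lemma deriv_incidence_scale: "deriv (incidence (c *s z)) s = c * deriv (incidence z) s"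
  unfolding incidence_def deriv_pencil[OF dual_curve_holomorphic] by (rule pencil_scale)

lemma simple_point_scale: "simple_point z t \<Longrightarrow> c \<noteq> 0 \<Longrightarrow> simple_point (c *s z) t"
  by (simp add: simple_point_def incidence_scale deriv_incidence_scale scale_eq_0_iff)

lemma root_stable_mono:
  assumes "root_stable A \<theta> \<rho> z \<epsilon>" "0 < e" "e \<le> \<epsilon>"
  shows "root_stable A \<theta> \<rho> z e"
proof -
  obtain m B where mB: "0 < m" "0 \<le> B" "real CARD('a) * \<epsilon> * B \<le> m / 2"
    "\<forall>s\<in>sphere \<theta> \<rho>. m \<le> norm (pencil A z s) \<and> (\<forall>j. norm (A j s) \<le> B)" and \<rho>: "0 < \<rho>"
    using assms(1) unfolding root_stable_def by blast
  have "real CARD('a) * e * B \<le> real CARD('a) * \<epsilon> * B"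
    using mB assms by (intro mult_right_mono mult_left_mono) auto
  then have "real CARD('a) * e * B \<le> m / 2"
    using mB(3) by linarith
  with mB have "\<exists>m B. 0 < m \<and> 0 \<le> B \<and> real CARD('a) * e * B \<le> m / 2 \<and>
     (\<forall>s\<in>sphere \<theta> \<rho>. m \<le> norm (pencil A z s) \<and> (\<forall>j. norm (A j s) \<le> B))"
    by blast
  then show ?thesis
    unfolding root_stable_def using \<rho> assms(2) by blast
qed

lemma simple_zero_deriv_nonzero:
  assumes f: "f holomorphic_on UNIV" and "f s\<^sub>0 \<noteq> 0" and s: "f s = 0" "zorder f s = 1"
  shows "deriv f s \<noteq> 0"
proof -
  obtain r where r: "r > 0" "zor_poly f s holomorphic_on cball s r"
    "\<And>w. w \<in> cball s r \<Longrightarrow> f w = zor_poly f s w * (w - s) ^ nat 1 \<and> zor_poly f s w \<noteq> 0"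
    using zorder_exist_zero[OF f open_UNIV convex_connected[OF convex_UNIV] UNIV_I bexI[of _ s\<^sub>0], of s] assms by auto
  define g where "g = zor_poly f s"
  have "g holomorphic_on ball s r"
    using r(2) unfolding g_def by (rule holomorphic_on_subset) auto
  then have "(g has_field_derivative deriv g s) (at s)"
    using r(1) by (intro holomorphic_derivI[of g "ball s r"]) auto
  then have "((\<lambda>w. g w * (w - s)) has_field_derivative g s) (at s)"
    by (auto intro!: derivative_eq_intros)
  then have "(f has_field_derivative g s) (at s)"
    by (rule has_field_derivative_transform_within_open[where S = "ball s r"]) (use r g_def in auto)
  then show ?thesis
    using r by (simp add: DERIV_imp_deriv g_def)
qed

lemma zorder_simple_zero:
  assumes "f holomorphic_on UNIV" "f s = 0" "deriv f s \<noteq> 0"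
  shows "zorder f s = 1"
  by (rule zorder_zero_eqI[OF assms(1)]) (use assms in auto)

text \<open>On the ball around \<open>z\<close> the root near \<open>t\<close> is unique, hence given by the first power
  sum, and it alone decides membership in the union of lines.\<close>

definition root_chart :: "complex^3 \<Rightarrow> real \<Rightarrow> real \<Rightarrow> real \<Rightarrow> bool" where
  "root_chart z t \<rho> \<epsilon> \<longleftrightarrow> root_stable dual_curve (of_real t) \<rho> z \<epsilon> \<and>
     (\<forall>y\<in>ball z \<epsilon>. root_sum dual_curve (of_real t) \<rho> 0 y = 1 \<and>
        (proj y \<in> levi_example \<longleftrightarrow> Im (root_sum dual_curve (of_real t) \<rho> 1 y) = 0))"

text \<open>Since \<open>t\<close> is the only real root modulo \<open>\<pi>\<close>, the rest of the period centred at
  \<open>t\<close> stays free of roots for nearby points.\<close>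

lemma root_chart_exists:
  assumes z: "simple_point z t" and r: "r > 0"
  obtains \<rho> \<epsilon> where "\<rho> < r" "root_chart z t \<rho> \<epsilon>"
proof -
  let ?\<theta> = "complex_of_real t"
  have z0: "z \<noteq> 0" and root: "incidence z ?\<theta> = 0" and simple: "deriv (incidence z) ?\<theta> \<noteq> 0"
    and only: "\<And>t'. incidence z (of_real t') = 0 \<Longrightarrow> \<exists>k::int. t' = t + k * pi"
    using z unfolding simple_point_def by auto
  have "0 < min r (pi / 2)" using r by simp
  then obtain \<rho> \<epsilon>\<^sub>0 where \<rho>: "0 < \<rho>" "\<rho> < min r (pi / 2)" and iso: "\<And>s. s \<in> cball ?\<theta> \<rho> \<Longrightarrow> incidence z s = 0 \<Longrightarrow> s = ?\<theta>"
    and st0: "root_stable dual_curve ?\<theta> \<rho> z \<epsilon>\<^sub>0"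
    using isolated_root_disc[OF z0, of "min r (pi / 2)" ?\<theta>] by blast
  \<comment> \<open>The period is centred at \<open>t\<close>, so \<open>t\<close> is the only root in it.\<close>
  define K where "K = {t - pi / 2..t - pi / 2 + pi} - ball t \<rho>"
  have "compact K"
    unfolding K_def by (intro compact_diff) auto
  moreover have "incidence z (of_real t') \<noteq> 0" if "t' \<in> K" for t'
  proof
    assume "incidence z (of_real t') = 0"
    then obtain k :: int where k: "t' = t + k * pi"
      using only by blast
    have "- (1 / 2) * pi \<le> real_of_int k * pi" "real_of_int k * pi \<le> 1 / 2 * pi" "k \<noteq> 0"
      using that k \<rho> by (auto simp: K_def dist_real_def)
    then have "- (1 / 2) \<le> real_of_int k" "real_of_int k \<le> 1 / 2" "k \<noteq> 0"
      by (simp_all only: mult_le_cancel_right_pos[OF pi_gt_zero])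
    then show False by linarith
  qed
  ultimately obtain \<epsilon>K where \<epsilon>K: "\<epsilon>K > 0"
    "\<And>y t. y \<in> ball z \<epsilon>K \<Longrightarrow> t \<in> K \<Longrightarrow> incidence y (complex_of_real t) \<noteq> 0"
    using incidence_nonzero_nearby[of K z] by blast
  define \<epsilon> where "\<epsilon> = min \<epsilon>\<^sub>0 \<epsilon>K"
  have \<epsilon>: "\<epsilon> > 0" "\<epsilon> \<le> \<epsilon>\<^sub>0" "\<epsilon> \<le> \<epsilon>K"
    using \<epsilon>K st0 by (auto simp: \<epsilon>_def root_stable_def)
  have st: "root_stable dual_curve ?\<theta> \<rho> z \<epsilon>"
    by (rule root_stable_mono[OF st0 \<epsilon>(1,2)])
  have roots: "{s. s \<in> ball ?\<theta> \<rho> \<and> pencil dual_curve z s = 0} = {?\<theta>}"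
    using iso root \<rho> unfolding incidence_def by auto
  have "zorder (incidence z) ?\<theta> = 1"
    by (rule zorder_simple_zero[OF incidence_holomorphic root simple])
  then have count_z: "root_sum dual_curve ?\<theta> \<rho> 0 z = 1"
    unfolding root_sum_def roots incidence_def by simp
  have "root_chart z t \<rho> \<epsilon>"
    unfolding root_chart_def
  proof (intro conjI ballI st)
    fix y assume y: "y \<in> ball z \<epsilon>"
    show count: "root_sum dual_curve ?\<theta> \<rho> 0 y = 1"
      using root_count_constant[OF dual_curve_holomorphic st y] count_z by simp
    have y0: "y \<noteq> 0"
      by (rule root_stable_ball_nonzero(1)[OF st y])
    obtain s\<^sub>1 where "pencil dual_curve y s\<^sub>1 \<noteq> 0"
      using incidence_nonconstant[OF y0] by (auto simp: incidence_def)
    note R = single_root[OF dual_curve_holomorphic \<rho>(1) this count]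
    show "proj y \<in> levi_example \<longleftrightarrow> Im (root_sum dual_curve ?\<theta> \<rho> 1 y) = 0"
    proof
      assume "proj y \<in> levi_example"
      then obtain t\<^sub>1 where "incidence y (complex_of_real t\<^sub>1) = 0"
        using proj_in_levi_example[OF y0] by blast
      then obtain t' where t': "t' \<in> {t - pi / 2..t - pi / 2 + pi}" "incidence y (complex_of_real t') = 0"
        using real_root_in_period[of y t\<^sub>1 "t - pi / 2"] by metis
      have "y \<in> ball z \<epsilon>K" using y \<epsilon> by auto
      then have "t' \<in> ball t \<rho>"
        using \<epsilon>K(2) t' unfolding K_def by blast
      then have "of_real t' \<in> pencil_roots dual_curve ?\<theta> \<rho> y"
        using t' by (simp add: pencil_roots_def incidence_def dist_of_real)
      then show "Im (root_sum dual_curve ?\<theta> \<rho> 1 y) = 0"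
        unfolding R by (metis Im_complex_of_real singletonD)
    next
      assume "Im (root_sum dual_curve ?\<theta> \<rho> 1 y) = 0"
      then have "root_sum dual_curve ?\<theta> \<rho> 1 y = of_real (Re (root_sum dual_curve ?\<theta> \<rho> 1 y))"
        by (simp add: complex_eq_iff)
      moreover have "incidence y (root_sum dual_curve ?\<theta> \<rho> 1 y) = 0"
        using R by (auto simp: pencil_roots_def incidence_def)
      ultimately show "proj y \<in> levi_example"
        using proj_in_levi_example[OF y0] by metis
    qed
  qed
  with \<rho> show ?thesis
    by (intro that[of \<rho> \<epsilon>]) auto
qed

lemma root_chart_root:
  assumes rc: "root_chart z t \<rho> \<epsilon>" and y: "y \<in> ball z \<epsilon>"
  defines "s \<equiv> root_sum dual_curve (of_real t) \<rho> 1 y"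
  shows "y \<noteq> 0" "s \<in> ball (of_real t) \<rho>" "incidence y s = 0" "deriv (incidence y) s \<noteq> 0"
    "\<And>s'. s' \<in> ball (of_real t) \<rho> \<Longrightarrow> incidence y s' = 0 \<Longrightarrow> s' = s"
proof -
  let ?\<theta> = "complex_of_real t"
  have st: "root_stable dual_curve ?\<theta> \<rho> z \<epsilon>" and count: "root_sum dual_curve ?\<theta> \<rho> 0 y = 1"
    using rc y unfolding root_chart_def by auto
  have \<rho>: "\<rho> > 0" using st by (simp add: root_stable_def)
  show y0: "y \<noteq> 0"
    by (rule root_stable_ball_nonzero(1)[OF st y])
  obtain s\<^sub>1 where s\<^sub>1: "pencil dual_curve y s\<^sub>1 \<noteq> 0"
    using incidence_nonconstant[OF y0] by (auto simp: incidence_def)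
  note R = single_root[OF dual_curve_holomorphic \<rho> s\<^sub>1 count, folded s_def]
  show s: "s \<in> ball ?\<theta> \<rho>" "incidence y s = 0"
    and only: "\<And>s'. s' \<in> ball ?\<theta> \<rho> \<Longrightarrow> incidence y s' = 0 \<Longrightarrow> s' = s"
    using R by (auto simp: pencil_roots_def incidence_def)
  have "of_int (zorder (incidence y) s) = (1::complex)"
    using count unfolding root_sum_def pencil_roots_def[symmetric] R incidence_def by simp
  then have "zorder (incidence y) s = 1"
    by (metis of_int_1 of_int_eq_iff)
  then show "deriv (incidence y) s \<noteq> 0"
    using s\<^sub>1 by (intro simple_zero_deriv_nonzero[OF incidence_holomorphic _ s(2), of s\<^sub>1]) (auto simp: incidence_def)
qed

text \<open>Caratheodory's form of differentiability.\<close>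

lemma has_derivative_componentwise:
  fixes f :: "complex^'n \<Rightarrow> complex"
  assumes ev: "\<forall>\<^sub>F y in at x. f y - f x = (\<Sum>j\<in>UNIV. (y - x) $ j * c j y)"
    and c: "\<And>j. isCont (c j) x"
  shows "(f has_derivative (\<lambda>h. \<Sum>j\<in>UNIV. h $ j * c j x)) (at x)"
proof -
  have lin: "bounded_linear (\<lambda>h::complex^'n. \<Sum>j\<in>UNIV. h $ j * c j x)"
    by (intro bounded_linear_sum bounded_linear_mult_const bounded_linear_vec_nth)
  have "((\<lambda>y. norm (f y - f x - (\<Sum>j\<in>UNIV. (y - x) $ j * c j x)) / norm (y - x)) \<longlongrightarrow> 0) (at x)"
  proof (rule Lim_null_comparison)
    show "((\<lambda>y. \<Sum>j\<in>UNIV. norm (c j y - c j x)) \<longlongrightarrow> 0) (at x)"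
      using c by (intro tendsto_null_sum tendsto_norm_zero LIM_zero) (simp add: isCont_def)
    have "\<forall>\<^sub>F y in at x. y \<noteq> x"
      by (simp add: eventually_at_filter)
    with ev show "\<forall>\<^sub>F y in at x. norm (norm (f y - f x - (\<Sum>j\<in>UNIV. (y - x) $ j * c j x)) / norm (y - x))
        \<le> (\<Sum>j\<in>UNIV. norm (c j y - c j x))"
    proof eventually_elim
      case (elim y)
      have "f y - f x - (\<Sum>j\<in>UNIV. (y - x) $ j * c j x) = (\<Sum>j\<in>UNIV. (y - x) $ j * (c j y - c j x))"
        unfolding elim(1) by (simp add: sum_subtractf right_diff_distrib)
      also have "norm \<dots> \<le> (\<Sum>j\<in>UNIV. norm (y - x) * norm (c j y - c j x))"
        by (intro sum_norm_le) (auto simp: norm_mult simp del: vector_minus_component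
            intro!: mult_right_mono Finite_Cartesian_Product.norm_nth_le)
      finally show ?case
        using elim(2) by (simp add: divide_simps sum_distrib_left mult.commute)
    qed
  qed
  then show ?thesis
    using lin by (simp only: has_derivative_iff_norm)
qed

text \<open>Implicit differentiation of \<open>incidence y (\<Theta> y) = 0\<close>.\<close>

lemma root_chart_derivative:
  assumes rc: "root_chart z t \<rho> \<epsilon>" and y: "y \<in> ball z \<epsilon>"
  defines "\<Theta> \<equiv> root_sum dual_curve (of_real t) \<rho> 1"
  shows "(\<Theta> has_derivative (\<lambda>h. - incidence h (\<Theta> y) / deriv (incidence y) (\<Theta> y))) (at y)"
proof -
  define s where "s = \<Theta> y"
  have st: "root_stable dual_curve (of_real t) \<rho> z \<epsilon>"
    using rc unfolding root_chart_def by auto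
  note root = root_chart_root[OF rc, folded \<Theta>_def]
  have "multi_analytic \<Theta> y"
    unfolding \<Theta>_def
    by (rule root_sum_multi_analytic[of dual_curve, OF dual_curve_holomorphic st, where Z = "\<lambda>v. v"]) (use y in auto)
  then have cont: "isCont \<Theta> y"
    by (rule differentiable_imp_continuous_within[OF multi_analytic_imp_differentiable])
  have "(incidence y has_field_derivative deriv (incidence y) s) (at s)"
    by (rule holomorphic_derivI[OF incidence_holomorphic open_UNIV UNIV_I])
  then obtain q where q: "\<And>s'. incidence y s' - incidence y s = q s' * (s' - s)" "isCont q s" "q s = deriv (incidence y) s"
    unfolding CARAT_DERIV by blast
  have qs: "q s \<noteq> 0"
    using root(4)[OF y] q(3) by (simp add: s_def)
  have q\<Theta>: "isCont (\<lambda>y'. q (\<Theta> y')) y"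
    using q(2) by (intro isCont_o2[OF cont]) (simp add: s_def)
  define c where "c j y' = - dual_curve j (\<Theta> y') / q (\<Theta> y')" for j y'
  have "(\<Theta> has_derivative (\<lambda>h. \<Sum>j\<in>UNIV. h $ j * c j y)) (at y)"
  proof (rule has_derivative_componentwise)
    show "isCont (c j) y" for j
    proof -
      have "isCont (dual_curve j) (\<Theta> y)"
        using dual_curve_holomorphic[of j]
        by (meson UNIV_I continuous_on_eq_continuous_at holomorphic_on_imp_continuous_on open_UNIV)
      from isCont_o2[OF cont this] q\<Theta> qs show ?thesis
        unfolding c_def by (intro continuous_intros) (auto simp: s_def)
    qed
    have "\<forall>\<^sub>F y' in at y. q (\<Theta> y') \<noteq> 0"
      using q\<Theta> qs by (intro tendsto_imp_eventually_ne[of _ "q s"]) (simp_all add: isCont_def s_def)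
    moreover have "\<forall>\<^sub>F y' in at y. y' \<in> ball z \<epsilon>"
      using y by (intro eventually_at_in_open') auto
    ultimately show "\<forall>\<^sub>F y' in at y. \<Theta> y' - \<Theta> y = (\<Sum>j\<in>UNIV. (y' - y) $ j * c j y')"
    proof eventually_elim
      case (elim y')
      have "incidence y' (\<Theta> y') = incidence y (\<Theta> y') + incidence (y' - y) (\<Theta> y')"
        unfolding incidence_def by (rule pencil_diff)
      then have "q (\<Theta> y') * (\<Theta> y' - \<Theta> y) = - incidence (y' - y) (\<Theta> y')"
        using root(3)[OF elim(2)] root(3)[OF y] q(1)[of "\<Theta> y'"] by (simp add: s_def eq_neg_iff_add_eq_0)
      then have "\<Theta> y' - \<Theta> y = - incidence (y' - y) (\<Theta> y') / q (\<Theta> y')"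
        using elim(1) by (simp add: field_simps)
      also have "\<dots> = (\<Sum>j\<in>UNIV. (y' - y) $ j * c j y')"
        by (simp add: incidence_def pencil_def c_def sum_divide_distrib sum_negf)
      finally show ?case .
    qed
  qed
  moreover have "(\<Sum>j\<in>UNIV. h $ j * c j y) = - incidence h (\<Theta> y) / deriv (incidence y) (\<Theta> y)" for h
    using q(3) by (simp add: incidence_def pencil_def c_def sum_divide_distrib sum_negf s_def)
  ultimately show ?thesis
    by simp
qed

section \<open>Charts adapted to the lines\<close>

lemma root_chart_cone_derivative:
  assumes rc: "root_chart z t \<rho> \<epsilon>" and c: "c \<noteq> 0" "c *s y \<in> ball z \<epsilon>"
  defines "\<Theta> \<equiv> root_sum dual_curve (of_real t) \<rho> 1"
  shows "(\<Theta> has_derivative (\<lambda>h. - incidence h (\<Theta> y) / deriv (incidence y) (\<Theta> y))) (at y)"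
proof -
  have scale: "\<Theta> (c *s y) = \<Theta> y" for y
    using c by (simp add: \<Theta>_def root_sum_scale)
  have "bounded_linear (\<lambda>y::complex^3. c *s y)"
    by (rule linear_conv_bounded_linear[THEN iffD1], rule linearI)
      (simp_all add: vec_eq_iff algebra_simps)
  then have "((\<lambda>y. c *s y) has_derivative (\<lambda>h. c *s h)) (at y)"
    by (rule bounded_linear_imp_has_derivative)
  from has_derivative_compose[OF this root_chart_derivative[OF rc c(2), folded \<Theta>_def]]
  have "((\<lambda>y. \<Theta> (c *s y)) has_derivative
      (\<lambda>h. - incidence (c *s h) (\<Theta> (c *s y)) / deriv (incidence (c *s y)) (\<Theta> (c *s y)))) (at y)" .
  then show ?thesis
    using c by (simp add: scale incidence_scale deriv_incidence_scale)
qed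

definition lift_deriv :: "3 \<Rightarrow> complex^2 \<Rightarrow> complex^3" where
  "lift_deriv i h = (\<chi> j. if j = i then 0 else if j = i + 1 then h $ 1 else h $ 2)"

lemma lift_deriv_components [simp]:
  "lift_deriv i h $ i = 0" "lift_deriv i h $ (i + 1) = h $ 1" "lift_deriv i h $ (i + 2) = h $ 2"
  by (simp_all add: lift_deriv_def)

lemma lift_deriv_scale: "lift_deriv i (c *s h) = c *s lift_deriv i h"
  by (simp add: lift_deriv_def vec_eq_iff)

lemma lift_deriv_add: "lift_deriv i (h + k) = lift_deriv i h + lift_deriv i k"
  by (simp add: lift_deriv_def vec_eq_iff)

lemma lift_plus: "lift i (v + h) = lift i v + lift_deriv i h"
  by (simp add: lift_def lift_deriv_def vec_eq_iff)

lemma bounded_linear_lift_deriv: "bounded_linear (lift_deriv i)"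
  by (rule linear_conv_bounded_linear[THEN iffD1], rule linearI)
    (simp_all add: lift_deriv_def vec_eq_iff)

lemma has_derivative_lift: "(lift i has_derivative lift_deriv i) (at w)"
proof -
  have "((\<lambda>v. lift i 0 + lift_deriv i v) has_derivative (\<lambda>h. 0 + lift_deriv i h)) (at w)"
    by (intro has_derivative_add has_derivative_const bounded_linear_imp_has_derivative bounded_linear_lift_deriv)
  moreover have "(\<lambda>v. lift i 0 + lift_deriv i v) = lift i"
    by (simp flip: lift_plus)
  ultimately show ?thesis by simp
qed

lemma sum_index: "(\<Sum>j\<in>UNIV. f j) = f i + f (i + 1) + f (i + 2)" for i :: 3 and f :: "3 \<Rightarrow> complex"
proof -
  have "UNIV = {i, i + 1, i + 2}"
    using index_cases[of _ i] by blast
  then have "sum f UNIV = sum f {i, i + 1, i + 2}"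
    by (rule arg_cong)
  then show ?thesis
    by (simp add: add.assoc)
qed

lemma incidence_index:
  "incidence z s = z $ i * dual_curve i s + z $ (i + 1) * dual_curve (i + 1) s + z $ (i + 2) * dual_curve (i + 2) s"
  unfolding incidence_def pencil_def by (rule sum_index)

lemma dual_curve_nonzero: "\<exists>j. dual_curve j s \<noteq> 0"
proof (rule ccontr)
  assume "\<nexists>j. dual_curve j s \<noteq> 0"
  then have "dual_curve 1 s = 0" "dual_curve 2 s = 0" by auto
  then have "cos s = 0" "sin s = 0" by (simp_all add: dual_curve_def)
  then show False
    using sin_cos_squared_add[of s] by simp
qed

text \<open>A point with \<open>z $ i \<noteq> 0\<close> does not lie on the coordinate line \<open>z $ i = 0\<close>, so
  the coordinates of a line through it are not concentrated at \<open>i\<close>.\<close>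

lemma dual_curve_chart_nonzero:
  assumes "z $ i \<noteq> 0" "incidence z s = 0"
  shows "dual_curve (i + 1) s \<noteq> 0 \<or> dual_curve (i + 2) s \<noteq> 0"
proof (rule ccontr)
  assume *: "\<not> (dual_curve (i + 1) s \<noteq> 0 \<or> dual_curve (i + 2) s \<noteq> 0)"
  then have "z $ i * dual_curve i s = 0"
    using assms(2) incidence_index[of z s i] by simp
  then have "dual_curve j s = 0" for j
    using assms(1) * index_cases[of j i] by auto
  then show False
    using dual_curve_nonzero by blast
qed

lemma rep_affine:
  assumes "\<And>c y. c \<noteq> 0 \<Longrightarrow> y \<noteq> 0 \<Longrightarrow> F (c *s y) = F y"
  shows "F (rep_cp2 (affine_point i v)) = F (lift i v)"
  using rep_proj[OF lift_nonzero[of i v]] assms unfolding affine_point_eq by (metis lift_nonzero)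

lemma root_chart_affine_derivative:
  assumes rc: "root_chart z t \<rho> \<epsilon>" and w: "affine_point i w \<in> proj ` ball z \<epsilon>"
  defines "\<Theta> \<equiv> root_sum dual_curve (of_real t) \<rho> 1"
  shows "((\<lambda>v. \<Theta> (lift i v)) has_derivative
      (\<lambda>h. - incidence (lift_deriv i h) (\<Theta> (lift i w)) / deriv (incidence (lift i w)) (\<Theta> (lift i w)))) (at w)"
    and "incidence (lift i w) (\<Theta> (lift i w)) = 0" and "deriv (incidence (lift i w)) (\<Theta> (lift i w)) \<noteq> 0"
    and "\<Theta> (lift i w) \<in> ball (of_real t) \<rho>"
proof -
  obtain y where y: "y \<in> ball z \<epsilon>" "proj (lift i w) = proj y"
    using w unfolding affine_point_eq by blast
  have y0: "y \<noteq> 0"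
    by (rule root_chart_root(1)[OF rc y(1)])
  obtain c where c: "c \<noteq> 0" "y = c *s lift i w"
    using proj_eqE[OF y(2) lift_nonzero y0] by blast
  have \<Theta>: "\<Theta> y = \<Theta> (lift i w)"
    unfolding \<Theta>_def c(2) using c(1) by (simp add: root_sum_scale)
  have "(\<Theta> has_derivative (\<lambda>h. - incidence h (\<Theta> (lift i w)) / deriv (incidence (lift i w)) (\<Theta> (lift i w)))) (at (lift i w))"
    unfolding \<Theta>_def by (rule root_chart_cone_derivative[OF rc c(1)]) (use y c in simp)
  from has_derivative_compose[OF has_derivative_lift this]
  show "((\<lambda>v. \<Theta> (lift i v)) has_derivative
      (\<lambda>h. - incidence (lift_deriv i h) (\<Theta> (lift i w)) / deriv (incidence (lift i w)) (\<Theta> (lift i w)))) (at w)" .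
  note root = root_chart_root[OF rc y(1), folded \<Theta>_def, unfolded \<Theta>]
  show "\<Theta> (lift i w) \<in> ball (of_real t) \<rho>"
    by (rule root(2))
  show "incidence (lift i w) (\<Theta> (lift i w)) = 0"
    using root(3) c by (simp add: incidence_scale)
  show "deriv (incidence (lift i w)) (\<Theta> (lift i w)) \<noteq> 0"
    using root(4) unfolding c(2) deriv_incidence_scale using c(1) by simp
qed

text \<open>The equation is that the root is real. Its differential is nonzero in every affine chart: the derivative of the
  root is a nonzero complex-linear form, so it takes nonreal values.\<close>

lemma root_chart_submanifold:
  assumes rc: "root_chart z t \<rho> \<epsilon>" and q: "q \<in> levi_example" "q \<in> proj ` ball z \<epsilon>"
  shows "submanifold_near 3 levi_example q"
proof -
  define \<Theta> where "\<Theta> = root_sum dual_curve (of_real t) \<rho> 1"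
  define f where "f = (\<lambda>p. Im (\<Theta> (rep_cp2 p)))"
  let ?W = "ball z \<epsilon>" and ?U = "proj ` ball z \<epsilon>"
  have st: "root_stable dual_curve (of_real t) \<rho> z \<epsilon>"
    using rc by (simp add: root_chart_def)
  have hom: "\<Theta> (c *s y) = \<Theta> y" if "c \<noteq> 0" for c y
    using that by (simp add: \<Theta>_def root_sum_scale)
  have W0: "0 \<notin> ?W"
    using root_stable_ball_nonzero(1)[OF st] by blast
  have an: "real_analytic_on f ?U"
    unfolding f_def
  proof (rule real_analytic_on_homogeneous(2)[OF hom W0])
    show "multi_analytic (\<lambda>v. \<Theta> (Z v)) w" if "\<And>j. multi_analytic (\<lambda>v. Z v $ j) w" "Z w \<in> ?W"
      for Z :: "complex^2 \<Rightarrow> complex^3" and w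
      unfolding \<Theta>_def by (rule root_sum_multi_analytic[OF dual_curve_holomorphic st that])
  qed
  have zero: "p \<in> levi_example \<longleftrightarrow> f p = 0" if "p \<in> ?U" for p
    unfolding f_def
    by (rule proj_image_iff[of \<Theta> ?W levi_example "\<lambda>x. Im x = 0" p, OF hom W0 _ that])
      (use rc in \<open>auto simp: root_chart_def \<Theta>_def\<close>)
  have nondegenerate: "c = 0"
    if w: "affine_point i w \<in> ?U" and c: "\<And>h. c * frechet_derivative (\<lambda>v. f (affine_point i v)) (at w) h = 0"
    for i w and c :: real
  proof -
    let ?s = "\<Theta> (lift i w)" and ?d = "deriv (incidence (lift i w)) (\<Theta> (lift i w))"
    note der = root_chart_affine_derivative[OF rc w, folded \<Theta>_def]
    have "((\<lambda>v. Im (\<Theta> (lift i v))) has_derivative (\<lambda>h. Im (- incidence (lift_deriv i h) ?s / ?d))) (at w)"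
      by (rule has_derivative_Im[OF der(1)])
    moreover have "(\<lambda>v. f (affine_point i v)) = (\<lambda>v. Im (\<Theta> (lift i v)))"
      unfolding f_def using rep_affine[of \<Theta>, OF hom] by simp
    ultimately have fd: "frechet_derivative (\<lambda>v. f (affine_point i v)) (at w) = (\<lambda>h. Im (- incidence (lift_deriv i h) ?s / ?d))"
      by (simp add: frechet_derivative_at[symmetric])
    have "\<exists>h. incidence (lift_deriv i h) ?s \<noteq> 0"
    proof -
      have *: "incidence (lift_deriv i h) ?s = h $ 1 * dual_curve (i + 1) ?s + h $ 2 * dual_curve (i + 2) ?s" for h
        by (subst incidence_index[of _ _ i]) simp
      have "dual_curve (i + 1) ?s \<noteq> 0 \<or> dual_curve (i + 2) ?s \<noteq> 0"
        by (rule dual_curve_chart_nonzero[of "lift i w"]) (use der in auto)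
      then show ?thesis
      proof (elim disjE)
        show ?thesis if "dual_curve (i + 1) ?s \<noteq> 0"
          using *[of "vector [1, 0]"] that by (intro exI[of _ "vector [1, 0]"]) simp
        show ?thesis if "dual_curve (i + 2) ?s \<noteq> 0"
          using *[of "vector [0, 1]"] that by (intro exI[of _ "vector [0, 1]"]) simp
      qed
    qed
    then obtain h where h: "incidence (lift_deriv i h) ?s \<noteq> 0" by blast
    define k where "k = - \<i> * ?d / incidence (lift_deriv i h) ?s"
    have "Im (- incidence (lift_deriv i (k *s h)) ?s / ?d) = 1"
      unfolding lift_deriv_scale incidence_scale k_def using h der(3) by simp
    then show ?thesis
      using c[of "k *s h"] unfolding fd by simp
  qed
  show ?thesis
    unfolding submanifold_near_def
  proof (intro conjI exI[of _ ?U] exI[of _ "\<lambda>_. f"])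
    show "open ?U"
      by (rule open_proj_image[OF open_ball W0])
    show "levi_example \<inter> ?U = {q \<in> ?U. \<forall>k<(4::nat) - 3. f q = 0}"
      using zero by auto
    show "\<forall>i w. affine_point i w \<in> levi_example \<inter> ?U \<longrightarrow> (\<forall>c. (\<forall>h. (\<Sum>k<(4::nat) - 3. c k *
        frechet_derivative (\<lambda>v. f (affine_point i v)) (at w) h) = 0) \<longrightarrow> (\<forall>k<(4::nat) - 3. c k = 0))"
    proof (intro allI impI)
      fix i w and c :: "nat \<Rightarrow> real" and k :: nat
      assume w: "affine_point i w \<in> levi_example \<inter> ?U" and k: "k < 4 - 3"
        and c: "\<forall>h. (\<Sum>k<(4::nat) - 3. c k * frechet_derivative (\<lambda>v. f (affine_point i v)) (at w) h) = 0"
      have "c 0 * frechet_derivative (\<lambda>v. f (affine_point i v)) (at w) h = 0" for h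
        using c[rule_format, of h] by simp
      then have "c 0 = 0"
        using nondegenerate[of i w "c 0"] w by blast
      with k show "c k = 0" by simp
    qed
  qed (use q an in auto)
qed

lemma open_affine_image:
  assumes "open B"
  shows "open (affine_point i ` B)"
proof -
  let ?c = "\<lambda>z::complex^3. \<chi> k::2. if k = 1 then z $ (i + 1) / z $ i else z $ (i + 2) / z $ i"
  have eq: "{z. z \<noteq> 0 \<and> proj z \<in> affine_point i ` B} = {z. z $ i \<noteq> 0} \<inter> ?c -` B"
  proof (intro equalityI subsetI)
    fix z assume "z \<in> {z. z \<noteq> 0 \<and> proj z \<in> affine_point i ` B}"
    then obtain v where v: "z \<noteq> 0" "v \<in> B" "proj (lift i v) = proj z"
      unfolding affine_point_eq by force
    then obtain c where c: "c \<noteq> 0" "z = c *s lift i v"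
      using proj_eqE[OF v(3) lift_nonzero v(1)] by blast
    have "?c z = v"
      unfolding vec_eq_iff forall_2 using c by simp
    then have "?c z \<in> B"
      using v(2) by simp
    moreover have "z $ i \<noteq> 0"
      using c by simp
    ultimately show "z \<in> {z. z $ i \<noteq> 0} \<inter> ?c -` B"
      by blast
  next
    fix z assume z: "z \<in> {z. z $ i \<noteq> 0} \<inter> ?c -` B"
    have "?c z = vector [z $ (i + 1) / z $ i, z $ (i + 2) / z $ i]"
      unfolding vec_eq_iff forall_2 by simp
    then have "z = z $ i *s lift i (?c z)"
      using z lift_surj[of z i] by (simp only:) simp
    then have "proj z = proj (z $ i *s lift i (?c z))"
      by (rule arg_cong)
    also have "\<dots> = affine_point i (?c z)"
      unfolding affine_point_eq using z by (intro proj_scale) auto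
    finally have "proj z = affine_point i (?c z)" .
    moreover have "z \<noteq> 0" using z by auto
    ultimately show "z \<in> {z. z \<noteq> 0 \<and> proj z \<in> affine_point i ` B}"
      using z by blast
  qed
  have "continuous_on {z. z $ i \<noteq> 0} ?c"
  proof (rule continuous_on_vec_lambda)
    fix k :: 2
    show "continuous_on {z. z $ i \<noteq> 0} (\<lambda>z::complex^3. if k = 1 then z $ (i + 1) / z $ i else z $ (i + 2) / z $ i)"
      by (cases "k = 1") (auto intro!: continuous_intros)
  qed
  moreover have "open {z::complex^3. z $ i \<noteq> 0}"
    by (intro open_Collect_neq continuous_intros)
  ultimately have "open ({z. z $ i \<noteq> 0} \<inter> ?c -` B)"
    using assms by (simp add: continuous_on_open_vimage Int_commute)
  then show ?thesis
    unfolding open_cp2_def eq .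
qed

lemma invertible_matrix_of_linear:
  fixes D :: "complex^2 \<Rightarrow> complex^2"
  assumes add: "\<And>h k. D (h + k) = D h + D k" and scale: "\<And>c h. D (c *s h) = c *s D h"
    and ker: "\<And>h. D h = 0 \<Longrightarrow> h = 0"
  shows "\<exists>A :: complex^2^2. invertible A \<and> D = (\<lambda>h. A *v h)"
proof -
  have "Vector_Spaces.linear (*s) (*s) D"
    using add scale by unfold_locales auto
  then have D: "matrix D *v h = D h" for h
    by (rule matrix_works)
  then have "\<forall>x. matrix D *v x = 0 \<longrightarrow> x = 0"
    using ker by simp
  then have "invertible (matrix D)"
    using matrix_left_invertible_ker invertible_left_inverse by blast
  with D show ?thesis
    by (intro exI[of _ "matrix D"]) auto
qed

lemma has_derivative_vector_2:
  fixes f g :: "'a::real_normed_vector \<Rightarrow> complex"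
  assumes "(f has_derivative f') (at x)" "(g has_derivative g') (at x)"
  shows "((\<lambda>v. vector [f v, g v] :: complex^2) has_derivative (\<lambda>h. vector [f' h, g' h])) (at x)"
proof -
  have lin: "bounded_linear (\<lambda>a::complex. a *s axis k 1 :: complex^2)" for k
    by (rule linear_conv_bounded_linear[THEN iffD1], rule linearI) (simp_all add: vec_eq_iff algebra_simps)
  have eq: "vector [a, b] = a *s axis 1 1 + b *s (axis 2 1 :: complex^2)" for a b :: complex
    unfolding vec_eq_iff forall_2 by (simp add: axis_def)
  show ?thesis
    unfolding eq by (intro has_derivative_add bounded_linear.has_derivative[OF lin] assms)
qed

lemma two_by_two_zero:
  fixes a b a' b' x y :: complex
  assumes "a * x + b * y = 0" "b' * x - a' * y = 0" "a * a' + b * b' \<noteq> 0"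
  shows "x = 0" "y = 0"
proof -
  have "(a * a' + b * b') * x = a' * (a * x + b * y) + b * (b' * x - a' * y)"
    by (simp add: algebra_simps)
  then show "x = 0" using assms by simp
  have "(a * a' + b * b') * y = b' * (a * x + b * y) - a * (b' * x - a' * y)"
    by (simp add: algebra_simps)
  then show "y = 0" using assms by simp
qed

definition leaf_line :: "real \<Rightarrow> cp2 set" where
  "leaf_line t = {proj z | z. z \<noteq> 0 \<and> incidence z (of_real t) = 0}"

lemma proj_in_leaf_line: "z \<noteq> 0 \<Longrightarrow> proj z \<in> leaf_line t \<longleftrightarrow> incidence z (of_real t) = 0"
  unfolding leaf_line_def using incidence_proj_cong by blast

lemma dual_curve_real: "dual_curve j (of_real t) \<in> \<real>"
  by (auto simp: dual_curve_def sin_cos_real cos_of_real sin_of_real)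

text \<open>The first coordinate is the root \<open>\<Theta>\<close>, so that the sets where it is constant are pieces of
  lines. The second is a linear function \<open>lin\<close>, divided by the chart coordinate, that restricts to a
  coordinate on each of these lines; \<open>\<Delta> s \<noteq> 0\<close> says so for the line with parameter
  \<open>s\<close>. The domain is the image of a ball in an affine chart, which makes the plaque on
  \<open>L\<^sub>t\<close> convex in this chart and therefore connected.\<close>

lemma adapted_levi_chart:
  assumes sp: "simple_point z t"
  obtains U \<zeta> where "proj z \<in> U" "levi_chart levi_example U \<zeta>"
    "\<And>p q. p \<in> U \<inter> leaf_line t \<Longrightarrow> q \<in> U \<inter> leaf_line t \<Longrightarrow> same_plaque levi_example p q"
proof -
  obtain i w where iw: "proj z = affine_point i w"
    by (rule affine_point_surj)
  have z0: "z \<noteq> 0" using sp by (simp add: simple_point_def)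
  define y where "y = lift i w"
  have "proj z = proj y"
    using iw by (simp add: affine_point_eq y_def)
  then obtain c where "c \<noteq> 0" "y = c *s z"
    using proj_eqE[of z y] z0 by (metis lift_nonzero y_def)
  then have sp_y: "simple_point y t"
    using sp simple_point_scale by blast
  then have y_t: "incidence y (of_real t) = 0"
    by (simp add: simple_point_def)
  define a0 b0 where "a0 = dual_curve (i + 1) (of_real t)" and "b0 = dual_curve (i + 2) (of_real t)"
  define \<Delta> where "\<Delta> s = dual_curve (i + 1) s * a0 + dual_curve (i + 2) s * b0" for s
  \<comment> \<open>On the real curve this is a sum of two squares, which do not both vanish.\<close>
  have "\<Delta> (of_real t) \<noteq> 0"
  proof -
    obtain x x' where x: "a0 = of_real x" "b0 = of_real x'"
      using dual_curve_real unfolding a0_def b0_def by (meson Reals_cases)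
    have "a0 \<noteq> 0 \<or> b0 \<noteq> 0"
      unfolding a0_def b0_def by (rule dual_curve_chart_nonzero[of y]) (use y_t in \<open>auto simp: y_def\<close>)
    then have "x * x + x' * x' \<noteq> 0"
      using x sum_squares_eq_zero_iff[of x x'] by auto
    moreover have "\<Delta> (of_real t) = of_real (x * x + x' * x')"
      unfolding \<Delta>_def using x by (simp add: a0_def b0_def)
    ultimately show ?thesis
      by (simp only: of_real_eq_0_iff not_False_eq_True)
  qed
  moreover have "isCont \<Delta> (of_real t)"
  proof -
    have "\<Delta> holomorphic_on UNIV"
      unfolding \<Delta>_def by (intro holomorphic_intros dual_curve_holomorphic)
    then show ?thesis
      by (meson UNIV_I continuous_on_eq_continuous_at holomorphic_on_imp_continuous_on open_UNIV)
  qed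
  ultimately obtain r where r: "r > 0" "\<And>s. dist (of_real t) s < r \<Longrightarrow> \<Delta> s \<noteq> 0"
    using continuous_at_avoid[of "of_real t" \<Delta> 0] by auto
  obtain \<rho> \<epsilon> where \<rho>: "\<rho> < r" and rc: "root_chart y t \<rho> \<epsilon>"
    using root_chart_exists[OF sp_y r(1)] by blast
  define \<Theta> where "\<Theta> = root_sum dual_curve (of_real t) \<rho> 1"
  have st: "root_stable dual_curve (of_real t) \<rho> y \<epsilon>"
    using rc by (simp add: root_chart_def)
  have hom: "\<Theta> (c *s y) = \<Theta> y" if "c \<noteq> 0" for c y
    using that by (simp add: \<Theta>_def root_sum_scale)
  have "open (lift i -` ball y \<epsilon>)"
    by (rule open_vimage[OF open_ball continuous_on_lift])
  moreover have "w \<in> lift i -` ball y \<epsilon>"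
    using st by (simp add: root_stable_def y_def)
  ultimately obtain r' where r': "r' > 0" "ball w r' \<subseteq> lift i -` ball y \<epsilon>"
    using open_contains_ball by blast
  define U where "U = affine_point i ` ball w r'"
  have U: "open U" "proj z \<in> U"
    unfolding U_def using open_affine_image r'(1) iw by auto
  have U_sub: "U \<subseteq> proj ` ball y \<epsilon>"
    unfolding U_def affine_point_eq using r'(2) by auto
  define lin where "lin y = b0 * y $ (i + 1) - a0 * y $ (i + 2)" for y :: "complex^3"
  define \<zeta>' where "\<zeta>' y = (vector [\<Theta> y, lin y / y $ i] :: complex^2)" for y
  have hom': "\<zeta>' (c *s y) = \<zeta>' y" if "c \<noteq> 0" for c y
  proof -
    have "lin (c *s y) = c * lin y"
      by (simp add: lin_def algebra_simps)
    then show ?thesis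
      unfolding \<zeta>'_def hom[OF that] using that by simp
  qed
  define \<zeta> where "\<zeta> p = \<zeta>' (rep_cp2 p)" for p
  have \<zeta>_aff: "\<zeta> (affine_point j v) = \<zeta>' (lift j v)" for j v
    unfolding \<zeta>_def by (rule rep_affine[of \<zeta>', OF hom'])
  have root: "incidence (lift j v) (\<Theta> (lift j v)) = 0" "\<Delta> (\<Theta> (lift j v)) \<noteq> 0"
    if "affine_point j v \<in> U" for j v
  proof -
    note der = root_chart_affine_derivative[OF rc, of j v, folded \<Theta>_def]
    have in': "affine_point j v \<in> proj ` ball y \<epsilon>"
      using that U_sub by blast
    show "incidence (lift j v) (\<Theta> (lift j v)) = 0"
      by (rule der(2)[OF in'])
    show "\<Delta> (\<Theta> (lift j v)) \<noteq> 0"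
      using der(4)[OF in'] \<rho> by (intro r(2)) auto
  qed
  have coords: "holomorphic_coordinates U \<zeta>"
    unfolding holomorphic_coordinates_def
  proof (intro conjI allI impI U(1) inj_onI)
    fix p p' assume pp: "p \<in> U" "p' \<in> U" "\<zeta> p = \<zeta> p'"
    then obtain v v' where v: "p = affine_point i v" "p' = affine_point i v'"
      unfolding U_def by blast
    have "\<zeta>' (lift i v) = \<zeta>' (lift i v')"
      using pp v \<zeta>_aff by simp
    then have eq: "\<Theta> (lift i v) = \<Theta> (lift i v')" "lin (lift i v) = lin (lift i v')"
      unfolding \<zeta>'_def vec_eq_iff forall_2 by auto
    define s where "s = \<Theta> (lift i v)"
    have "incidence (lift i v) s = 0" "incidence (lift i v') s = 0" and \<Delta>s: "\<Delta> s \<noteq> 0"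
      using root[of i v] root[of i v'] pp v eq by (auto simp: s_def)
    moreover have "dual_curve (i + 1) s * (v $ 1 - v' $ 1) + dual_curve (i + 2) s * (v $ 2 - v' $ 2)
        = incidence (lift i v) s - incidence (lift i v') s"
      unfolding incidence_index[of _ s i] lift_same lift_components by (simp add: algebra_simps)
    ultimately have "dual_curve (i + 1) s * (v $ 1 - v' $ 1) + dual_curve (i + 2) s * (v $ 2 - v' $ 2) = 0"
      by simp
    moreover have "b0 * (v $ 1 - v' $ 1) - a0 * (v $ 2 - v' $ 2) = 0"
      using eq(2) unfolding lin_def lift_components by (simp add: algebra_simps)
    ultimately have "v $ 1 - v' $ 1 = 0" "v $ 2 - v' $ 2 = 0"
      using two_by_two_zero \<Delta>s unfolding \<Delta>_def by blast+
    then have "v = v'"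
      by (simp add: vec_eq_iff forall_2)
    with v show "p = p'" by simp
  next
    fix j v assume v: "affine_point j v \<in> U"
    define x where "x = lift j v"
    define s where "s = \<Theta> x"
    define d where "d = deriv (incidence x) s"
    have in': "affine_point j v \<in> proj ` ball y \<epsilon>"
      using v U_sub by blast
    note der = root_chart_affine_derivative[OF rc in', folded \<Theta>_def x_def, folded s_def, folded d_def]
    have xi: "x $ i \<noteq> 0"
    proof -
      obtain v' where "proj x = proj (lift i v')"
        using v unfolding U_def affine_point_eq x_def by blast
      then obtain c where "c \<noteq> 0" "x = c *s lift i v'"
        using proj_eqE[of "lift i v'" x] by (metis lift_nonzero x_def)
      then show ?thesis by simp
    qed
    define D where "D h = (vector [- incidence (lift_deriv j h) s / d,
      (lin (lift_deriv j h) * x $ i - lin x * lift_deriv j h $ i) / (x $ i * x $ i)] :: complex^2)" for h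
    have lin_bl: "bounded_linear lin"
      unfolding lin_def by (intro bounded_linear_sub bounded_linear_const_mult bounded_linear_vec_nth)
    have "((\<lambda>x. lin x / x $ i) has_derivative (\<lambda>h. (lin h * x $ i - lin x * h $ i) / (x $ i * x $ i))) (at x)"
      by (intro has_derivative_divide' bounded_linear_imp_has_derivative lin_bl bounded_linear_vec_nth xi)
    from has_derivative_compose[OF has_derivative_lift, OF this[unfolded x_def]]
    have "((\<lambda>v. lin (lift j v) / lift j v $ i) has_derivative
       (\<lambda>h. (lin (lift_deriv j h) * x $ i - lin x * lift_deriv j h $ i) / (x $ i * x $ i))) (at v)"
      by (simp add: x_def)
    from has_derivative_vector_2[OF der(1) this]
    have has_D: "((\<lambda>v. \<zeta> (affine_point j v)) has_derivative D) (at v)"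
      unfolding \<zeta>_aff \<zeta>'_def D_def[abs_def] .
    have "\<exists>A :: complex^2^2. invertible A \<and> D = (\<lambda>h. A *v h)"
    proof (rule invertible_matrix_of_linear)
      show "D (h + k) = D h + D k" for h k
        unfolding D_def vec_eq_iff forall_2 lift_deriv_add
        by (simp add: lin_def incidence_eq add_divide_distrib[symmetric] diff_divide_distrib[symmetric] algebra_simps)
      show "D (c *s h) = c *s D h" for c h
        unfolding D_def vec_eq_iff forall_2 lift_deriv_scale incidence_scale
        by (simp add: lin_def algebra_simps)
      fix h assume "D h = 0"
      define h' where "h' = lift_deriv j h"
      have inc: "incidence h' s = 0" and linh: "lin h' * x $ i = lin x * h' $ i"
        using \<open>D h = 0\<close> der(3) xi unfolding D_def vec_eq_iff forall_2 h'_def by auto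
      \<comment> \<open>A kernel vector differs from a multiple of \<open>x\<close> by a vector that is tangent to the line and on which \<open>lin\<close> vanishes.\<close>
      define \<kappa> where "\<kappa> = h' $ i / x $ i"
      define k where "k = h' - \<kappa> *s x"
      have ki: "k $ i = 0"
        using xi by (simp add: k_def \<kappa>_def)
      have "incidence k s = incidence h' s - \<kappa> * incidence x s"
        by (simp add: k_def incidence_eq algebra_simps)
      then have "incidence k s = 0"
        using inc der(2) by simp
      then have e1: "dual_curve (i + 1) s * k $ (i + 1) + dual_curve (i + 2) s * k $ (i + 2) = 0"
        unfolding incidence_index[of k s i] ki by (simp add: mult.commute)
      have "lin k = lin h' - \<kappa> * lin x"
        by (simp add: k_def lin_def algebra_simps)
      also have "\<dots> = 0"
        using linh xi by (simp add: \<kappa>_def field_simps)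
      finally have e2: "b0 * k $ (i + 1) - a0 * k $ (i + 2) = 0"
        by (simp add: lin_def)
      have "\<Delta> s \<noteq> 0"
        using root(2)[OF v] by (simp add: s_def x_def)
      then have "k $ (i + 1) = 0" "k $ (i + 2) = 0"
        using two_by_two_zero[OF e1 e2] unfolding \<Delta>_def by blast+
      then have "k = 0"
        unfolding vec_eq_iff using ki index_cases[of _ i] by (metis zero_index)
      then have hk: "h' = \<kappa> *s x"
        by (simp add: k_def)
      from arg_cong[OF hk, of "\<lambda>z. z $ j"] have "\<kappa> = 0"
        by (simp add: h'_def x_def)
      with hk have "h' = 0" by simp
      then have "h' $ (j + 1) = 0" "h' $ (j + 2) = 0" by simp_all
      then show "h = 0"
        by (simp add: h'_def vec_eq_iff forall_2)
    qed
    then show "\<exists>A :: complex^2^2. invertible A \<and> ((\<lambda>v. \<zeta> (affine_point j v)) has_derivative (\<lambda>h. A *v h)) (at v)"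
      using has_D by metis
  qed
  have chart: "levi_chart levi_example U \<zeta>"
    unfolding levi_chart_def
  proof (intro conjI coords)
    have W0: "0 \<notin> ball y \<epsilon>"
      using root_stable_ball_nonzero(1)[OF st] by blast
    have "p \<in> levi_example \<longleftrightarrow> Im (\<Theta> (rep_cp2 p)) = 0" if "p \<in> U" for p
      by (rule proj_image_iff[of \<Theta> "ball y \<epsilon>" levi_example "\<lambda>x. Im x = 0" p, OF hom W0])
        (use rc that U_sub in \<open>auto simp: root_chart_def \<Theta>_def\<close>)
    moreover have "p \<in> regular_part levi_example \<longleftrightarrow> p \<in> levi_example" if "p \<in> U" for p
      using root_chart_submanifold[OF rc, of p] that U_sub
      by (auto simp: regular_part_def submanifold_near_def)
    ultimately show "regular_part levi_example \<inter> U = {q \<in> U. Im (\<zeta> q $ 1) = 0}"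
      by (auto simp: \<zeta>_def \<zeta>'_def)
  qed
  have \<rho>_pos: "\<rho> > 0"
    using st by (simp add: root_stable_def)
  define S where "S = {v \<in> ball w r'. incidence (lift i v) (of_real t) = 0}"
  have S: "{p \<in> U. \<zeta> p $ 1 = complex_of_real t} = affine_point i ` S"
  proof -
    have "\<zeta> (affine_point i v) $ 1 = complex_of_real t \<longleftrightarrow> incidence (lift i v) (of_real t) = 0" if v: "v \<in> ball w r'" for v
    proof -
      have "lift i v \<in> ball y \<epsilon>" using v r' by auto
      note rt = root_chart_root[OF rc this, folded \<Theta>_def]
      show ?thesis
        unfolding \<zeta>_aff \<zeta>'_def using rt(3) rt(5)[of "of_real t"] \<rho>_pos by auto
    qed
    then show ?thesis
      unfolding U_def S_def by auto
  qed
  have "convex S"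
    unfolding convex_alt
  proof (intro ballI allI impI)
    fix v v' :: "complex^2" and u :: real assume v: "v \<in> S" "v' \<in> S" and u: "0 \<le> u \<and> u \<le> 1"
    have "(1 - u) *\<^sub>R v + u *\<^sub>R v' \<in> ball w r'"
      using v u convex_ball[of w r'] unfolding S_def convex_alt by auto
    moreover have "incidence (lift i ((1 - u) *\<^sub>R v + u *\<^sub>R v')) (of_real t)
        = (1 - u) * incidence (lift i v) (of_real t) + u * incidence (lift i v') (of_real t)"
      unfolding incidence_index[of _ _ i] lift_same lift_components vector_add_component vector_scaleR_component
      by (simp add: scaleR_conv_of_real algebra_simps)
    ultimately show "(1 - u) *\<^sub>R v + u *\<^sub>R v' \<in> S"
      using v by (simp add: S_def)
  qed
  then have conn: "connected {p \<in> U. \<zeta> p $ 1 = complex_of_real t}"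
    unfolding S by (intro connected_continuous_image continuous_on_affine_point convex_connected)
  show ?thesis
  proof (rule that[OF U(2) chart])
    fix p q assume pq: "p \<in> U \<inter> leaf_line t" "q \<in> U \<inter> leaf_line t"
    have "x \<in> {p \<in> U. \<zeta> p $ 1 = complex_of_real t}" if x: "x \<in> U \<inter> leaf_line t" for x
    proof -
      obtain v where v: "v \<in> ball w r'" "x = affine_point i v"
        using x unfolding U_def by blast
      then have "incidence (lift i v) (of_real t) = 0"
        using x proj_in_leaf_line[OF lift_nonzero] by (auto simp: affine_point_eq)
      then show ?thesis
        unfolding S using v by (auto simp: S_def)
    qed
    then have "connected_component {p \<in> U. \<zeta> p $ 1 = complex_of_real t} p q"
      unfolding connected_component_def using pq conn by blast
    then show "same_plaque levi_example p q"
      unfolding same_plaque_def using chart by blast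
  qed
qed

section \<open>Regular points\<close>

lemma submanifold_near_3E:
  assumes "submanifold_near 3 H p"
  obtains U f where "open U" "p \<in> U" "real_analytic_on f U" "\<And>q. q \<in> U \<Longrightarrow> q \<in> H \<longleftrightarrow> f q = 0"
    "\<And>i w. affine_point i w \<in> H \<inter> U \<Longrightarrow>
      \<exists>h. frechet_derivative (\<lambda>v. f (affine_point i v)) (at w) h \<noteq> 0"
    "\<And>q. q \<in> H \<inter> U \<Longrightarrow> submanifold_near 3 H q"
proof -
  obtain U f where U: "open U" "p \<in> U" and an: "\<forall>k<(4::nat) - 3. real_analytic_on (f k) U"
    and zero: "H \<inter> U = {q \<in> U. \<forall>k<(4::nat) - 3. f k q = 0}"
    and nd: "\<forall>i w. affine_point i w \<in> H \<inter> U \<longrightarrow> (\<forall>c :: nat \<Rightarrow> real.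
        (\<forall>h. (\<Sum>k<(4::nat) - 3. c k * frechet_derivative (\<lambda>v. f k (affine_point i v)) (at w) h) = 0) \<longrightarrow>
        (\<forall>k<(4::nat) - 3. c k = 0))"
    using assms unfolding submanifold_near_def by blast
  show ?thesis
  proof (rule that[OF U])
    show "real_analytic_on (f 0) U"
      using an by simp
    show "q \<in> H \<longleftrightarrow> f 0 q = 0" if "q \<in> U" for q
    proof -
      have "q \<in> H \<longleftrightarrow> q \<in> H \<inter> U"
        using that by simp
      also have "\<dots> \<longleftrightarrow> f 0 q = 0"
        unfolding zero using that by (auto simp: less_Suc_eq)
      finally show ?thesis .
    qed
    show "\<exists>h. frechet_derivative (\<lambda>v. f 0 (affine_point i v)) (at w) h \<noteq> 0"
      if w: "affine_point i w \<in> H \<inter> U" for i w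
    proof (rule ccontr)
      assume "\<nexists>h. frechet_derivative (\<lambda>v. f 0 (affine_point i v)) (at w) h \<noteq> 0"
      then have "(1::real) = 0"
        by (intro nd[rule_format, OF w, of "\<lambda>_. 1" 0]) simp_all
      then show False by simp
    qed
    show "submanifold_near 3 H q" if q: "q \<in> H \<inter> U" for q
      unfolding submanifold_near_def
    proof (intro conjI exI[of _ U] exI[of _ f])
      show "q \<in> H" "q \<in> U" using q by auto
    qed (use U an zero nd in auto)
  qed
qed

text \<open>A function that vanishes on the union of lines is constant along each of them.\<close>

lemma derivative_vanishes_along_line:
  assumes g: "(g has_derivative g') (at w)" and U: "open U" "affine_point i w \<in> U"
    and zero: "\<And>q. q \<in> U \<Longrightarrow> q \<in> levi_example \<Longrightarrow> f q = (0::real)"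
    and g_def: "\<And>v. g v = f (affine_point i v)"
    and w: "incidence (lift i w) (of_real t) = 0" and h: "incidence (lift_deriv i h) (of_real t) = 0"
  shows "g' h = 0"
proof -
  define c where "c \<tau> = w + \<tau> *\<^sub>R h" for \<tau> :: real
  have c_der: "(c has_derivative (\<lambda>\<tau>. \<tau> *\<^sub>R h)) (at 0)"
    unfolding c_def by (auto intro!: derivative_eq_intros)
  have "(g has_derivative g') (at (c 0))"
    using g by (simp add: c_def)
  from has_derivative_compose[OF c_der this]
  have gc: "((\<lambda>\<tau>. g (c \<tau>)) has_derivative (\<lambda>\<tau>. g' (\<tau> *\<^sub>R h))) (at 0)" .
  define T where "T = c -` {v. affine_point i v \<in> U}"
  have "continuous_on UNIV c"
    unfolding c_def by (intro continuous_intros)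
  then have T: "open T" "0 \<in> T"
    unfolding T_def using open_vimage[OF open_affine_vimage[OF U(1)]] U(2) by (auto simp: c_def)
  have "g (c \<tau>) = 0" if "\<tau> \<in> T" for \<tau>
  proof -
    have "incidence (lift i (c \<tau>)) (of_real t) = incidence (lift i w) (of_real t) + of_real \<tau> * incidence (lift_deriv i h) (of_real t)"
    proof -
      have scaleR: "lift_deriv i (\<tau> *\<^sub>R h) = of_real \<tau> *s lift_deriv i h"
        unfolding lift_deriv_def vec_eq_iff by (simp add: scaleR_conv_of_real[symmetric])
      have "incidence (x + y) s = incidence x s + incidence y s" for x y s
        by (simp add: incidence_eq algebra_simps)
      then show ?thesis
        unfolding c_def lift_plus scaleR by (simp add: incidence_scale)
    qed
    then have "affine_point i (c \<tau>) \<in> levi_example"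
      unfolding affine_point_eq using proj_in_levi_example[OF lift_nonzero] w h by auto
    then show ?thesis
      unfolding g_def using zero that by (simp add: T_def)
  qed
  then have "((\<lambda>_. 0) has_derivative (\<lambda>\<tau>. g' (\<tau> *\<^sub>R h))) (at 0)"
    by (intro has_derivative_transform_within_open[OF gc T]) auto
  then have "(\<lambda>\<tau>. g' (\<tau> *\<^sub>R h)) = (\<lambda>_. 0)"
    by (rule has_derivative_unique) simp
  from fun_cong[OF this, of 1] show ?thesis by simp
qed

text \<open>The derivative of a local equation vanishes on two distinct complex lines, which span the tangent space
  \<open>\<complex>\<^sup>2\<close>.\<close>

lemma crossing_point_not_regular:
  assumes z: "z \<noteq> 0" and t1: "incidence z (of_real t1) = 0" and t2: "incidence z (of_real t2) = 0"
    and ne: "sin (t2 - t1) \<noteq> 0"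
  shows "\<not> submanifold_near 3 levi_example (proj z)"
proof
  assume "submanifold_near 3 levi_example (proj z)"
  then obtain U f where U: "open U" "proj z \<in> U" and an: "real_analytic_on f U"
    and zero: "\<And>q. q \<in> U \<Longrightarrow> q \<in> levi_example \<longleftrightarrow> f q = 0"
    and nd: "\<And>i w. affine_point i w \<in> levi_example \<inter> U \<Longrightarrow>
      \<exists>h. frechet_derivative (\<lambda>v. f (affine_point i v)) (at w) h \<noteq> 0"
    by (rule submanifold_near_3E) blast
  obtain i w where iw: "proj z = affine_point i w"
    by (rule affine_point_surj)
  have inc: "incidence (lift i w) (of_real t1) = 0" "incidence (lift i w) (of_real t2) = 0"
    using iw incidence_proj_cong[of z "lift i w"] z t1 t2 by (auto simp: affine_point_eq)
  define g where "g v = f (affine_point i v)" for v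
  define g' where "g' = frechet_derivative g (at w)"
  have "real_analytic_at g w"
    using an U(2) iw unfolding real_analytic_on_def g_def by simp
  then have g: "(g has_derivative g') (at w)"
    unfolding g'_def by (intro frechet_derivative_works[THEN iffD1] real_analytic_at_imp_differentiable)
  then interpret g': bounded_linear g'
    by (rule has_derivative_bounded_linear)
  have vanish: "g' h = 0" if "incidence (lift_deriv i h) (of_real t1) = 0 \<or> incidence (lift_deriv i h) (of_real t2) = 0" for h
    using derivative_vanishes_along_line[OF g U(1), of i f _ h] U(2) iw zero inc that g_def by metis
  define \<alpha>1 \<beta>1 \<alpha>2 \<beta>2 where "\<alpha>1 = dual_curve (i + 1) (of_real t1)" and "\<beta>1 = dual_curve (i + 2) (of_real t1)"
    and "\<alpha>2 = dual_curve (i + 1) (of_real t2)" and "\<beta>2 = dual_curve (i + 2) (of_real t2)"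
  have inc_h: "incidence (lift_deriv i h) (of_real t1) = h $ 1 * \<alpha>1 + h $ 2 * \<beta>1"
    "incidence (lift_deriv i h) (of_real t2) = h $ 1 * \<alpha>2 + h $ 2 * \<beta>2" for h
    unfolding incidence_index[of _ _ i] lift_deriv_components \<alpha>1_def \<beta>1_def \<alpha>2_def \<beta>2_def by simp_all
  \<comment> \<open>If this minor of the coordinate vectors of the two lines vanished, then so would all three; the one with indices 1 and 2 is \<open>sin (t2 - t1)\<close>.\<close>
  define \<Delta> where "\<Delta> = \<alpha>1 * \<beta>2 - \<alpha>2 * \<beta>1"
  have \<Delta>: "\<Delta> \<noteq> 0"
  proof
    assume \<Delta>0: "\<Delta> = 0"
    define M where "M j k = dual_curve j (of_real t1) * dual_curve k (of_real t2) - dual_curve k (of_real t1) * dual_curve j (of_real t2)" for j k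
    have A: "dual_curve i (of_real t1) = - (w $ 1 * \<alpha>1 + w $ 2 * \<beta>1)" "dual_curve i (of_real t2) = - (w $ 1 * \<alpha>2 + w $ 2 * \<beta>2)"
      using inc unfolding incidence_index[of _ _ i] lift_same lift_components \<alpha>1_def \<beta>1_def \<alpha>2_def \<beta>2_def
      by (simp_all only: eq_neg_iff_add_eq_0 add.assoc mult_1)
    have "M (i + 1) (i + 2) = \<Delta>" "M i (i + 1) = w $ 2 * \<Delta>" "M i (i + 2) = - (w $ 1 * \<Delta>)"
      unfolding M_def A \<Delta>_def \<alpha>1_def[symmetric] \<beta>1_def[symmetric] \<alpha>2_def[symmetric] \<beta>2_def[symmetric]
      by (simp_all add: algebra_simps)
    then have M0: "M (i + 1) (i + 2) = 0" "M i (i + 1) = 0" "M i (i + 2) = 0"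
      using \<Delta>0 by simp_all
    have anti: "M j k = - M k j" for j k
      by (simp add: M_def)
    have diag: "M j j = 0" for j
      by (simp add: M_def)
    have "M j k = 0" for j k
      using index_cases[of j i] index_cases[of k i] M0 diag anti by (metis neg_equal_0_iff_equal)
    then have "M 1 2 = 0" .
    moreover have "M 1 2 = of_real (sin (t2 - t1))"
      by (simp add: M_def dual_curve_def sin_diff cos_of_real sin_of_real mult.commute)
    ultimately show False
      using ne by simp
  qed
  have "g' h = 0" for h
  proof -
    \<comment> \<open>The direction \<open>h\<close> is split into directions along the two lines, by Cramer's rule.\<close>
    define x where "x = - (h $ 1 * \<alpha>2 + h $ 2 * \<beta>2) / \<Delta>"
    define y where "y = (h $ 1 * \<alpha>1 + h $ 2 * \<beta>1) / \<Delta>"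
    define e1 where "e1 = (vector [x * \<beta>1, - x * \<alpha>1] :: complex^2)"
    define e2 where "e2 = (vector [y * \<beta>2, - y * \<alpha>2] :: complex^2)"
    have "x * \<beta>1 + y * \<beta>2 = h $ 1" "- x * \<alpha>1 - y * \<alpha>2 = h $ 2"
    proof -
      have "\<Delta> * (x * \<beta>1 + y * \<beta>2) = - (h $ 1 * \<alpha>2 + h $ 2 * \<beta>2) * \<beta>1 + (h $ 1 * \<alpha>1 + h $ 2 * \<beta>1) * \<beta>2"
        using \<Delta> by (simp add: x_def y_def distrib_left)
      also have "\<dots> = \<Delta> * h $ 1"
        by (simp add: \<Delta>_def algebra_simps)
      finally show "x * \<beta>1 + y * \<beta>2 = h $ 1"
        using \<Delta> by simp
      have "\<Delta> * (- x * \<alpha>1 - y * \<alpha>2) = (h $ 1 * \<alpha>2 + h $ 2 * \<beta>2) * \<alpha>1 - (h $ 1 * \<alpha>1 + h $ 2 * \<beta>1) * \<alpha>2"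
        using \<Delta> by (simp add: x_def y_def right_diff_distrib) (simp add: algebra_simps)
      also have "\<dots> = \<Delta> * h $ 2"
        by (simp add: \<Delta>_def algebra_simps)
      finally show "- x * \<alpha>1 - y * \<alpha>2 = h $ 2"
        using \<Delta> by simp
    qed
    then have "h = e1 + e2"
      by (simp add: e1_def e2_def vec_eq_iff forall_2)
    moreover have "g' e1 = 0" "g' e2 = 0"
      by (rule vanish, simp add: inc_h e1_def e2_def algebra_simps)+
    ultimately show ?thesis
      by (simp add: g'.add)
  qed
  moreover have "proj z \<in> levi_example"
    using proj_in_levi_example[OF z] t1 by blast
  then have "\<exists>h. frechet_derivative g (at w) h \<noteq> 0"
    using nd[of i w] iw U(2) unfolding g_def by auto
  ultimately show False
    by (auto simp: g'_def)
qed

lemma deriv_incidence_eq: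
  "deriv (incidence z) s = - z $ 1 * sin s + z $ 2 * cos s + z $ 3 * cos (cos s) * sin s"
  unfolding incidence_eq[abs_def] by (rule DERIV_imp_deriv) (auto intro!: derivative_eq_intros simp: algebra_simps)

text \<open>A multiple root at \<open>t\<close> means that \<open>z\<close> is orthogonal to \<open>a t\<close> and to its
  derivative. The real points \<open>X (k s)\<close> are the intersections of the lines with parameters
  \<open>t\<close> and \<open>s\<close>; they converge to the point represented by \<open>z\<close> as
  \<open>s\<close> tends to \<open>t\<close>, and no point near a regular one is a crossing point.\<close>

lemma multiple_root_not_regular:
  assumes z: "z \<noteq> 0" and root: "incidence z (of_real t) = 0" and double: "deriv (incidence z) (of_real t) = 0"
  shows "\<not> submanifold_near 3 levi_example (proj z)"
proof
  assume "submanifold_near 3 levi_example (proj z)"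
  then obtain U where U: "open U" "proj z \<in> U" and sub: "\<And>q. q \<in> levi_example \<inter> U \<Longrightarrow> submanifold_near 3 levi_example q"
    by (rule submanifold_near_3E) blast
  define h where "h = (\<lambda>t::real. sin (cos t))"
  define h' where "h' = - cos (cos t) * sin t"
  \<comment> \<open>The real points of the line with parameter \<open>t\<close>, apart from its point at infinity; \<open>z\<close> is the one with \<open>k = h'\<close>.\<close>
  define X where "X k = (vector [of_real (h t * cos t - k * sin t), of_real (h t * sin t + k * cos t), 1] :: complex^3)" for k
  have h_eq: "sin (cos (complex_of_real t)) = of_real (h t)" for t
    by (simp add: h_def sin_cos_real)
  have e1: "z $ 1 * of_real (cos t) + z $ 2 * of_real (sin t) = z $ 3 * of_real (h t)"
    using root unfolding incidence_eq h_eq by (simp add: cos_of_real sin_of_real)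
  have e2: "- z $ 1 * of_real (sin t) + z $ 2 * of_real (cos t) = z $ 3 * of_real h'"
    using double by (simp add: deriv_incidence_eq h'_def cos_of_real sin_of_real eq_neg_iff_add_eq_0 mult.assoc)
  have cs: "of_real (cos t) * of_real (cos t) + of_real (sin t) * of_real (sin t) = (1::complex)"
    by (metis of_real_1 of_real_add of_real_mult power2_eq_square sin_cos_squared_add2)
  have z1: "z $ 1 = z $ 3 * of_real (h t * cos t - h' * sin t)"
  proof -
    have "z $ 1 = z $ 1 * (of_real (cos t) * of_real (cos t) + of_real (sin t) * of_real (sin t))"
      unfolding cs by simp
    also have "\<dots> = of_real (cos t) * (z $ 1 * of_real (cos t) + z $ 2 * of_real (sin t))
        - of_real (sin t) * (- z $ 1 * of_real (sin t) + z $ 2 * of_real (cos t))"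
      by (simp add: algebra_simps)
    finally show ?thesis
      unfolding e1 e2 by (simp add: algebra_simps)
  qed
  have z2: "z $ 2 = z $ 3 * of_real (h t * sin t + h' * cos t)"
  proof -
    have "z $ 2 = z $ 2 * (of_real (cos t) * of_real (cos t) + of_real (sin t) * of_real (sin t))"
      unfolding cs by simp
    also have "\<dots> = of_real (sin t) * (z $ 1 * of_real (cos t) + z $ 2 * of_real (sin t))
        + of_real (cos t) * (- z $ 1 * of_real (sin t) + z $ 2 * of_real (cos t))"
      by (simp add: algebra_simps)
    finally show ?thesis
      unfolding e1 e2 by (simp add: algebra_simps)
  qed
  have z_eq: "z = z $ 3 *s X h'"
    unfolding vec_eq_iff forall_3 X_def using z1 z2 by simp
  then have z3: "z $ 3 \<noteq> 0"
    using z by (metis vector_smult_lzero)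
  have X0: "X k \<noteq> 0" for k
    by (auto simp: X_def vec_eq_iff forall_3)
  have proj_X: "proj (X h') = proj z"
    using z_eq proj_scale[OF z3 X0] by metis
  \<comment> \<open>For this value the point lies on the line with parameter \<open>s\<close> too.\<close>
  define k where "k s = (h s - h t * cos (s - t)) / sin (s - t)" for s
  have k_lim: "(k \<longlongrightarrow> h') (at t)"
  proof -
    have "((\<lambda>s. h s - h t * cos (s - t)) has_real_derivative h') (at t)"
      unfolding h_def h'_def by (auto intro!: derivative_eq_intros)
    then have 1: "((\<lambda>s. (h s - h t * cos (s - t)) / (s - t)) \<longlongrightarrow> h') (at t)"
      by (simp add: has_field_derivative_iff)
    have "((\<lambda>s. sin (s - t)) has_real_derivative 1) (at t)"
      by (auto intro!: derivative_eq_intros)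
    then have 2: "((\<lambda>s. sin (s - t) / (s - t)) \<longlongrightarrow> 1) (at t)"
      by (simp add: has_field_derivative_iff)
    have "((\<lambda>s. ((h s - h t * cos (s - t)) / (s - t)) / (sin (s - t) / (s - t))) \<longlongrightarrow> h' / 1) (at t)"
      by (rule tendsto_divide[OF 1 2]) simp
    then show ?thesis
      unfolding div_by_1
    proof (rule Lim_transform_eventually)
      have "\<forall>\<^sub>F s in at t. s \<noteq> t"
        by (simp add: eventually_at_filter)
      then show "\<forall>\<^sub>F s in at t. ((h s - h t * cos (s - t)) / (s - t)) / (sin (s - t) / (s - t)) = k s"
        by eventually_elim (simp add: k_def)
    qed
  qed
  have "isCont X h'"
    unfolding isCont_def
  proof (rule vec_tendstoI)
    show "((\<lambda>k. X k $ j) \<longlongrightarrow> X h' $ j) (at h')" for j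
    proof -
      consider "j = 1" | "j = 2" | "j = 3"
        using exhaust_3[of j] by blast
      then show ?thesis
        by cases (simp_all only: X_def vector_3, (intro tendsto_intros)+)
    qed
  qed
  then have "((\<lambda>s. X (k s)) \<longlongrightarrow> X h') (at t)"
    using k_lim by (rule isCont_tendsto_compose)
  moreover have "open {y. y \<noteq> 0 \<and> proj y \<in> U}"
    using U(1) unfolding open_cp2_def .
  moreover have "X h' \<in> {y. y \<noteq> 0 \<and> proj y \<in> U}"
    using X0 U(2) proj_X by simp
  ultimately have "\<forall>\<^sub>F s in at t. X (k s) \<in> {y. y \<noteq> 0 \<and> proj y \<in> U}"
    by (rule topological_tendstoD)
  moreover have "\<forall>\<^sub>F s in at t. s \<noteq> t \<and> dist s t < pi"
    using eventually_at[of "\<lambda>s. s \<noteq> t \<and> dist s t < pi" t UNIV] pi_gt_zero by blast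
  ultimately have "\<forall>\<^sub>F s in at t. proj (X (k s)) \<in> U \<and> s \<noteq> t \<and> dist s t < pi"
    by eventually_elim auto
  then obtain s where s: "proj (X (k s)) \<in> U" "s \<noteq> t" "dist s t < pi"
    using eventually_happens' trivial_limit_at by fastforce
  have sin_ne: "sin (s - t) \<noteq> 0"
  proof (cases "s > t")
    case True
    then show ?thesis using sin_gt_zero[of "s - t"] s(3) by (simp add: dist_real_def)
  next
    case False
    then have "sin (t - s) > 0"
      using s by (intro sin_gt_zero) (auto simp: dist_real_def)
    then show ?thesis
      by (metis less_irrefl minus_diff_eq neg_equal_0_iff_equal sin_minus)
  qed
  have inc: "incidence (X (k s)) (of_real s') = of_real (h t * cos (s' - t) + k s * sin (s' - t) - h s')" for s'
    unfolding incidence_eq h_eq by (simp add: X_def cos_of_real sin_of_real cos_diff sin_diff algebra_simps)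
  have "incidence (X (k s)) (of_real t) = 0" "incidence (X (k s)) (of_real s) = 0"
    unfolding inc using sin_ne by (simp_all add: k_def)
  then have "\<not> submanifold_near 3 levi_example (proj (X (k s)))" "proj (X (k s)) \<in> levi_example"
    using crossing_point_not_regular[OF X0 _ _ sin_ne] proj_in_levi_example[OF X0] by blast+
  with sub s(1) show False by blast
qed

lemma regular_part_iff:
  assumes z: "z \<noteq> 0"
  shows "proj z \<in> regular_part levi_example \<longleftrightarrow> (\<exists>t. simple_point z t)"
proof
  assume "proj z \<in> regular_part levi_example"
  then have reg: "submanifold_near 3 levi_example (proj z)"
    by (simp add: regular_part_def)
  then have "proj z \<in> levi_example"
    by (simp add: submanifold_near_def)
  then obtain t where t: "incidence z (of_real t) = 0"
    using proj_in_levi_example[OF z] by blast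
  have "simple_point z t"
    unfolding simple_point_def
  proof (intro conjI allI impI z t)
    show "deriv (incidence z) (of_real t) \<noteq> 0"
      using multiple_root_not_regular[OF z t] reg by blast
    fix t' assume "incidence z (of_real t') = 0"
    then have "sin (t' - t) = 0"
      using crossing_point_not_regular[OF z t] reg by blast
    then obtain k :: int where "t' - t = of_int k * pi"
      using sin_zero_iff_int2 by auto
    then show "\<exists>k::int. t' = t + k * pi"
      by (intro exI[of _ k]) simp
  qed
  then show "\<exists>t. simple_point z t" ..
next
  assume "\<exists>t. simple_point z t"
  then obtain t where t: "simple_point z t" ..
  obtain \<rho> \<epsilon> where rc: "root_chart z t \<rho> \<epsilon>"
    using root_chart_exists[OF t zero_less_one] by blast
  have "proj z \<in> levi_example"
    using t proj_in_levi_example[OF z] by (auto simp: simple_point_def)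
  moreover have "z \<in> ball z \<epsilon>"
    using rc by (simp add: root_chart_def root_stable_def)
  ultimately show "proj z \<in> regular_part levi_example"
    using root_chart_submanifold[OF rc] by (simp add: regular_part_def)
qed

lemma levi_flat_levi_example: "levi_flat levi_example"
  unfolding levi_flat_def
proof
  fix p assume p: "p \<in> regular_part levi_example"
  obtain z where z: "z \<noteq> 0" "p = proj z"
    using proj_surj by blast
  then obtain t where t: "simple_point z t"
    using p regular_part_iff by blast
  show "\<exists>U \<zeta>. p \<in> U \<and> levi_chart levi_example U \<zeta>"
    by (rule adapted_levi_chart[OF t]) (use z in blast)
qed

section \<open>Plaques lie on lines\<close>

lemma holomorphic_real_valued_constant:
  assumes F: "\<And>x. x \<in> ball a r \<Longrightarrow> (F has_field_derivative D x) (at x)"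
    and real: "\<And>x. x \<in> ball a r \<Longrightarrow> Im (F x) = 0" and x: "x \<in> ball a r" "y \<in> ball a r"
  shows "F x = F y"
proof -
  have "(F has_field_derivative 0) (at x within ball a r)" if x: "x \<in> ball a r" for x
  proof -
    have "((\<lambda>x. Im (F x)) has_derivative (\<lambda>h. Im (D x * h))) (at x)"
      using F[OF x] has_derivative_Im unfolding has_field_derivative_def by blast
    then have "((\<lambda>_. 0) has_derivative (\<lambda>h. Im (D x * h))) (at x)"
      by (rule has_derivative_transform_within_open[OF _ open_ball x]) (simp add: real)
    then have "(\<lambda>h. Im (D x * h)) = (\<lambda>_. 0)"
      by (rule has_derivative_unique) simp
    from fun_cong[OF this, of 1] fun_cong[OF this, of \<i>] have "D x = 0"
      by (simp add: complex_eq_iff)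
    with F[OF x] show ?thesis
      by (simp add: has_field_derivative_at_within)
  qed
  then obtain c where "\<And>x. x \<in> ball a r \<Longrightarrow> F x = c"
    using has_field_derivative_zero_constant[OF convex_ball, of a r F] by blast
  with x show ?thesis by simp
qed

text \<open>The coordinates are merely complex-differentiable with invertible derivative at each point. Invariance of domain
  provides a continuous inverse, which is then differentiable.\<close>

lemma holomorphic_coordinates_local_inverse:
  assumes hc: "holomorphic_coordinates U \<zeta>" and B: "open B" "\<And>v. v \<in> B \<Longrightarrow> affine_point i v \<in> U"
  defines "\<phi> \<equiv> \<lambda>v. \<zeta> (affine_point i v)"
  shows "\<exists>\<psi>. open (\<phi> ` B) \<and> (\<forall>v\<in>B. \<psi> (\<phi> v) = v) \<and>
    (\<forall>y\<in>\<phi> ` B. \<exists>A :: complex^2^2. (\<psi> has_derivative (\<lambda>h. A *v h)) (at y))"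
proof -
  have \<phi>_der: "\<exists>A :: complex^2^2. invertible A \<and> (\<phi> has_derivative (\<lambda>h. A *v h)) (at v)" if "v \<in> B" for v
    using hc B(2)[OF that] unfolding holomorphic_coordinates_def \<phi>_def by blast
  then have \<phi>_isCont: "isCont \<phi> v" if "v \<in> B" for v
    using that has_derivative_continuous by blast
  then have cont: "continuous_on B \<phi>"
    by (simp add: continuous_at_imp_continuous_on)
  have inj: "inj_on \<phi> B"
  proof (rule inj_onI)
    fix v v' assume "v \<in> B" "v' \<in> B" "\<phi> v = \<phi> v'"
    then have "affine_point i v = affine_point i v'"
      using hc B(2) unfolding holomorphic_coordinates_def \<phi>_def by (meson inj_onD)
    then show "v = v'"
      by (rule affine_point_inj)
  qed
  have img: "open (\<phi> ` B)"
    by (rule invariance_of_domain[OF cont B(1) inj])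
  obtain \<psi> where "homeomorphism B (\<phi> ` B) \<phi> \<psi>"
    using invariance_of_domain_homeomorphism[OF B(1) cont _ inj] by auto
  then have \<psi>: "continuous_on (\<phi> ` B) \<psi>" "\<And>v. v \<in> B \<Longrightarrow> \<psi> (\<phi> v) = v" "\<And>y. y \<in> \<phi> ` B \<Longrightarrow> \<phi> (\<psi> y) = y"
    by (auto simp: homeomorphism_def)
  have der: "\<exists>A :: complex^2^2. (\<psi> has_derivative (\<lambda>h. A *v h)) (at y)" if y: "y \<in> \<phi> ` B" for y
  proof -
    obtain v where v: "v \<in> B" "y = \<phi> v" using y by blast
    obtain A :: "complex^2^2" where A: "invertible A" "(\<phi> has_derivative (\<lambda>h. A *v h)) (at v)"
      using \<phi>_der[OF v(1)] by blast
    obtain A' where A': "A' ** A = mat 1"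
      using A(1) invertible_left_inverse by blast
    have "(\<psi> has_derivative (\<lambda>h. A' *v h)) (at y)"
    proof (rule has_derivative_inverse_basic[where f = \<phi> and T = "\<phi> ` B"])
      show "(\<phi> has_derivative (\<lambda>h. A *v h)) (at (\<psi> y))"
        using A(2) \<psi>(2) v by simp
      show "bounded_linear (\<lambda>h. A' *v h)"
        by (rule linear_conv_bounded_linear[THEN iffD1], rule linearI)
          (simp_all add: matrix_vector_mult_def vec_eq_iff scaleR_right.sum sum.distrib distrib_left)
      show "(\<lambda>h. A' *v h) \<circ> (\<lambda>h. A *v h) = id"
        by (simp add: fun_eq_iff matrix_vector_mul_assoc A')
      show "isCont \<psi> y"
        using \<psi>(1) img y continuous_on_eq_continuous_at by blast
    qed (use img y \<psi> in auto)
    then show ?thesis by blast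
  qed
  show ?thesis
    by (intro exI[of _ \<psi>] conjI ballI img \<psi>(2) der)
qed

text \<open>For an arbitrary Levi chart, the root function restricted to a level set of the first coordinate is a
  holomorphic function of the second coordinate. It takes real values because the level set consists of points of
  the union of lines. Hence it is constant.\<close>

lemma plaque_locally_in_line:
  assumes chart: "levi_chart levi_example U \<zeta>" and a: "a \<in> U" "\<zeta> a $ 1 = complex_of_real t'"
  shows "\<exists>V t. open V \<and> a \<in> V \<and> (\<forall>x\<in>V \<inter> U. \<zeta> x $ 1 = complex_of_real t' \<longrightarrow> x \<in> leaf_line t)"
proof -
  have hc: "holomorphic_coordinates U \<zeta>" and reg: "regular_part levi_example \<inter> U = {q \<in> U. Im (\<zeta> q $ 1) = 0}"
    using chart by (auto simp: levi_chart_def)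
  have U: "open U" using hc by (simp add: holomorphic_coordinates_def)
  have reg': "q \<in> regular_part levi_example" if "q \<in> U" "\<zeta> q $ 1 = complex_of_real t'" for q
  proof -
    have "q \<in> regular_part levi_example \<inter> U"
      unfolding reg using that by simp
    then show ?thesis by blast
  qed
  have "a \<in> regular_part levi_example"
    by (rule reg'[OF a])
  moreover obtain z where z: "z \<noteq> 0" "a = proj z"
    using proj_surj by blast
  ultimately have "proj z \<in> regular_part levi_example"
    by simp
  then obtain t where sp: "simple_point z t"
    unfolding regular_part_iff[OF z(1)] by blast
  obtain \<rho> \<epsilon> where rc: "root_chart z t \<rho> \<epsilon>"
    using root_chart_exists[OF sp zero_less_one] by blast
  define \<Theta> where "\<Theta> = root_sum dual_curve (of_real t) \<rho> 1"
  have st: "root_stable dual_curve (of_real t) \<rho> z \<epsilon>"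
    using rc by (simp add: root_chart_def)
  have W0: "0 \<notin> ball z \<epsilon>"
    using root_stable_ball_nonzero(1)[OF st] by blast
  have zW: "z \<in> ball z \<epsilon>"
    using st by (simp add: root_stable_def)
  have hom: "\<Theta> (c *s y) = \<Theta> y" if "c \<noteq> 0" for c y
    using that by (simp add: \<Theta>_def root_sum_scale)
  have real_iff: "q \<in> levi_example \<longleftrightarrow> Im (\<Theta> (rep_cp2 q)) = 0" if "q \<in> proj ` ball z \<epsilon>" for q
    by (rule proj_image_iff[of \<Theta> "ball z \<epsilon>" levi_example "\<lambda>x. Im x = 0" q, OF hom W0 _ that])
      (use rc in \<open>auto simp: root_chart_def \<Theta>_def\<close>)
  obtain i w where iw: "a = affine_point i w"
    by (rule affine_point_surj)
  have \<Theta>_w: "\<Theta> (lift i w) = of_real t"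
  proof -
    have "proj z = proj (lift i w)"
      using iw z by (simp add: affine_point_eq)
    then obtain c where c: "c \<noteq> 0" "lift i w = c *s z"
      using proj_eqE[of z "lift i w"] z by (metis lift_nonzero)
    have "of_real t = \<Theta> z"
      unfolding \<Theta>_def
      by (rule root_chart_root(5)[OF rc zW]) (use sp st in \<open>auto simp: simple_point_def root_stable_def\<close>)
    then show ?thesis
      using hom c by simp
  qed
  define B where "B = {v. affine_point i v \<in> U \<inter> proj ` ball z \<epsilon>}"
  have B: "open B" "w \<in> B"
    unfolding B_def using open_affine_vimage[OF open_Int[OF U open_proj_image[OF open_ball W0]]] a iw imageI[OF zW, of proj] z by auto
  have B_U: "affine_point i v \<in> U" if "v \<in> B" for v
    using that by (simp add: B_def)
  define \<phi> where "\<phi> = (\<lambda>v. \<zeta> (affine_point i v))"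
  obtain \<psi> where img: "open (\<phi> ` B)" and \<psi>: "\<And>v. v \<in> B \<Longrightarrow> \<psi> (\<phi> v) = v"
    and \<psi>_der: "\<And>y. y \<in> \<phi> ` B \<Longrightarrow> \<exists>A :: complex^2^2. (\<psi> has_derivative (\<lambda>h. A *v h)) (at y)"
    using holomorphic_coordinates_local_inverse[OF hc B(1) B_U] unfolding \<phi>_def by blast
  obtain r where r: "r > 0" "ball (\<phi> w) r \<subseteq> \<phi> ` B"
    using img B(2) open_contains_ball by blast
  define \<tau>0 where "\<tau>0 = \<phi> w $ 2"
  define line where "line \<tau> = (vector [of_real t', \<tau>] :: complex^2)" for \<tau>
  have \<phi>w: "\<phi> w = line \<tau>0"
    using a iw by (simp add: line_def \<tau>0_def vec_eq_iff forall_2 \<phi>_def)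
  have line_ball: "line \<tau> \<in> ball (\<phi> w) r \<longleftrightarrow> \<tau> \<in> ball \<tau>0 r" for \<tau>
  proof -
    have "dist (line \<tau>0) (line \<tau>) = dist \<tau>0 \<tau>"
      unfolding dist_vec_def L2_set_def line_def by (simp add: sum_2)
    then show ?thesis by (simp add: \<phi>w)
  qed
  define F where "F \<tau> = \<Theta> (lift i (\<psi> (line \<tau>)))" for \<tau>
  have F: "\<exists>D. (F has_field_derivative D) (at \<tau>)" "Im (F \<tau>) = 0" if \<tau>: "\<tau> \<in> ball \<tau>0 r" for \<tau>
  proof -
    have y: "line \<tau> \<in> \<phi> ` B"
      using r(2) line_ball \<tau> by blast
    then obtain v where v: "v \<in> B" "line \<tau> = \<phi> v" by blast
    then have \<psi>v: "\<psi> (line \<tau>) = v"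
      using \<psi> by simp
    have v': "affine_point i v \<in> U" "affine_point i v \<in> proj ` ball z \<epsilon>"
      using v(1) by (auto simp: B_def)
    have "\<zeta> (affine_point i v) $ 1 = of_real t'"
      using v(2) unfolding \<phi>_def line_def vec_eq_iff forall_2 by simp
    then have "affine_point i v \<in> regular_part levi_example"
      by (rule reg'[OF v'(1)])
    then have "affine_point i v \<in> levi_example"
      by (simp add: regular_part_def submanifold_near_def)
    then have "Im (\<Theta> (rep_cp2 (affine_point i v))) = 0"
      using real_iff v'(2) by blast
    then show "Im (F \<tau>) = 0"
      using rep_affine[of \<Theta>, OF hom] by (simp add: F_def \<psi>v)
    obtain A :: "complex^2^2" where A: "(\<psi> has_derivative (\<lambda>h. A *v h)) (at (line \<tau>))"
      using \<psi>_der[OF y] by blast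
    have "(line has_derivative (\<lambda>h. vector [0, h])) (at \<tau>)"
      unfolding line_def by (rule has_derivative_vector_2) auto
    from has_derivative_compose[OF this A]
    have "((\<lambda>\<tau>. \<psi> (line \<tau>)) has_derivative (\<lambda>h. A *v vector [0, h])) (at \<tau>)" .
    moreover define d where "d = deriv (incidence (lift i v)) (\<Theta> (lift i v))"
    note root_chart_affine_derivative(1)[OF rc v'(2), folded \<Theta>_def, folded d_def]
    ultimately have F_der: "(F has_derivative (\<lambda>h. - incidence (lift_deriv i (A *v vector [0, h])) (\<Theta> (lift i v)) / d)) (at \<tau>)"
      unfolding F_def using has_derivative_compose[of "\<lambda>\<tau>. \<psi> (line \<tau>)" "\<lambda>h. A *v vector [0, h]" \<tau> UNIV "\<lambda>v. \<Theta> (lift i v)"] \<psi>v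
      by simp
    have "- incidence (lift_deriv i (A *v vector [0, h])) (\<Theta> (lift i v)) / d
        = - incidence (lift_deriv i (A *v vector [0, 1])) (\<Theta> (lift i v)) / d * h" for h
    proof -
      have "vector [0, h] = h *s (vector [0, 1] :: complex^2)"
        by (simp add: vec_eq_iff forall_2)
      then have "A *v vector [0, h] = h *s (A *v vector [0, 1])"
        by (simp add: matrix_vector_mult_def vec_eq_iff sum_2)
      then show ?thesis
        by (simp add: lift_deriv_scale incidence_scale)
    qed
    then have "(F has_derivative (*) (- incidence (lift_deriv i (A *v vector [0, 1])) (\<Theta> (lift i v)) / d)) (at \<tau>)"
      by (intro has_derivative_eq_rhs[OF F_der] ext)
    then show "\<exists>D. (F has_field_derivative D) (at \<tau>)"
      unfolding has_field_derivative_def by (rule exI)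
  qed
  then have "\<forall>\<tau>\<in>ball \<tau>0 r. \<exists>D. (F has_field_derivative D) (at \<tau>)"
    by blast
  from this[THEN bchoice] obtain D where D: "\<And>\<tau>. \<tau> \<in> ball \<tau>0 r \<Longrightarrow> (F has_field_derivative D \<tau>) (at \<tau>)"
    by blast
  have F_const: "F \<tau> = of_real t" if "\<tau> \<in> ball \<tau>0 r" for \<tau>
  proof -
    have "F \<tau> = F \<tau>0"
      by (rule holomorphic_real_valued_constant[OF D F(2) that]) (use r in auto)
    also have "F \<tau>0 = of_real t"
      using \<psi>[OF B(2)] \<phi>w \<Theta>_w by (simp add: F_def)
    finally show ?thesis .
  qed
  define V where "V = affine_point i ` (B \<inter> \<phi> -` ball (\<phi> w) r)"
  have "continuous_on B \<phi>"
  proof -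
    have "isCont \<phi> v" if "v \<in> B" for v
    proof -
      have "affine_point i v \<in> U" using that by (simp add: B_def)
      then obtain A :: "complex^2^2" where "(\<phi> has_derivative (\<lambda>h. A *v h)) (at v)"
        using hc unfolding holomorphic_coordinates_def \<phi>_def by blast
      then show ?thesis by (rule has_derivative_continuous)
    qed
    then show ?thesis by (simp add: continuous_at_imp_continuous_on)
  qed
  then have "open (B \<inter> \<phi> -` ball (\<phi> w) r)"
    using B(1) by (simp add: continuous_on_open_vimage Int_commute)
  then have "open V"
    unfolding V_def by (rule open_affine_image)
  moreover have "a \<in> V"
    unfolding V_def iw using B(2) r(1) by auto
  moreover have "x \<in> leaf_line t" if x: "x \<in> V" "\<zeta> x $ 1 = complex_of_real t'" for x
  proof -
    obtain v where v: "v \<in> B" "\<phi> v \<in> ball (\<phi> w) r" "x = affine_point i v"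
      using x(1) unfolding V_def by blast
    have \<phi>v: "\<phi> v = line (\<phi> v $ 2)"
      using x(2) v(3) by (simp add: line_def vec_eq_iff forall_2 \<phi>_def)
    then have "\<phi> v $ 2 \<in> ball \<tau>0 r"
      using v(2) line_ball by metis
    then have "F (\<phi> v $ 2) = of_real t"
      by (rule F_const)
    then have "\<Theta> (lift i v) = of_real t"
      unfolding F_def \<phi>v[symmetric] using \<psi>[OF v(1)] by simp
    moreover have "affine_point i v \<in> proj ` ball z \<epsilon>"
      using v(1) by (simp add: B_def)
    then have "incidence (lift i v) (\<Theta> (lift i v)) = 0"
      unfolding \<Theta>_def by (rule root_chart_affine_derivative(2)[OF rc])
    ultimately show ?thesis
      unfolding v(3) affine_point_eq using proj_in_leaf_line by simp
  qed
  ultimately show ?thesis by blast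
qed

lemma regular_leaf_line_cong:
  assumes "x \<in> regular_part levi_example" "x \<in> leaf_line t" "x \<in> leaf_line t'"
  shows "leaf_line t = leaf_line t'"
proof -
  obtain z where z: "z \<noteq> 0" "x = proj z"
    using proj_surj by blast
  then obtain u where u: "simple_point z u"
    using assms(1) regular_part_iff[OF z(1)] by auto
  have "leaf_line s = leaf_line u" if "x \<in> leaf_line s" for s
  proof -
    have "incidence z (of_real s) = 0"
      using that z proj_in_leaf_line[OF z(1), of s] by simp
    then obtain k :: int where "s = u + k * pi"
      using u unfolding simple_point_def by auto
    then show ?thesis
      using incidence_plus_int_pi[of _ "of_real u" k] unfolding leaf_line_def by simp
  qed
  from this[OF assms(2)] this[OF assms(3)] show ?thesis by simp
qed

text \<open>Membership in \<open>L\<^sub>t\<close> is locally constant on a plaque, and plaques are connected.\<close>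

lemma same_plaque_in_leaf_line:
  assumes "same_plaque levi_example p q"
  shows "p \<in> regular_part levi_example" "q \<in> regular_part levi_example" "p \<in> leaf_line t \<longleftrightarrow> q \<in> leaf_line t"
proof -
  obtain U \<zeta> t' where chart: "levi_chart levi_example U \<zeta>"
    and cc: "connected_component {x \<in> U. \<zeta> x $ 1 = complex_of_real t'} p q"
    using assms unfolding same_plaque_def by blast
  obtain C where C: "connected C" "C \<subseteq> {x \<in> U. \<zeta> x $ 1 = complex_of_real t'}" "p \<in> C" "q \<in> C"
    using cc unfolding connected_component_def by blast
  have C_reg: "x \<in> regular_part levi_example" if "x \<in> C" for x
  proof -
    have "regular_part levi_example \<inter> U = {q \<in> U. Im (\<zeta> q $ 1) = 0}"
      using chart by (simp add: levi_chart_def)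
    moreover have "x \<in> {q \<in> U. Im (\<zeta> q $ 1) = 0}"
      using C(2) that by auto
    ultimately show ?thesis by blast
  qed
  then show "p \<in> regular_part levi_example" "q \<in> regular_part levi_example"
    using C by auto
  have step: "\<exists>T. openin (top_of_set C) T \<and> a \<in> T \<and> (\<forall>x\<in>T. \<forall>y\<in>T. x \<in> leaf_line t \<longrightarrow> y \<in> leaf_line t)" if "a \<in> C" for a
  proof -
    have "a \<in> U" "\<zeta> a $ 1 = complex_of_real t'"
      using that C(2) by auto
    from plaque_locally_in_line[OF chart this]
    obtain V u where V: "open V" "a \<in> V"
      and V_line: "\<forall>x\<in>V \<inter> U. \<zeta> x $ 1 = complex_of_real t' \<longrightarrow> x \<in> leaf_line u"
      by (elim exE conjE)
    have in_u: "x \<in> leaf_line u" if "x \<in> C \<inter> V" for x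
      using that C(2) V_line by auto
    have const: "y \<in> leaf_line t" if xy: "x \<in> C \<inter> V" "y \<in> C \<inter> V" "x \<in> leaf_line t" for x y
    proof -
      have "leaf_line t = leaf_line u"
        by (rule regular_leaf_line_cong[OF C_reg xy(3) in_u[OF xy(1)]]) (use xy in blast)
      then show ?thesis
        using in_u[OF xy(2)] by simp
    qed
    show ?thesis
    proof (intro exI[of _ "C \<inter> V"] conjI ballI impI)
      show "openin (top_of_set C) (C \<inter> V)"
        using V(1) by (simp add: openin_open_Int)
      show "a \<in> C \<inter> V"
        using V(2) that by blast
    qed (rule const)
  qed
  have imp: "y \<in> leaf_line t" if "x \<in> C" "y \<in> C" "x \<in> leaf_line t" for x y
    by (rule connected_induction_simple[OF C(1), where P = "\<lambda>x. x \<in> leaf_line t" and a = x and b = y])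
      (use that step in auto)
  show "p \<in> leaf_line t \<longleftrightarrow> q \<in> leaf_line t"
    using imp C by blast
qed

text \<open>A linear parametrization of \<open>L\<^sub>t\<close>; \<open>\<nu> = 0\<close> is its real point at infinity,
  and the other real points are those with real \<open>\<mu> / \<nu>\<close>.\<close>

definition leaf_vec :: "real \<Rightarrow> complex \<Rightarrow> complex \<Rightarrow> complex^3" where
  "leaf_vec t \<mu> \<nu> = vector [\<nu> * sin (cos (of_real t)) * cos (of_real t) - \<mu> * sin (of_real t),
     \<nu> * sin (cos (of_real t)) * sin (of_real t) + \<mu> * cos (of_real t), \<nu>]"

lemma cos_sin_sq: "cos (s::complex) * cos s + sin s * sin s = 1"
  using sin_cos_squared_add[of s] by (simp add: power2_eq_square add.commute)

lemma leaf_vec_eq_0_iff: "leaf_vec t \<mu> \<nu> = 0 \<longleftrightarrow> \<mu> = 0 \<and> \<nu> = 0"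
proof
  assume *: "leaf_vec t \<mu> \<nu> = 0"
  then have "\<nu> = 0" "\<mu> * sin (complex_of_real t) = 0" "\<mu> * cos (complex_of_real t) = 0"
    unfolding leaf_vec_def vec_eq_iff forall_3 by auto
  moreover have "\<mu> = \<mu> * (cos (complex_of_real t) * cos (complex_of_real t) + sin (complex_of_real t) * sin (complex_of_real t))"
    by (simp only: cos_sin_sq mult_1_right)
  then have "\<mu> = cos (complex_of_real t) * (\<mu> * cos (complex_of_real t)) + sin (complex_of_real t) * (\<mu> * sin (complex_of_real t))"
    by (simp only: algebra_simps)
  ultimately show "\<mu> = 0 \<and> \<nu> = 0" by (simp only: mult_zero_right add_0_right)
qed (simp add: leaf_vec_def vec_eq_iff forall_3)

lemma leaf_vec_scale: "leaf_vec t (c * \<mu>) (c * \<nu>) = c *s leaf_vec t \<mu> \<nu>"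
  by (simp add: leaf_vec_def vec_eq_iff forall_3 algebra_simps)

lemma incidence_leaf_vec:
  "incidence (leaf_vec t \<mu> \<nu>) (of_real t') =
     \<mu> * of_real (sin (t' - t)) + \<nu> * of_real (sin (cos t) * cos (t' - t) - sin (cos t'))"
  by (simp add: incidence_eq leaf_vec_def sin_cos_real cos_of_real sin_of_real cos_diff sin_diff algebra_simps)

lemma deriv_incidence_leaf_vec:
  "deriv (incidence (leaf_vec t \<mu> \<nu>)) (of_real t) = \<mu> + \<nu> * of_real (cos (cos t) * sin t)"
proof -
  define c s where "c = cos (complex_of_real t)" and "s = sin (complex_of_real t)"
  have "\<mu> * (c * c) + \<mu> * (s * s) = \<mu>"
    unfolding c_def s_def distrib_left[symmetric] cos_sin_sq by simp
  then have "deriv (incidence (leaf_vec t \<mu> \<nu>)) (of_real t) = \<mu> + \<nu> * (cos c * s)"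
    unfolding deriv_incidence_eq leaf_vec_def c_def[symmetric] s_def[symmetric] by (simp add: algebra_simps)
  then show ?thesis
    by (simp add: c_def s_def cos_of_real sin_of_real)
qed

lemma leaf_vec_surj:
  assumes "incidence z (of_real t) = 0"
  shows "z = leaf_vec t (z $ 2 * cos (of_real t) - z $ 1 * sin (of_real t)) (z $ 3)"
proof -
  define c s where "c = cos (complex_of_real t)" and "s = sin (complex_of_real t)"
  have cs: "c * c + s * s = 1"
    unfolding c_def s_def by (rule cos_sin_sq)
  have e: "z $ 1 * c + z $ 2 * s = z $ 3 * sin c"
    using assms by (simp add: incidence_eq c_def s_def)
  have "z $ 1 = (z $ 1 * c + z $ 2 * s) * c - (z $ 2 * c - z $ 1 * s) * s"
  proof -
    have "(z $ 1 * c + z $ 2 * s) * c - (z $ 2 * c - z $ 1 * s) * s = z $ 1 * (c * c + s * s)"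
      by (simp add: algebra_simps)
    then show ?thesis by (simp add: cs)
  qed
  moreover have "z $ 2 = (z $ 1 * c + z $ 2 * s) * s + (z $ 2 * c - z $ 1 * s) * c"
  proof -
    have "(z $ 1 * c + z $ 2 * s) * s + (z $ 2 * c - z $ 1 * s) * c = z $ 2 * (c * c + s * s)"
      by (simp add: algebra_simps)
    then show ?thesis by (simp add: cs)
  qed
  ultimately show ?thesis
    unfolding e leaf_vec_def c_def[symmetric] s_def[symmetric] vec_eq_iff forall_3 by simp
qed

text \<open>The root equation has the form \<open>\<mu> x + \<nu> y = 0\<close> with real \<open>x\<close> and
  \<open>y\<close>, and likewise for the derivative. When \<open>\<mu> / \<nu>\<close> is not real, both
  \<open>x\<close> and \<open>y\<close> vanish; when \<open>\<nu> = 0\<close>, \<open>x\<close> does. In both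
  cases \<open>x = sin (t' - t)\<close> determines \<open>t'\<close> modulo \<open>\<pi>\<close>.\<close>

lemma simple_point_leaf_vec:
  assumes "\<mu> \<noteq> 0" "\<nu> = 0 \<or> Im (\<mu> / \<nu>) \<noteq> 0"
  shows "simple_point (leaf_vec t \<mu> \<nu>) t"
proof -
  have real_dependent: "x = 0" if eq: "\<mu> * of_real x + \<nu> * of_real y = 0" for x y
  proof (cases "\<nu> = 0")
    case True
    then show ?thesis using eq assms(1) by simp
  next
    case False
    define q where "q = \<mu> / \<nu>"
    have "q * of_real x + of_real y = 0"
      using False eq by (simp add: q_def field_simps)
    from arg_cong[OF this, of Im] show ?thesis
      using assms(2) False by (simp add: q_def[symmetric])
  qed
  show ?thesis
    unfolding simple_point_def
  proof (intro conjI allI impI)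
    show "leaf_vec t \<mu> \<nu> \<noteq> 0"
      using assms(1) by (simp add: leaf_vec_eq_0_iff)
    show "incidence (leaf_vec t \<mu> \<nu>) (of_real t) = 0"
      by (simp add: incidence_leaf_vec)
    show "deriv (incidence (leaf_vec t \<mu> \<nu>)) (of_real t) \<noteq> 0"
      using real_dependent[of 1 "cos (cos t) * sin t"] unfolding deriv_incidence_leaf_vec by auto
    fix t' assume "incidence (leaf_vec t \<mu> \<nu>) (of_real t') = 0"
    then have "sin (t' - t) = 0"
      unfolding incidence_leaf_vec by (rule real_dependent)
    then obtain k :: int where "t' - t = of_int k * pi"
      using sin_zero_iff_int2 by auto
    then show "\<exists>k::int. t' = t + k * pi"
      by (intro exI[of _ k]) simp
  qed
qed

section \<open>Leaves and dimension\<close>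

lemma closed_leaf_line: "closed (leaf_line t)"
proof -
  have "{z. z \<noteq> 0 \<and> proj z \<in> - leaf_line t} = {z. z \<noteq> 0} \<inter> {z. incidence z (of_real t) \<noteq> 0}"
    using proj_in_leaf_line by auto
  moreover have "open \<dots>"
    unfolding incidence_eq by (intro open_Int open_Collect_neq continuous_intros)
  ultimately show ?thesis
    unfolding closed_def open_cp2_def by simp
qed

lemma complex_hyperplane_leaf_line: "complex_hyperplane (leaf_line t)"
  unfolding complex_hyperplane_def
proof (intro exI conjI)
  let ?a = "\<chi> j. dual_curve j (of_real t)"
  show "?a \<noteq> 0"
    using dual_curve_nonzero[of "of_real t"] by (auto simp: vec_eq_iff)
  show "leaf_line t = {proj z | z. z \<noteq> 0 \<and> (\<Sum>j\<in>UNIV. ?a $ j * z $ j) = 0}"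
    by (simp add: leaf_line_def incidence_def pencil_def mult.commute)
qed

definition leaf :: "real \<Rightarrow> cp2 set" where
  "leaf t = leaf_line t \<inter> regular_part levi_example"

lemma leaf_vec_in_leaf_line: "\<mu> \<noteq> 0 \<or> \<nu> \<noteq> 0 \<Longrightarrow> proj (leaf_vec t \<mu> \<nu>) \<in> leaf_line t"
  by (subst proj_in_leaf_line) (auto simp: leaf_vec_eq_0_iff incidence_leaf_vec)

lemma leaf_vec_in_leaf:
  assumes "\<mu> \<noteq> 0" "\<nu> = 0 \<or> Im (\<mu> / \<nu>) \<noteq> 0"
  shows "proj (leaf_vec t \<mu> \<nu>) \<in> leaf t"
  unfolding leaf_def using assms leaf_vec_in_leaf_line[of \<mu> \<nu> t] simple_point_leaf_vec[OF assms, of t]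
    regular_part_iff[of "leaf_vec t \<mu> \<nu>"] leaf_vec_eq_0_iff[of t \<mu> \<nu>] by blast

lemma Im_inverse_nonzero: "Im c \<noteq> 0 \<Longrightarrow> Im (1 / c) \<noteq> 0"
  by (auto simp: Im_divide complex_eq_iff sum_power2_eq_zero_iff)

lemma continuous_on_leaf_vec:
  assumes "continuous_on S f" "continuous_on S g"
  shows "continuous_on S (\<lambda>c. leaf_vec t (f c) (g c))"
proof -
  have eq: "leaf_vec t (f c) (g c) = (\<chi> j. if j = 1 then g c * sin (cos (of_real t)) * cos (of_real t) - f c * sin (of_real t)
     else if j = 2 then g c * sin (cos (of_real t)) * sin (of_real t) + f c * cos (of_real t) else g c)" for c
    by (simp add: leaf_vec_def vec_eq_iff forall_3)
  show ?thesis
    unfolding eq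
  proof (rule continuous_on_vec_lambda)
    fix j :: 3
    consider "j = 1" | "j = 2" | "j = 3"
      using exhaust_3[of j] by blast
    then show "continuous_on S (\<lambda>c. if j = 1 then g c * sin (cos (of_real t)) * cos (of_real t) - f c * sin (of_real t)
     else if j = 2 then g c * sin (cos (of_real t)) * sin (of_real t) + f c * cos (of_real t) else g c)"
      by cases (auto intro!: continuous_intros assms)
  qed
qed

lemma continuous_on_proj_leaf_vec:
  assumes "continuous_on S f" "continuous_on S g" "\<And>c. c \<in> S \<Longrightarrow> f c \<noteq> 0 \<or> g c \<noteq> 0"
  shows "continuous_on S (\<lambda>c. proj (leaf_vec t (f c) (g c)))"
  by (rule continuous_on_compose2[OF continuous_on_proj continuous_on_leaf_vec[OF assms(1,2)]])
    (use assms(3) in \<open>auto simp: leaf_vec_eq_0_iff\<close>)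

lemma convex_half_plane_point:
  assumes "0 \<le> \<sigma> * Im x\<^sub>0"
  shows "convex {c. 0 < \<sigma> * Im c \<or> c = x\<^sub>0}"
  unfolding convex_alt
proof (intro ballI allI impI)
  fix x y :: complex and u :: real
  assume x: "x \<in> {c. 0 < \<sigma> * Im c \<or> c = x\<^sub>0}" and y: "y \<in> {c. 0 < \<sigma> * Im c \<or> c = x\<^sub>0}" and u: "0 \<le> u \<and> u \<le> 1"
  have eq: "\<sigma> * Im ((1 - u) *\<^sub>R x + u *\<^sub>R y) = (1 - u) * (\<sigma> * Im x) + u * (\<sigma> * Im y)"
    by (simp add: algebra_simps)
  consider "u = 0" | "u = 1" | "0 < u" "u < 1"
    using u by linarith
  then show "(1 - u) *\<^sub>R x + u *\<^sub>R y \<in> {c. 0 < \<sigma> * Im c \<or> c = x\<^sub>0}"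
  proof cases
    case 3
    show ?thesis
    proof (cases "x = x\<^sub>0 \<and> y = x\<^sub>0")
      case True
      then have "(1 - u) *\<^sub>R x + u *\<^sub>R y = x\<^sub>0"
        by (simp flip: scaleR_add_left)
      then show ?thesis by simp
    next
      case False
      have "0 \<le> \<sigma> * Im x" "0 \<le> \<sigma> * Im y" "0 < \<sigma> * Im x \<or> 0 < \<sigma> * Im y"
        using x y assms False by auto
      then have "0 < (1 - u) * (\<sigma> * Im x) + u * (\<sigma> * Im y)"
        using 3 by (auto intro: add_pos_nonneg add_nonneg_pos)
      then show ?thesis
        unfolding mem_Collect_eq eq by blast
    qed
  qed (use x y in auto)
qed

text \<open>An open half plane together with one boundary point is convex. This moves any regular point of
  \<open>L\<^sub>t\<close> into an adjacent open half without leaving the regular part.\<close>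

lemma leaf_half_connected:
  assumes \<sigma>: "\<sigma> \<noteq> 0" "0 \<le> \<sigma> * Im x\<^sub>0" and x\<^sub>0: "proj (leaf_vec t 1 x\<^sub>0) \<in> leaf t" and c: "0 < \<sigma> * Im c"
  shows "connected_component (leaf t) (proj (leaf_vec t 1 x\<^sub>0)) (proj (leaf_vec t 1 c))"
proof -
  let ?T = "{c. 0 < \<sigma> * Im c \<or> c = x\<^sub>0}" and ?P = "\<lambda>c. proj (leaf_vec t 1 c)"
  have "connected (?P ` ?T)"
    by (intro connected_continuous_image continuous_on_proj_leaf_vec convex_connected convex_half_plane_point \<sigma>)
      (auto intro: continuous_intros)
  moreover have "?P c \<in> leaf t" if "c \<in> ?T" for c
  proof (cases "c = x\<^sub>0")
    case False
    then have "Im c \<noteq> 0"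
      using that by auto
    then show ?thesis
      using Im_inverse_nonzero[of c] by (intro leaf_vec_in_leaf) auto
  qed (use x\<^sub>0 in simp)
  ultimately show ?thesis
    unfolding connected_component_def using c by (intro exI[of _ "?P ` ?T"]) auto
qed

lemma proj_leaf_vec_normalize:
  "\<mu> \<noteq> 0 \<Longrightarrow> proj (leaf_vec t \<mu> \<nu>) = proj (leaf_vec t 1 (\<nu> / \<mu>))"
  using leaf_vec_scale[of t \<mu> 1 "\<nu> / \<mu>"] proj_scale[of \<mu> "leaf_vec t 1 (\<nu> / \<mu>)"] by (simp add: leaf_vec_eq_0_iff)

lemma proj_leaf_vec_normalize':
  "\<nu> \<noteq> 0 \<Longrightarrow> proj (leaf_vec t \<mu> \<nu>) = proj (leaf_vec t (\<mu> / \<nu>) 1)"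
  using leaf_vec_scale[of t \<nu> "\<mu> / \<nu>" 1] proj_scale[of \<nu> "leaf_vec t (\<mu> / \<nu>) 1"] by (simp add: leaf_vec_eq_0_iff)

lemma leaf_line_cases:
  assumes "p \<in> leaf_line t"
  obtains c where "p = proj (leaf_vec t 1 c)" | "p = proj (leaf_vec t 0 1)"
proof -
  obtain z where z: "z \<noteq> 0" "p = proj z" "incidence z (of_real t) = 0"
    using assms unfolding leaf_line_def by blast
  obtain \<mu> \<nu> where z_eq: "z = leaf_vec t \<mu> \<nu>"
    using leaf_vec_surj[OF z(3)] by blast
  show ?thesis
  proof (cases "\<mu> = 0")
    case False
    then show ?thesis
      using proj_leaf_vec_normalize[of \<mu> t \<nu>] z z_eq that(1) by simp
  next
    case True
    then have "\<nu> \<noteq> 0"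
      using z z_eq leaf_vec_eq_0_iff[of t \<mu> \<nu>] by simp
    then show ?thesis
      using proj_leaf_vec_normalize'[of \<nu> t \<mu>] True z z_eq that(2) by simp
  qed
qed

text \<open>Both halves are adjacent to the regular real point at infinity, the parameter value \<open>0\<close>.\<close>

lemma connected_leaf: "connected (leaf t)"
proof -
  let ?P = "\<lambda>c. proj (leaf_vec t 1 c)"
  have P0: "?P 0 \<in> leaf t"
    by (intro leaf_vec_in_leaf) auto
  have "connected_component (leaf t) p (?P 0)" if p: "p \<in> leaf t" for p
  proof -
    have "p \<in> leaf_line t" using p by (simp add: leaf_def)
    then show ?thesis
    proof (cases rule: leaf_line_cases)
      case (1 c)
      define \<sigma> :: real where "\<sigma> = (if Im c \<ge> 0 then 1 else -1)"
      have "connected_component (leaf t) (?P c) (?P (of_real \<sigma> * \<i>))"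
        by (rule leaf_half_connected[of \<sigma>]) (use 1 p in \<open>auto simp: \<sigma>_def\<close>)
      moreover have "connected_component (leaf t) (?P 0) (?P (of_real \<sigma> * \<i>))"
        by (rule leaf_half_connected[of \<sigma>]) (use P0 in \<open>auto simp: \<sigma>_def\<close>)
      ultimately show ?thesis
        unfolding 1 using connected_component_sym connected_component_trans by metis
    next
      case 2
      let ?T = "{c. 0 < 1 * Im c \<or> c = 0}" and ?Q = "\<lambda>c. proj (leaf_vec t c 1)"
      have "connected (?Q ` ?T)"
        by (intro connected_continuous_image continuous_on_proj_leaf_vec convex_connected convex_half_plane_point)
          (auto intro: continuous_intros)
      moreover have "?Q c \<in> leaf t" if "c \<in> ?T" for c
      proof (cases "c = 0")
        case False
        then have "Im c \<noteq> 0"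
          using that by auto
        then show ?thesis
          by (intro leaf_vec_in_leaf) auto
      qed (use p 2 in simp)
      ultimately have "connected_component (leaf t) (?Q 0) (?Q \<i>)"
        unfolding connected_component_def by (intro exI[of _ "?Q ` ?T"]) auto
      \<comment> \<open>The parameters of the two affine coordinates of the line are inverse to each other.\<close>
      moreover have "?Q \<i> = ?P (- \<i>)"
        using proj_leaf_vec_normalize[of \<i> t 1] by simp
      moreover have "connected_component (leaf t) (?P 0) (?P (- \<i>))"
        by (rule leaf_half_connected[of "-1"]) (use P0 in auto)
      ultimately show ?thesis
        unfolding 2 using connected_component_sym connected_component_trans by metis
    qed
  qed
  then show ?thesis
    unfolding connected_iff_connected_component
    using connected_component_sym connected_component_trans by metis
qed

text \<open>The points with nonreal parameter are regular and dense in the line.\<close>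

lemma closure_leaf: "closure (leaf t) = leaf_line t"
proof (rule antisym)
  show "closure (leaf t) \<subseteq> leaf_line t"
    by (rule closure_minimal) (auto simp: leaf_def closed_leaf_line)
  have dense: "closure {c. Im c \<noteq> 0} = UNIV"
  proof -
    have "c \<in> closure {c. Im c \<noteq> 0}" for c
      unfolding closure_approachable
    proof (intro allI impI)
      fix e :: real assume e: "e > 0"
      show "\<exists>y\<in>{c. Im c \<noteq> 0}. dist y c < e"
      proof (cases "Im c = 0")
        case True
        then show ?thesis
          using e by (intro bexI[of _ "c + of_real (e / 2) * \<i>"]) (auto simp: dist_norm norm_mult)
      next
        case False
        then show ?thesis
          using e by (intro bexI[of _ c]) auto
      qed
    qed
    then show ?thesis by blast
  qed
  have limit: "f c \<in> closure (leaf t)"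
    if f: "continuous_on UNIV f" "\<And>c. Im c \<noteq> 0 \<Longrightarrow> f c \<in> leaf t" for f :: "complex \<Rightarrow> cp2" and c
  proof -
    have "f ` closure {c. Im c \<noteq> 0} \<subseteq> closure (leaf t)"
      by (rule image_closure_subset) (use f closure_subset dense in auto)
    then show ?thesis
      unfolding dense by blast
  qed
  show "leaf_line t \<subseteq> closure (leaf t)"
  proof
    fix p assume "p \<in> leaf_line t"
    then show "p \<in> closure (leaf t)"
    proof (cases rule: leaf_line_cases)
      case (1 c)
      show ?thesis
        unfolding 1
      proof (rule limit[of "\<lambda>c. proj (leaf_vec t 1 c)" c])
        show "continuous_on UNIV (\<lambda>c. proj (leaf_vec t 1 c))"
          by (rule continuous_on_proj_leaf_vec) (auto intro: continuous_intros)
        show "proj (leaf_vec t 1 c) \<in> leaf t" if "Im c \<noteq> 0" for c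
          using Im_inverse_nonzero[OF that] by (intro leaf_vec_in_leaf) auto
      qed
    next
      case 2
      show ?thesis
        unfolding 2
      proof (rule limit[of "\<lambda>c. proj (leaf_vec t c 1)" 0])
        show "continuous_on UNIV (\<lambda>c. proj (leaf_vec t c 1))"
          by (rule continuous_on_proj_leaf_vec) (auto intro: continuous_intros)
        show "proj (leaf_vec t c 1) \<in> leaf t" if "Im c \<noteq> 0" for c
          using that by (intro leaf_vec_in_leaf) auto
      qed
    qed
  qed
qed

lemma regular_in_leaf:
  assumes "p \<in> regular_part levi_example"
  obtains z t where "z \<noteq> 0" "p = proj z" "simple_point z t" "p \<in> leaf t"
proof -
  obtain z where z: "z \<noteq> 0" "p = proj z"
    using proj_surj by blast
  then obtain t where t: "simple_point z t"
    using assms regular_part_iff[OF z(1)] by auto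
  then have "p \<in> leaf t"
    using assms z proj_in_leaf_line[OF z(1), of t] by (simp add: leaf_def simple_point_def)
  with z t show ?thesis by (rule that)
qed

text \<open>Chains of plaques stay on the line; conversely the adapted charts make reachability an equivalence relation with
  open classes on a connected set.\<close>

lemma levi_leaf_eq_leaf:
  assumes p: "p \<in> leaf t"
  shows "{q. (same_plaque levi_example)\<^sup>*\<^sup>* p q} = leaf t"
proof (intro equalityI subsetI)
  fix q assume "q \<in> {q. (same_plaque levi_example)\<^sup>*\<^sup>* p q}"
  then have "(same_plaque levi_example)\<^sup>*\<^sup>* p q" by simp
  then show "q \<in> leaf t"
  proof (induction rule: rtranclp_induct)
    case (step y q)
    then show ?case
      using same_plaque_in_leaf_line[OF step(2)] by (simp add: leaf_def)
  qed (rule p)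
next
  fix q assume q: "q \<in> leaf t"
  let ?R = "(same_plaque levi_example)\<^sup>*\<^sup>*"
  have sym: "symp (same_plaque levi_example)"
    unfolding symp_def same_plaque_def using connected_component_sym by metis
  have "?R p q"
  proof (rule connected_equivalence_relation[OF connected_leaf p q])
    show "?R y x" if "?R x y" for x y
      using sympD[OF symp_rtranclp[OF sym] that] .
    show "?R x z" if "?R x y" "?R y z" for x y z
      using that by (rule rtranclp_trans)
    fix a assume a: "a \<in> leaf t"
    then have "a \<in> regular_part levi_example" by (simp add: leaf_def)
    then obtain z u where z: "z \<noteq> 0" "a = proj z" "simple_point z u" "a \<in> leaf u"
      by (rule regular_in_leaf)
    obtain U \<zeta> where U: "proj z \<in> U" and chart: "levi_chart levi_example U \<zeta>"
      and plaque: "\<And>p q. p \<in> U \<inter> leaf_line u \<Longrightarrow> q \<in> U \<inter> leaf_line u \<Longrightarrow> same_plaque levi_example p q"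
      by (rule adapted_levi_chart[OF z(3)]) blast
    have tu: "leaf_line t = leaf_line u"
      using a z(4) by (intro regular_leaf_line_cong[of a]) (auto simp: leaf_def)
    have "open U"
      using chart by (simp add: levi_chart_def holomorphic_coordinates_def)
    show "\<exists>T. openin (top_of_set (leaf t)) T \<and> a \<in> T \<and> (\<forall>x\<in>T. ?R a x)"
    proof (intro exI[of _ "leaf t \<inter> U"] conjI ballI)
      show "openin (top_of_set (leaf t)) (leaf t \<inter> U)"
        using \<open>open U\<close> by (simp add: openin_open_Int)
      show "a \<in> leaf t \<inter> U"
        using a U z by simp
      fix x assume "x \<in> leaf t \<inter> U"
      then have "same_plaque levi_example a x"
        using plaque[of a x] U z a tu by (simp add: leaf_def)
      then show "?R a x" by blast
    qed
  qed
  then show "q \<in> {q. ?R p q}" by simp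
qed

lemma all_leaves_hyperplanes_levi_example: "all_leaves_hyperplanes levi_example"
  unfolding all_leaves_hyperplanes_def levi_leaves_def
proof (intro ballI, elim imageE)
  fix L p assume L: "L = {q. (same_plaque levi_example)\<^sup>*\<^sup>* p q}" and "p \<in> regular_part levi_example"
  then obtain t where "p \<in> leaf t"
    by (rule_tac regular_in_leaf) auto
  then have L_eq: "L = leaf t"
    unfolding L by (rule levi_leaf_eq_leaf)
  show "closedin (top_of_set (regular_part levi_example)) L \<and> complex_hyperplane (closure L)"
    unfolding L_eq closure_leaf
    using closed_leaf_line[of t] complex_hyperplane_leaf_line[of t]
    by (simp add: leaf_def Int_commute closedin_closed_Int)
qed

text \<open>An equation that vanishes on an open set has zero differential there.\<close>

lemma not_submanifold_both:
  assumes "submanifold_near 3 H p" "open V" "p \<in> V" "V \<subseteq> H"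
  shows False
proof (rule submanifold_near_3E[OF assms(1)])
  fix U f assume U: "open U" "p \<in> U" and zero: "\<And>q. q \<in> U \<Longrightarrow> q \<in> H \<longleftrightarrow> f q = 0"
    and nd: "\<And>i w. affine_point i w \<in> H \<inter> U \<Longrightarrow>
      \<exists>h. frechet_derivative (\<lambda>v. f (affine_point i v)) (at w) h \<noteq> 0"
  obtain i w where iw: "p = affine_point i w"
    by (rule affine_point_surj)
  let ?B = "{v. affine_point i v \<in> U \<inter> V}"
  have B: "open ?B" "w \<in> ?B"
    using open_affine_vimage[OF open_Int[OF U(1) assms(2)]] U(2) assms(3) iw by auto
  have "f (affine_point i v) = 0" if "v \<in> ?B" for v
    using zero that assms(4) by auto
  then have "((\<lambda>v. f (affine_point i v)) has_derivative (\<lambda>_. 0)) (at w)"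
    by (intro has_derivative_transform_within_open[OF has_derivative_const B]) auto
  then have "frechet_derivative (\<lambda>v. f (affine_point i v)) (at w) = (\<lambda>_. 0)"
    by (simp add: frechet_derivative_at[symmetric])
  then show False
    using nd[of i w] iw U assms by auto
qed

text \<open>An open set contained in the union of lines would contain a regular point, by density of the leaves.\<close>

lemma has_real_dimension_levi_example: "has_real_dimension levi_example 3"
  unfolding has_real_dimension_def
proof (intro conjI allI impI notI)
  have "proj (leaf_vec 0 1 0) \<in> leaf 0"
    by (intro leaf_vec_in_leaf) auto
  then show "\<exists>p. submanifold_near 3 levi_example p"
    by (auto simp: leaf_def regular_part_def)
next
  fix e p assume e: "3 < e" and sub: "submanifold_near e levi_example p"
  have "e \<le> 4"
    using sub by (simp add: submanifold_near_def)
  then have "e = 4" using e by simp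
  with sub obtain U where U: "open U" "p \<in> U" "levi_example \<inter> U = U" and p: "p \<in> levi_example"
    by (auto simp: submanifold_near_def)
  obtain z t where "z \<noteq> 0" "p = proj z" "incidence z (of_real t) = 0"
    using p unfolding levi_example_def by blast
  then have "p \<in> closure (leaf t)"
    unfolding closure_leaf leaf_line_def by blast
  then obtain q where q: "q \<in> leaf t" "q \<in> U"
    using U(1,2) by (meson closure_iff_nhds_not_empty disjoint_iff subset_refl)
  then have "submanifold_near 3 levi_example q"
    by (simp add: leaf_def regular_part_def)
  then show False
    using not_submanifold_both[of levi_example q U] U q by blast
qed

lemma levi_flat_hypersurface_levi_example: "levi_flat_hypersurface levi_example"
  unfolding levi_flat_hypersurface_def
  using real_analytic_subvariety_levi_example has_real_dimension_levi_example levi_flat_levi_example by blast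

section \<open>Transcendence\<close>

text \<open>The conjugate variables are treated as independent, so that the polynomial can be continued holomorphically in
  the curve parameter.\<close>

definition bipolynomial ::
  "((nat^3) \<times> (nat^3)) set \<Rightarrow> (nat^3 \<Rightarrow> nat^3 \<Rightarrow> complex) \<Rightarrow> complex^3 \<Rightarrow> complex^3 \<Rightarrow> complex" where
  "bipolynomial I c z w = (\<Sum>(\<alpha>, \<beta>)\<in>I.
     c \<alpha> \<beta> * (\<Prod>j\<in>UNIV. (z $ j) ^ (\<alpha> $ j)) * (\<Prod>j\<in>UNIV. (w $ j) ^ (\<beta> $ j)))"

text \<open>Induction over the build-up of a polynomial, shared by continuity, holomorphy and the Laurent property.\<close>

lemma bipolynomial_closed:
  fixes P :: "('a \<Rightarrow> complex) \<Rightarrow> bool"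
  assumes const: "\<And>k. P (\<lambda>_. k)"
    and add: "\<And>f g. P f \<Longrightarrow> P g \<Longrightarrow> P (\<lambda>s. f s + g s)"
    and mult: "\<And>f g. P f \<Longrightarrow> P g \<Longrightarrow> P (\<lambda>s. f s * g s)"
    and Z: "\<And>j. P (\<lambda>s. Z s $ j)" and W: "\<And>j. P (\<lambda>s. W s $ j)" and fin: "finite I"
  shows "P (\<lambda>s. bipolynomial I c (Z s) (W s))"
proof -
  have power: "P (\<lambda>s. f s ^ n)" if "P f" for f n
    by (induction n) (use that const mult in auto)
  have prod: "P (\<lambda>s. \<Prod>j\<in>J. f j s)" if "finite J" "\<And>j. P (f j)" for f :: "3 \<Rightarrow> 'a \<Rightarrow> complex" and J
    using that(1) by (induction J rule: finite_induct) (use that(2) const mult in auto)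
  have sum: "P (\<lambda>s. \<Sum>x\<in>I. f x s)" if "\<And>x. P (f x)" for f
    using fin by (induction I rule: finite_induct) (use that const add in auto)
  show ?thesis
    unfolding bipolynomial_def case_prod_unfold by (intro sum mult prod power const Z W) auto
qed

definition laurent_in_exp :: "(complex \<Rightarrow> complex) \<Rightarrow> bool" where
  "laurent_in_exp f \<longleftrightarrow> (\<exists>m p. \<forall>s. exp (\<i> * s) ^ m * f s = poly p (exp (\<i> * s)))"

lemma laurent_const: "laurent_in_exp (\<lambda>_. k)"
  unfolding laurent_in_exp_def by (intro exI[of _ 0] exI[of _ "[:k:]"]) simp

lemma laurent_add:
  assumes "laurent_in_exp f" "laurent_in_exp g"
  shows "laurent_in_exp (\<lambda>s. f s + g s)"
proof -
  obtain m p n q where f: "\<And>s. exp (\<i> * s) ^ m * f s = poly p (exp (\<i> * s))"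
    and g: "\<And>s. exp (\<i> * s) ^ n * g s = poly q (exp (\<i> * s))"
    using assms unfolding laurent_in_exp_def by blast
  have "exp (\<i> * s) ^ (m + n) * (f s + g s) = poly (monom 1 n * p + monom 1 m * q) (exp (\<i> * s))" for s
    by (simp add: poly_monom power_add f[symmetric] g[symmetric] algebra_simps)
  then show ?thesis
    unfolding laurent_in_exp_def by blast
qed

lemma laurent_mult:
  assumes "laurent_in_exp f" "laurent_in_exp g"
  shows "laurent_in_exp (\<lambda>s. f s * g s)"
proof -
  obtain m p n q where f: "\<And>s. exp (\<i> * s) ^ m * f s = poly p (exp (\<i> * s))"
    and g: "\<And>s. exp (\<i> * s) ^ n * g s = poly q (exp (\<i> * s))"
    using assms unfolding laurent_in_exp_def by blast
  have "exp (\<i> * s) ^ (m + n) * (f s * g s) = poly (p * q) (exp (\<i> * s))" for s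
    by (simp add: power_add f[symmetric] g[symmetric] algebra_simps)
  then show ?thesis
    unfolding laurent_in_exp_def by blast
qed

lemma laurent_cos: "laurent_in_exp cos"
proof -
  have "exp (\<i> * s) ^ 1 * cos s = poly [:1 / 2, 0, 1 / 2:] (exp (\<i> * s))" for s
    by (simp add: cos_exp_eq exp_minus field_simps power2_eq_square)
  then show ?thesis
    unfolding laurent_in_exp_def by blast
qed

lemma laurent_sin: "laurent_in_exp sin"
proof -
  have "exp (\<i> * s) ^ 1 * sin s = poly [:- 1 / (2 * \<i>), 0, 1 / (2 * \<i>):] (exp (\<i> * s))" for s
    by (simp add: sin_exp_eq exp_minus field_simps power2_eq_square)
  then show ?thesis
    unfolding laurent_in_exp_def by blast
qed

lemma laurent_eq_0:
  assumes f: "laurent_in_exp f" and inf: "infinite ((\<lambda>s. exp (\<i> * s)) ` {s. f s = 0})"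
  shows "f s = 0"
proof -
  obtain m p where p: "\<And>s. exp (\<i> * s) ^ m * f s = poly p (exp (\<i> * s))"
    using f unfolding laurent_in_exp_def by blast
  have "(\<lambda>s. exp (\<i> * s)) ` {s. f s = 0} \<subseteq> {x. poly p x = 0}"
    using p by (auto simp flip: p)
  then have "infinite {x. poly p x = 0}"
    using inf finite_subset by blast
  then have "p = 0"
    using poly_roots_finite by blast
  then show ?thesis
    using p[of s] by simp
qed

lemma entire_eq_0_if_zero_on_reals:
  assumes f: "f holomorphic_on UNIV" and zero: "\<And>t. f (complex_of_real t) = 0"
  shows "f s = 0"
proof (rule analytic_continuation[OF f, of "range complex_of_real" 0])
  show "(0::complex) islimpt range complex_of_real"
    unfolding islimpt_approachable
  proof (intro allI impI)
    fix e :: real assume "e > 0"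
    then show "\<exists>x'\<in>range complex_of_real. x' \<noteq> 0 \<and> dist x' 0 < e"
      by (intro bexI[OF _ rangeI[of complex_of_real "e / 2"]]) auto
  qed
qed (use zero in \<open>auto intro: convex_connected\<close>)

text \<open>The points of the line with coordinates \<open>(cos s, sin s, - \<eta>)\<close>.\<close>

definition pencil_vec :: "complex \<Rightarrow> complex \<Rightarrow> complex \<Rightarrow> complex \<Rightarrow> complex^3" where
  "pencil_vec \<eta> s \<mu> \<nu> = vector [\<nu> * \<eta> * cos s - \<mu> * sin s, \<nu> * \<eta> * sin s + \<mu> * cos s, \<nu>]"

lemma leaf_vec_pencil_vec: "leaf_vec t \<mu> \<nu> = pencil_vec (sin (cos (of_real t))) (of_real t) \<mu> \<nu>"
  by (simp add: leaf_vec_def pencil_vec_def)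

lemma pencil_vec_closed:
  fixes P :: "(complex \<Rightarrow> complex) \<Rightarrow> bool"
  assumes const: "\<And>k. P (\<lambda>_. k)"
    and add: "\<And>f g. P f \<Longrightarrow> P g \<Longrightarrow> P (\<lambda>s. f s + g s)"
    and mult: "\<And>f g. P f \<Longrightarrow> P g \<Longrightarrow> P (\<lambda>s. f s * g s)"
    and trig: "P cos" "P sin" and \<eta>: "P \<eta>"
  shows "P (\<lambda>s. pencil_vec (\<eta> s) s \<mu> \<nu> $ j)"
proof -
  have 1: "P (\<lambda>s. (\<nu> * \<eta> s) * cos s + (- \<mu>) * sin s)" and 2: "P (\<lambda>s. (\<nu> * \<eta> s) * sin s + \<mu> * cos s)"
    by (intro add mult const trig \<eta>)+
  consider "j = 1" | "j = 2" | "j = 3"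
    using exhaust_3[of j] by blast
  then show ?thesis
    by cases (use 1 2 const in \<open>simp_all add: pencil_vec_def\<close>)
qed

text \<open>Let \<open>sin w\<^sub>0 = \<eta>\<close> and \<open>cos (x n) = w\<^sub>0 + 2 \<pi> n\<close>. Then \<open>sin
  (cos (x n)) = \<eta>\<close> for all \<open>n\<close>, while the numbers \<open>exp (\<i> x n)\<close> are
  distinct, so for fixed \<open>\<eta>\<close> the Laurent polynomial has infinitely many zeros.\<close>

lemma vanishing_with_free_height:
  assumes fin: "finite I"
    and zero: "\<And>t. bipolynomial I c (leaf_vec t \<mu> \<nu>) (leaf_vec t \<mu>' \<nu>') = 0"
  shows "bipolynomial I c (pencil_vec \<eta> s \<mu> \<nu>) (pencil_vec \<eta> s \<mu>' \<nu>') = 0"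
proof -
  let ?h = "\<lambda>s. sin (cos s)"
  have entire: "bipolynomial I c (pencil_vec (?h s) s \<mu> \<nu>) (pencil_vec (?h s) s \<mu>' \<nu>') = 0" for s
  proof (rule entire_eq_0_if_zero_on_reals[where
        f = "\<lambda>s. bipolynomial I c (pencil_vec (?h s) s \<mu> \<nu>) (pencil_vec (?h s) s \<mu>' \<nu>')"])
    have component: "(\<lambda>s. pencil_vec (?h s) s \<mu> \<nu> $ j) holomorphic_on UNIV" for \<mu> \<nu> j
      by (rule pencil_vec_closed[where P = "\<lambda>f. f holomorphic_on UNIV" and \<eta> = ?h]) (auto intro!: holomorphic_intros)
    show "(\<lambda>s. bipolynomial I c (pencil_vec (?h s) s \<mu> \<nu>) (pencil_vec (?h s) s \<mu>' \<nu>')) holomorphic_on UNIV"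
      by (rule bipolynomial_closed[where P = "\<lambda>f. f holomorphic_on UNIV"])
        (auto intro!: holomorphic_intros component fin)
    show "bipolynomial I c (pencil_vec (?h (of_real t)) (of_real t) \<mu> \<nu>) (pencil_vec (?h (of_real t)) (of_real t) \<mu>' \<nu>') = 0" for t
      using zero[of t] by (simp add: leaf_vec_pencil_vec)
  qed
  define w\<^sub>0 where "w\<^sub>0 = Arcsin \<eta>"
  \<comment> \<open>The cosine takes every complex value, also far outside the unit interval.\<close>
  define x where "x n = Arccos (w\<^sub>0 + of_real (2 * real n * pi))" for n :: nat
  have cos_x: "cos (x n) = w\<^sub>0 + of_real (2 * real n * pi)" for n
    by (simp add: x_def)
  have sin_cos_x: "sin (cos (x n)) = \<eta>" for n
  proof -
    have "sin (complex_of_real (2 * real n * pi)) = 0" "cos (complex_of_real (2 * real n * pi)) = 1"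
      by (simp_all only: sin_of_real cos_of_real sin_2npi cos_2npi of_real_0 of_real_1)
    then show ?thesis
      unfolding cos_x sin_add by (simp add: w\<^sub>0_def)
  qed
  have inj: "inj (\<lambda>n. exp (\<i> * x n))"
  proof (rule injI)
    fix n m assume "exp (\<i> * x n) = exp (\<i> * x m)"
    then have "cos (x n) = cos (x m)"
      by (simp add: cos_exp_eq exp_minus)
    then show "n = m"
      unfolding cos_x by simp
  qed
  show ?thesis
  proof (rule laurent_eq_0[where
        f = "\<lambda>s. bipolynomial I c (pencil_vec \<eta> s \<mu> \<nu>) (pencil_vec \<eta> s \<mu>' \<nu>')"])
    show "laurent_in_exp (\<lambda>s. bipolynomial I c (pencil_vec \<eta> s \<mu> \<nu>) (pencil_vec \<eta> s \<mu>' \<nu>'))"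
      by (intro bipolynomial_closed[where P = laurent_in_exp] fin
          pencil_vec_closed[where P = laurent_in_exp] laurent_const laurent_add laurent_mult laurent_cos laurent_sin)
    have "range (\<lambda>n. exp (\<i> * x n)) \<subseteq> (\<lambda>s. exp (\<i> * s)) ` {s. bipolynomial I c (pencil_vec \<eta> s \<mu> \<nu>) (pencil_vec \<eta> s \<mu>' \<nu>') = 0}"
      using entire[of "x _"] unfolding sin_cos_x by auto
    then show "infinite ((\<lambda>s. exp (\<i> * s)) ` {s. bipolynomial I c (pencil_vec \<eta> s \<mu> \<nu>) (pencil_vec \<eta> s \<mu>' \<nu>') = 0})"
      using range_inj_infinite[OF inj] finite_subset by blast
  qed
qed

definition cnj_vec :: "complex^3 \<Rightarrow> complex^3" where
  "cnj_vec z = (\<chi> j. cnj (z $ j))"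

lemma cnj_pencil_vec:
  "cnj_vec (pencil_vec (of_real \<eta>) (of_real t) \<mu> \<nu>) = pencil_vec (of_real \<eta>) (of_real t) (cnj \<mu>) (cnj \<nu>)"
  by (simp add: cnj_vec_def pencil_vec_def vec_eq_iff forall_3 cnj_sin cnj_cos)

lemma continuous_zero_limit:
  fixes f :: "real \<Rightarrow> complex"
  assumes "continuous_on UNIV f" "\<And>e. e \<noteq> 0 \<Longrightarrow> f e = 0"
  shows "f 0 = 0"
proof -
  have "(f \<longlongrightarrow> f 0) (at 0)"
    using assms(1) by (simp add: continuous_on_def)
  moreover have "(f \<longlongrightarrow> 0) (at 0)"
    by (rule tendsto_eventually) (use assms(2) in \<open>simp add: eventually_at_filter\<close>)
  ultimately show ?thesis
    by (rule tendsto_unique[rotated]) simp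
qed

text \<open>The line is the one through \<open>z\<close> and its complex conjugate; the angle \<open>t\<close> of its normal
  makes the imaginary part of the affine point orthogonal to \<open>(cos t, sin t)\<close>.\<close>

lemma pencil_vec_covers:
  assumes z3: "z $ 3 \<noteq> 0" and nonreal: "Im (z $ 1 / z $ 3) \<noteq> 0"
  obtains \<eta> t :: real and \<mu> where "z = pencil_vec (of_real \<eta>) (of_real t) \<mu> (z $ 3)" "Im (\<mu> / z $ 3) \<noteq> 0"
proof -
  define a b where "a = z $ 1 / z $ 3" and "b = z $ 2 / z $ 3"
  obtain t where "incidence (vector [of_real (Im a), of_real (Im b), of_real 0]) (of_real t) = 0"
    using real_point_root[of "Im a" "Im b" 0] by blast
  then have "complex_of_real (Im a * cos t + Im b * sin t) = 0"
    by (simp add: incidence_eq cos_of_real sin_of_real)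
  then have t: "Im a * cos t + Im b * sin t = 0"
    by (simp only: of_real_eq_0_iff)
  define c s where "c = complex_of_real (cos t)" and "s = complex_of_real (sin t)"
  have cs: "cos (complex_of_real t) = c" "sin (complex_of_real t) = s"
    by (simp_all add: c_def s_def cos_of_real sin_of_real)
  have sq: "c * c + s * s = 1"
    using cos_sin_sq[of "of_real t"] unfolding cs .
  define \<eta> where "\<eta> = Re a * cos t + Re b * sin t"
  have \<eta>: "a * c + b * s = of_real \<eta>"
    using t by (simp add: complex_eq_iff c_def s_def \<eta>_def)
  define \<mu> where "\<mu> = z $ 3 * (b * c - a * s)"
  have z12: "z $ 1 = z $ 3 * a" "z $ 2 = z $ 3 * b"
    using z3 by (simp_all add: a_def b_def)
  have "z $ 3 * of_real \<eta> * c - \<mu> * s = z $ 3 * (a * (c * c + s * s))"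
    unfolding \<eta>[symmetric] \<mu>_def by (simp add: algebra_simps)
  moreover have "z $ 3 * of_real \<eta> * s + \<mu> * c = z $ 3 * (b * (c * c + s * s))"
    unfolding \<eta>[symmetric] \<mu>_def by (simp add: algebra_simps)
  ultimately have "z = pencil_vec (of_real \<eta>) (of_real t) \<mu> (z $ 3)"
    unfolding pencil_vec_def vec_eq_iff forall_3 cs sq using z12 by simp
  moreover have "Im (\<mu> / z $ 3) \<noteq> 0"
  proof
    assume "Im (\<mu> / z $ 3) = 0"
    moreover have "\<mu> / z $ 3 = b * c - a * s"
      using z3 by (simp add: \<mu>_def)
    ultimately have "Im b * cos t - Im a * sin t = 0"
      by (simp add: c_def s_def)
    moreover have "Im a = cos t * (Im a * cos t + Im b * sin t) - sin t * (Im b * cos t - Im a * sin t)"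
    proof -
      have "cos t * (Im a * cos t + Im b * sin t) - sin t * (Im b * cos t - Im a * sin t) = Im a * (cos t * cos t + sin t * sin t)"
        by algebra
      then show ?thesis by simp
    qed
    ultimately have "Im a = 0"
      using t by simp
    with nonreal show False by (simp add: a_def)
  qed
  ultimately show ?thesis by (rule that)
qed

text \<open>The defining polynomial vanishes on the nonreal points of every \<open>L\<^sub>t\<close>, hence on the nonreal
  points of every real line other than the line at infinity, and by continuity everywhere.\<close>

lemma algebraic_hull_of_regular_part:
  assumes V: "real_algebraic_subvariety V" and sub: "regular_part levi_example \<subseteq> V"
  shows "V = UNIV"
proof -
  obtain \<rho> where poly: "polynomial_z_zbar \<rho>" and bihom: "bihomogeneous \<rho>"
    and V_eq: "V = {proj z | z. z \<noteq> 0 \<and> \<rho> z = 0}"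
    using V unfolding real_algebraic_subvariety_def by blast
  obtain I c where fin: "finite I" and \<rho>_sum: "\<And>z. \<rho> z = (\<Sum>(\<alpha>, \<beta>)\<in>I.
      c \<alpha> \<beta> * (\<Prod>j\<in>UNIV. (z $ j) ^ (\<alpha> $ j)) * (\<Prod>j\<in>UNIV. cnj (z $ j) ^ (\<beta> $ j)))"
    using poly unfolding polynomial_z_zbar_def by blast
  have \<rho>: "\<rho> z = bipolynomial I c z (cnj_vec z)" for z
    by (simp add: \<rho>_sum bipolynomial_def cnj_vec_def)
  have on_V: "\<rho> z = 0" if z: "z \<noteq> 0" "proj z \<in> V" for z
  proof -
    obtain y where y: "proj y = proj z" "y \<noteq> 0" "\<rho> y = 0"
      using z unfolding V_eq by auto
    then obtain d where "z = d *s y"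
      using proj_eqE[OF y(1,2) z(1)] by blast
    then show ?thesis
      using bihom y(3) unfolding bihomogeneous_def by auto
  qed
  have on_pencil: "\<rho> (pencil_vec (of_real \<eta>) (of_real t) \<mu> \<nu>) = 0" if "\<nu> \<noteq> 0" "Im (\<mu> / \<nu>) \<noteq> 0" for \<eta> t :: real and \<mu> \<nu>
  proof -
    have "bipolynomial I c (leaf_vec t \<mu> \<nu>) (leaf_vec t (cnj \<mu>) (cnj \<nu>)) = 0" for t
    proof -
      have "\<mu> \<noteq> 0" using that by auto
      then have "leaf_vec t \<mu> \<nu> \<noteq> 0" "proj (leaf_vec t \<mu> \<nu>) \<in> V"
        using leaf_vec_in_leaf[of \<mu> \<nu> t] that sub by (auto simp: leaf_def leaf_vec_eq_0_iff)
      then have "\<rho> (leaf_vec t \<mu> \<nu>) = 0"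
        by (rule on_V)
      moreover have "cnj_vec (leaf_vec t \<mu> \<nu>) = leaf_vec t (cnj \<mu>) (cnj \<nu>)"
        using cnj_pencil_vec[of "sin (cos t)" t \<mu> \<nu>] by (simp add: leaf_vec_pencil_vec sin_cos_real)
      ultimately show ?thesis by (simp add: \<rho>)
    qed
    from vanishing_with_free_height[OF fin this] show ?thesis
      unfolding \<rho> cnj_pencil_vec .
  qed
  have \<rho>_line_cont: "continuous_on UNIV (\<lambda>e::real. \<rho> (z + of_real e *s y))" for z y
    unfolding \<rho>
    by (intro bipolynomial_closed[where P = "\<lambda>f. continuous_on UNIV f"] fin)
      (auto simp: cnj_vec_def intro!: continuous_intros)
  have generic: "\<rho> z = 0" if z3: "z $ 3 \<noteq> 0" and nonreal: "Im (z $ 1 / z $ 3) \<noteq> 0" for z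
  proof -
    obtain \<eta> t :: real and \<mu> where z: "z = pencil_vec (of_real \<eta>) (of_real t) \<mu> (z $ 3)" "Im (\<mu> / z $ 3) \<noteq> 0"
      by (rule pencil_vec_covers[OF z3 nonreal])
    have "\<rho> z = \<rho> (pencil_vec (of_real \<eta>) (of_real t) \<mu> (z $ 3))"
      by (rule arg_cong[OF z(1)])
    also have "\<dots> = 0"
      by (rule on_pencil[OF z3 z(2)])
    finally show ?thesis .
  qed
  have finite_part: "\<rho> z = 0" if z3: "z $ 3 \<noteq> 0" for z
  proof (cases "Im (z $ 1 / z $ 3) = 0")
    case True
    \<comment> \<open>Adding \<open>e\<close> times this vector adds \<open>e\<close> to the imaginary part of \<open>z $ 1 / z $ 3\<close>.\<close>
    define y where "y = (\<i> * z $ 3) *s (axis 1 1 :: complex^3)"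
    have "\<rho> (z + of_real e *s y) = 0" if e: "e \<noteq> 0" for e :: real
    proof (rule generic)
      have x: "(z + of_real e *s y) $ 3 = z $ 3" "(z + of_real e *s y) $ 1 = z $ 1 + of_real e * \<i> * z $ 3"
        by (simp_all add: y_def axis_def)
      then have "(z + of_real e *s y) $ 1 / (z + of_real e *s y) $ 3 = z $ 1 / z $ 3 + of_real e * \<i>"
        unfolding x using z3 by (simp add: add_divide_distrib)
      then show "Im ((z + of_real e *s y) $ 1 / (z + of_real e *s y) $ 3) \<noteq> 0"
        using True e by simp
      show "(z + of_real e *s y) $ 3 \<noteq> 0"
        unfolding x by (rule z3)
    qed
    from continuous_zero_limit[OF \<rho>_line_cont[of z y] this] show ?thesis
      by simp
  qed (rule generic[OF z3])
  have "\<rho> z = 0" for z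
  proof (cases "z $ 3 = 0")
    case True
    have "\<rho> (z + of_real e *s axis 3 1) = 0" if "e \<noteq> 0" for e :: real
      using that True by (intro finite_part) (simp add: axis_def)
    from continuous_zero_limit[OF \<rho>_line_cont this] show ?thesis
      by simp
  qed (rule finite_part)
  then have "p \<in> V" for p
    using proj_surj[of p] unfolding V_eq by blast
  then show ?thesis by blast
qed

theorem theorem1p5:
  shows "\<exists>H :: cp2 set.
    levi_flat_hypersurface H \<and>
    all_leaves_hyperplanes H \<and>
    (\<forall>V. real_algebraic_subvariety V \<and> V \<noteq> UNIV \<longrightarrow>
       \<not> regular_part H \<subseteq> V \<and> \<not> H \<subseteq> V)"
proof (intro exI conjI allI impI)
  show "levi_flat_hypersurface levi_example"
    by (rule levi_flat_hypersurface_levi_example)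
  show "all_leaves_hyperplanes levi_example"
    by (rule all_leaves_hyperplanes_levi_example)
  fix V assume V: "real_algebraic_subvariety V \<and> V \<noteq> UNIV"
  then show regular: "\<not> regular_part levi_example \<subseteq> V"
    using algebraic_hull_of_regular_part by blast
  have "regular_part levi_example \<subseteq> levi_example"
    by (auto simp: regular_part_def submanifold_near_def)
  with regular show "\<not> levi_example \<subseteq> V"
    by blast
qed

end
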